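(* For every $\beta\in[1,2]$ there exists a Nevanlinna domain $G\subset\mathbb C$ such that $\dim_H(\partial G)=\beta$.
   Context: $\mathbb D=\{z\in\mathbb C:|z|<1\}$, $\mathbb T=\partial\mathbb D$. For an open set $U$, $H^\infty(U)$ is the set of bounded holomorphic functions on $U$. A bounded simply connected domain $G\subset\mathbb C$ is called a Nevanlinna domain if there exist $u,v\in H^\infty(G)$ with $v\not\equiv 0$ such that $\overline z=u(z)/v(z)$ almost everywhere on $\partial G$ in the sense of conformal mappings, i.e. for a conformal mapping $f$ of $\mathbb D$ onto $G$ the equality of angular boundary values $\overline{f(\zeta)}=\dfrac{(u\circ f)(\zeta)}{(v\circ f)(\zeta)}$ holds for almost all $\zeta\in\mathbb T$ with respect to Lebesgue measure (the definition does not depend on the choice of $f$). $\dim_H$ denotes the Hausdorff dimension. *)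

theory Defs
  imports "HOL-Analysis.Analysis"
begin

section \<open>Hausdorff dimension\<close>

text \<open>
  The power \<open>(diam U)\<^sup>s\<close> with the usual conventions of Hausdorff measure theory: the empty set
  contributes 0, and for \<open>s = 0\<close> every nonempty set contributes 1. The case distinction is
  needed because \<open>0 powr 0 = 0\<close>.
\<close>

definition diam_pow :: "real \<Rightarrow> 'a::metric_space set \<Rightarrow> ennreal" where
  "diam_pow s U =
     (if U = {} then 0 else if s = 0 then 1 else ennreal (diameter U powr s))"

text \<open>
  Boundedness is required explicitly because \<^const>\<open>diameter\<close> is unspecified on unbounded sets.
\<close>

definition hausdorff_content :: "real \<Rightarrow> real \<Rightarrow> 'a::metric_space set \<Rightarrow> ennreal" where
  "hausdorff_content s \<delta> A =
     (INF U \<in> {U :: nat \<Rightarrow> 'a set.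
                 A \<subseteq> (\<Union>i. U i) \<and> (\<forall>i. bounded (U i) \<and> diameter (U i) \<le> \<delta>)}.
        \<Sum>i. diam_pow s (U i))"

definition hausdorff_measure :: "real \<Rightarrow> 'a::metric_space set \<Rightarrow> ennreal" where
  "hausdorff_measure s A = (SUP \<delta> \<in> {0<..}. hausdorff_content s \<delta> A)"

definition hausdorff_dim :: "'a::metric_space set \<Rightarrow> ereal" where
  "hausdorff_dim A = (INF s \<in> {s. 0 \<le> s \<and> hausdorff_measure s A = 0}. ereal s)"


section \<open>Angular boundary values\<close>

text \<open>
  For \<open>M \<le> 1\<close> the region is empty when \<open>norm \<zeta> = 1\<close>, hence the restriction to \<open>M > 1\<close> below.
\<close>

definition stolz_region :: "real \<Rightarrow> complex \<Rightarrow> complex set" where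
  "stolz_region M \<zeta> = {z \<in> ball 0 1. norm (z - \<zeta>) < M * (1 - norm z)}"

definition has_angular_limit :: "(complex \<Rightarrow> complex) \<Rightarrow> complex \<Rightarrow> complex \<Rightarrow> bool" where
  "has_angular_limit g \<zeta> l \<longleftrightarrow>
     (\<forall>M>1. (g \<longlongrightarrow> l) (at \<zeta> within stolz_region M \<zeta>))"


section \<open>Nevanlinna domains\<close>

definition H_infinity :: "complex set \<Rightarrow> (complex \<Rightarrow> complex) set" where
  "H_infinity U = {h. h holomorphic_on U \<and> bounded (h ` U)}"

definition conformal_map_of_disc_onto :: "(complex \<Rightarrow> complex) \<Rightarrow> complex set \<Rightarrow> bool" where
  "conformal_map_of_disc_onto f G \<longleftrightarrow>
     f holomorphic_on ball 0 1 \<and> inj_on f (ball 0 1) \<and> f ` ball 0 1 = G"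

text \<open>
  The circle is parametrized by \<^const>\<open>cis\<close> on \<open>[0, 2\<pi>]\<close>. The angular boundary values involved exist
  almost everywhere by Fatou's theorem, and that of \<open>v \<circ> f\<close> is nonzero almost everywhere by the
  uniqueness theorem of F. and M. Riesz; \<open>c \<noteq> 0\<close> is stated since division by zero is total.
\<close>

definition conj_eq_quotient_ae ::
    "(complex \<Rightarrow> complex) \<Rightarrow> (complex \<Rightarrow> complex) \<Rightarrow> (complex \<Rightarrow> complex) \<Rightarrow> bool" where
  "conj_eq_quotient_ae f u v \<longleftrightarrow>
     (AE t in lebesgue_on {0..2 * pi}. \<exists>a b c.
        has_angular_limit f (cis t) a \<and>
        has_angular_limit (u \<circ> f) (cis t) b \<and>
        has_angular_limit (v \<circ> f) (cis t) c \<and>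
        c \<noteq> 0 \<and> cnj a = b / c)"

text \<open>
  The condition does not depend on the conformal map \<open>f\<close>, so it is required of one such map
  (which exists by the Riemann mapping theorem).
\<close>

definition nevanlinna_domain :: "complex set \<Rightarrow> bool" where
  "nevanlinna_domain G \<longleftrightarrow>
     open G \<and> connected G \<and> G \<noteq> {} \<and> bounded G \<and> simply_connected G \<and>
     (\<exists>u \<in> H_infinity G. \<exists>v \<in> H_infinity G.
        (\<exists>z\<in>G. v z \<noteq> 0) \<and>
        (\<exists>f. conformal_map_of_disc_onto f G \<and> conj_eq_quotient_ae f u v))"

end

theory Submission
  imports Defs "HOL-Complex_Analysis.Complex_Analysis" "HOL-Real_Asymp.Real_Asymp"
begin

text \<open>
The domain is a comb: the unit disc with countably many long thin teeth, which accumulate on a set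
of dimension \<open>\<beta>\<close>. It is the image of the disc under
  \<open>f z = z + (\<Sum>n. \<zeta>\<^sub>n * a\<^sub>n * tooth N\<^sub>n e\<^sub>n (1 - cnj \<zeta>\<^sub>n * z))\<close>,
where \<open>\<zeta>\<^sub>n\<close> lies on the unit circle and \<open>tooth N e u\<close> is the average of the \<open>N\<close> kernels
\<open>s / (s + u)\<close> with \<open>s = e, e/2, e/4, \<dots>\<close>. One kernel maps the half plane \<open>Re u > 0\<close> onto the disc with
diameter \<open>[0, 1]\<close>, and its values leave a neighbourhood of 0 only for \<open>u\<close> at most of about size \<open>s\<close>; averaging
over geometrically spaced scales presses the image to within \<open>4 / N\<close> of the segment \<open>[0, 1]\<close>. The
\<open>n\<close>-th summand therefore pulls a tiny arc at \<open>\<zeta>\<^sub>n\<close> out into a thin tooth of length about 1.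
The factor \<open>a\<^sub>n\<close> is the derivative at \<open>\<zeta>\<^sub>n\<close> of the sum of the preceding terms, so that the tooth leaves
the boundary in the normal direction.

Univalence. A tooth can be added without destroying univalence, however small \<open>e\<^sub>n\<close> is. Close to
\<open>\<zeta>\<^sub>n\<close> the divided difference of the new map is a multiple of \<open>q + (\<Sum>i. m\<^sub>i / ((s\<^sub>i + u) * (s\<^sub>i + v)))\<close> with
positive \<open>m\<^sub>i\<close>, \<open>s\<^sub>i\<close> and \<open>q\<close> close to 1. The disc lies strictly inside its tangent half plane, and this
convexity keeps the expression away from 0 (\<open>perturbed_kernel_sum_nonzero\<close>). Points on different
teeth have different images since the teeth are nearly radial and point in different directions
(\<open>tooth_separation\<close>), and in the remaining case the new term is a small perturbation. So all partial
sums are univalent (\<open>dd_nonzero\<close>), and Hurwitz's theorem passes this on to \<open>f\<close>.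

Nevanlinna property. On the circle the conjugate of a kernel is a rational function with one pole
in the disc, which a Blaschke factor removes. As the \<open>e\<^sub>n\<close> tend to 0 very fast, the Blaschke product
\<open>B\<close> of these factors converges, the conjugate of \<open>f\<close> equals \<open>U / B\<close> almost everywhere with \<open>U\<close> bounded
by the maximum principle, and away from the countably many centres all the angular limits
exist by uniform convergence on Stolz regions (\<open>tame_angular_limit\<close>, \<open>nevanlinna_G\<close>).

Dimension. For any compact \<open>C\<close> on the circle with dense complement, the centres can be chosen to
accumulate exactly at \<open>C\<close>. The boundary then consists of countably many Lipschitz images of subsets
of the circle, which have dimension at most 1, and the set \<open>K\<close> of the points
\<open>P \<xi> t = f \<xi> + t * \<xi> * f' \<xi>\<close> with \<open>\<xi>\<close> in \<open>C\<close> and \<open>t\<close> in \<open>[0, 1]\<close> at which the teeth accumulate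
(\<open>K_subset_frontier\<close>, \<open>frontier_subset\<close>). The parametrization \<open>P\<close> is bi-Lipschitz, so \<open>K\<close> has the
dimension of \<open>C \<times> [0, 1]\<close>. A Cantor set \<open>C\<close> of dimension \<open>\<beta> - 1\<close>, given as the closure of the range of
an explicit step function (\<open>stair\<close>), yields \<open>\<beta>\<close>. For \<open>\<beta> = 1\<close> a single point \<open>C\<close> suffices.
\<close>

section \<open>Null sets of Hausdorff measure and the mass distribution principle\<close>

lemma diameter_le_dist:
  fixes S :: "'a::metric_space set"
  assumes "0 \<le> d" "\<And>x y. x \<in> S \<Longrightarrow> y \<in> S \<Longrightarrow> dist x y \<le> d"
  shows "diameter S \<le> d"
  unfolding diameter_def using assms by (auto intro!: cSUP_least)

lemma bounded_if_dist_le: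
  fixes S :: "'a::metric_space set"
  assumes "\<And>x y. x \<in> S \<Longrightarrow> y \<in> S \<Longrightarrow> dist x y \<le> d"
  shows "bounded S"
  using assms unfolding bounded_def by (metis all_not_in_conv)

lemma hausdorff_measure_eq_0_iff:
  "hausdorff_measure s A = 0 \<longleftrightarrow>
     (\<forall>\<delta>>0. \<forall>\<epsilon>>0. \<exists>U. A \<subseteq> (\<Union>i. U i) \<and> (\<forall>i::nat. bounded (U i) \<and> diameter (U i) \<le> \<delta>) \<and> (\<Sum>i. diam_pow s (U i)) < ennreal \<epsilon>)"
proof -
  have "hausdorff_content s \<delta> A = 0 \<longleftrightarrow>
     (\<forall>\<epsilon>>0. \<exists>U. A \<subseteq> (\<Union>i. U i) \<and> (\<forall>i::nat. bounded (U i) \<and> diameter (U i) \<le> \<delta>) \<and> (\<Sum>i. diam_pow s (U i)) < ennreal \<epsilon>)" for \<delta>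
  proof
    assume 0: "hausdorff_content s \<delta> A = 0"
    show "\<forall>\<epsilon>>0. \<exists>U. A \<subseteq> (\<Union>i. U i) \<and> (\<forall>i::nat. bounded (U i) \<and> diameter (U i) \<le> \<delta>) \<and> (\<Sum>i. diam_pow s (U i)) < ennreal \<epsilon>"
    proof (intro allI impI)
      fix \<epsilon> :: real assume "0 < \<epsilon>"
      then have "hausdorff_content s \<delta> A < ennreal \<epsilon>" using 0 by simp
      then show "\<exists>U. A \<subseteq> (\<Union>i. U i) \<and> (\<forall>i::nat. bounded (U i) \<and> diameter (U i) \<le> \<delta>) \<and> (\<Sum>i. diam_pow s (U i)) < ennreal \<epsilon>"
        unfolding hausdorff_content_def INF_less_iff by blast
    qed
  next
    assume *: "\<forall>\<epsilon>>0. \<exists>U. A \<subseteq> (\<Union>i. U i) \<and> (\<forall>i::nat. bounded (U i) \<and> diameter (U i) \<le> \<delta>) \<and> (\<Sum>i. diam_pow s (U i)) < ennreal \<epsilon>"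
    have "hausdorff_content s \<delta> A \<le> 0 + ennreal \<epsilon>" if \<epsilon>: "0 < \<epsilon>" for \<epsilon>
    proof -
      obtain U where "A \<subseteq> (\<Union>i. U i)" "\<forall>i::nat. bounded (U i) \<and> diameter (U i) \<le> \<delta>" "(\<Sum>i. diam_pow s (U i)) < ennreal \<epsilon>"
        using *[rule_format, OF \<epsilon>] by meson
      then show ?thesis unfolding hausdorff_content_def by (intro INF_lower2[of U]) auto
    qed
    then have "hausdorff_content s \<delta> A \<le> 0" by (rule ennreal_le_epsilon)
    then show "hausdorff_content s \<delta> A = 0" by simp
  qed
  moreover have "hausdorff_measure s A = 0 \<longleftrightarrow> (\<forall>\<delta>>0. hausdorff_content s \<delta> A = 0)"
    unfolding hausdorff_measure_def
    by (metis (no_types, lifting) SUP_le_iff greaterThan_iff le_zero_eq zero_le SUP_bot_conv(1) bot_ennreal)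
  ultimately show ?thesis by simp
qed

lemma hausdorff_null_mono: "hausdorff_measure s B = 0 \<Longrightarrow> A \<subseteq> B \<Longrightarrow> hausdorff_measure s A = 0"
  unfolding hausdorff_measure_eq_0_iff by (meson order_trans)

text \<open>
Covers by sets of diameter at most 1 cost less for a larger exponent.
\<close>

lemma hausdorff_null_exponent_mono:
  fixes A :: "'a::metric_space set"
  assumes "hausdorff_measure s A = 0" "0 \<le> s" "s \<le> s'"
  shows "hausdorff_measure s' A = 0"
  unfolding hausdorff_measure_eq_0_iff
proof (intro allI impI)
  fix \<delta> \<epsilon> :: real assume "0 < \<delta>" "0 < \<epsilon>"
  then have "0 < min \<delta> 1" by simp
  then obtain U :: "nat \<Rightarrow> 'a set" where U: "A \<subseteq> (\<Union>i. U i)" "\<forall>i. bounded (U i) \<and> diameter (U i) \<le> min \<delta> 1" "(\<Sum>i. diam_pow s (U i)) < ennreal \<epsilon>"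
    using assms(1) \<open>0 < \<epsilon>\<close> unfolding hausdorff_measure_eq_0_iff by meson
  have "diam_pow s' (U i) \<le> diam_pow s (U i)" for i
  proof -
    have d: "0 \<le> diameter (U i)" "diameter (U i) \<le> 1" using U(2) diameter_ge_0 by auto
    have "diameter (U i) powr s' \<le> diameter (U i) powr s"
      using d assms(3) by (cases "diameter (U i) = 0") (auto intro: powr_mono')
    moreover have "diameter (U i) powr s' \<le> 1" using d assms by (intro powr_le1) auto
    ultimately show ?thesis using assms(2,3) by (auto simp: diam_pow_def ennreal_leI simp flip: ennreal_1)
  qed
  then have "(\<Sum>i. diam_pow s' (U i)) \<le> (\<Sum>i. diam_pow s (U i))" by (intro suminf_le) auto
  then show "\<exists>U. A \<subseteq> (\<Union>i. U i) \<and> (\<forall>i::nat. bounded (U i) \<and> diameter (U i) \<le> \<delta>) \<and> (\<Sum>i. diam_pow s' (U i)) < ennreal \<epsilon>"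
    using U by (intro exI[of _ U]) auto
qed

lemma hausdorff_null_UN:
  fixes A :: "nat \<Rightarrow> 'a::metric_space set"
  assumes "\<And>n. hausdorff_measure s (A n) = 0"
  shows "hausdorff_measure s (\<Union>n. A n) = 0"
  unfolding hausdorff_measure_eq_0_iff
proof (intro allI impI)
  fix \<delta> \<epsilon> :: real assume \<delta>: "0 < \<delta>" and \<epsilon>: "0 < \<epsilon>"
  have "\<forall>n. \<exists>U. A n \<subseteq> (\<Union>i. U i) \<and> (\<forall>i::nat. bounded (U i) \<and> diameter (U i) \<le> \<delta>) \<and> (\<Sum>i. diam_pow s (U i)) < ennreal (\<epsilon> / 2 * (1/2)^Suc n)"
  proof
    fix n
    have "0 < \<epsilon> / 2 * (1/2)^Suc n" using \<epsilon> by simp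
    then show "\<exists>U. A n \<subseteq> (\<Union>i. U i) \<and> (\<forall>i::nat. bounded (U i) \<and> diameter (U i) \<le> \<delta>) \<and> (\<Sum>i. diam_pow s (U i)) < ennreal (\<epsilon> / 2 * (1/2)^Suc n)"
      using assms[of n] \<delta> unfolding hausdorff_measure_eq_0_iff by meson
  qed
  then obtain U where U: "\<forall>n. A n \<subseteq> (\<Union>i. U n i) \<and> (\<forall>i::nat. bounded (U n i) \<and> diameter (U n i) \<le> \<delta>) \<and> (\<Sum>i. diam_pow s (U n i)) < ennreal (\<epsilon> / 2 * (1/2)^Suc n)"
    by (rule choice[THEN exE])
  define V where "V k = (\<lambda>(n, i). U n i) (prod_decode k)" for k
  have "(\<Sum>k. diam_pow s (V k)) = (\<Sum>k. (\<lambda>(n, i). diam_pow s (U n i)) (prod_decode k))"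
    by (simp add: V_def case_prod_beta)
  also have "\<dots> = (\<Sum>n. \<Sum>i. diam_pow s (U n i))" by (rule suminf_ennreal_2dimen) simp
  also have "\<dots> \<le> (\<Sum>n. ennreal (\<epsilon> / 2 * (1/2)^Suc n))" using U by (intro suminf_le) (auto intro: less_imp_le)
  also have "\<dots> = ennreal (\<epsilon> / 2)"
    using \<epsilon> sums_mult[OF power_half_series, of "\<epsilon> / 2"] by (intro suminf_ennreal_eq) auto
  also have "\<dots> < ennreal \<epsilon>" using \<epsilon> by (simp add: ennreal_lessI)
  finally have "(\<Sum>k. diam_pow s (V k)) < ennreal \<epsilon>" .
  moreover have "(\<Union>n. A n) \<subseteq> (\<Union>k. V k)"
  proof
    fix x assume "x \<in> (\<Union>n. A n)"
    then obtain n where "x \<in> A n" by blast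
    then obtain i where "x \<in> U n i" using U by blast
    then have "x \<in> V (prod_encode (n, i))" by (simp add: V_def)
    then show "x \<in> (\<Union>k. V k)" by blast
  qed
  moreover have "bounded (V k) \<and> diameter (V k) \<le> \<delta>" for k using U by (simp add: V_def case_prod_beta)
  ultimately show "\<exists>V. (\<Union>n. A n) \<subseteq> (\<Union>k. V k) \<and> (\<forall>k::nat. bounded (V k) \<and> diameter (V k) \<le> \<delta>) \<and> (\<Sum>k. diam_pow s (V k)) < ennreal \<epsilon>"
    by blast
qed

lemma hausdorff_null_Un:
  assumes "hausdorff_measure s A = 0" "hausdorff_measure s B = 0"
  shows "hausdorff_measure s (A \<union> B) = 0"
proof -
  have "hausdorff_measure s (\<Union>n::nat. if n = 0 then A else B) = 0" using assms by (intro hausdorff_null_UN) auto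
  moreover have "A \<union> B \<subseteq> (\<Union>n::nat. if n = 0 then A else B)"
  proof
    fix x assume "x \<in> A \<union> B"
    then show "x \<in> (\<Union>n::nat. if n = 0 then A else B)" by (cases "x \<in> A") (auto intro: exI[of _ 0] exI[of _ 1])
  qed
  ultimately show ?thesis by (rule hausdorff_null_mono)
qed

lemma hausdorff_null_lipschitz_image:
  fixes f :: "'a::metric_space \<Rightarrow> 'b::metric_space"
  assumes null: "hausdorff_measure s A = 0" and f: "L-lipschitz_on A f" and s: "0 < s"
  shows "hausdorff_measure s (f ` A) = 0"
  unfolding hausdorff_measure_eq_0_iff
proof (intro allI impI)
  fix \<delta> \<epsilon> :: real assume \<delta>: "0 < \<delta>" and \<epsilon>: "0 < \<epsilon>"
  define M where "M = max L 1"
  have M: "0 < M" "L \<le> M" by (auto simp: M_def)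
  have "0 < \<delta> / M" "0 < \<epsilon> / M powr s" using \<delta> \<epsilon> M by auto
  then obtain U :: "nat \<Rightarrow> 'a set" where U: "A \<subseteq> (\<Union>i. U i)" "\<forall>i. bounded (U i) \<and> diameter (U i) \<le> \<delta> / M" "(\<Sum>i. diam_pow s (U i)) < ennreal (\<epsilon> / M powr s)"
    using null unfolding hausdorff_measure_eq_0_iff by meson
  define V where "V i = f ` (U i \<inter> A)" for i
  have V: "dist x y \<le> M * diameter (U i)" if xV: "x \<in> V i" and yV: "y \<in> V i" for x y i
  proof -
    obtain x' where x': "x' \<in> U i \<inter> A" "x = f x'" using xV unfolding V_def by blast
    obtain y' where y': "y' \<in> U i \<inter> A" "y = f y'" using yV unfolding V_def by blast
    note xy = x' y'
    have "dist x y \<le> L * dist x' y'" using lipschitz_onD[OF f] xy by auto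
    also have "\<dots> \<le> M * dist x' y'" using M by (intro mult_right_mono) auto
    also have "\<dots> \<le> M * diameter (U i)" using xy U(2) M by (intro mult_left_mono diameter_bounded_bound) auto
    finally show ?thesis .
  qed
  have d0: "0 \<le> diameter (U i)" for i using U(2) diameter_ge_0 by blast
  have dV: "diameter (V i) \<le> M * diameter (U i)" for i using V d0[of i] M by (intro diameter_le_dist) auto
  have bV: "bounded (V i)" for i using V by (rule bounded_if_dist_le)
  have "diam_pow s (V i) \<le> ennreal (M powr s) * diam_pow s (U i)" for i
  proof (cases "V i = {}")
    case False
    then have "U i \<noteq> {}" by (auto simp: V_def)
    have "diameter (V i) powr s \<le> (M * diameter (U i)) powr s"
      using dV bV s diameter_ge_0[of "V i"] by (intro powr_mono2) auto
    also have "\<dots> = M powr s * diameter (U i) powr s" using M d0 by (simp add: powr_mult)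
    finally show ?thesis using False s \<open>U i \<noteq> {}\<close> by (simp add: diam_pow_def ennreal_leI flip: ennreal_mult)
  qed (simp add: diam_pow_def)
  then have "(\<Sum>i. diam_pow s (V i)) \<le> (\<Sum>i. ennreal (M powr s) * diam_pow s (U i))" by (intro suminf_le) auto
  also have "\<dots> = ennreal (M powr s) * (\<Sum>i. diam_pow s (U i))" by (rule ennreal_suminf_cmult)
  also have "\<dots> < ennreal (M powr s) * ennreal (\<epsilon> / M powr s)"
    using U(3) M by (intro ennreal_mult_strict_left_mono) auto
  also have "\<dots> = ennreal \<epsilon>" using M \<epsilon> by (simp flip: ennreal_mult)
  finally have "(\<Sum>i. diam_pow s (V i)) < ennreal \<epsilon>" .
  moreover have "f ` A \<subseteq> (\<Union>i. V i)" using U(1) unfolding V_def by blast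
  moreover have "diameter (V i) \<le> \<delta>" for i
  proof -
    have "M * diameter (U i) \<le> M * (\<delta> / M)" using U(2) M by (intro mult_left_mono) auto
    then show ?thesis using dV[of i] M by simp
  qed
  ultimately show "\<exists>V. f ` A \<subseteq> (\<Union>i. V i) \<and> (\<forall>i::nat. bounded (V i) \<and> diameter (V i) \<le> \<delta>) \<and> (\<Sum>i. diam_pow s (V i)) < ennreal \<epsilon>"
    using bV by blast
qed

text \<open>
A bound on the size of the covering sets comes for free: if \<open>m * d powr s\<close> is small, then so is
\<open>d\<close> as soon as the cover is not empty.
\<close>

lemma hausdorff_null_finite_covers:
  fixes A :: "'a::metric_space set"
  assumes s: "0 < s"
    and cover: "\<And>\<epsilon>. 0 < \<epsilon> \<Longrightarrow> \<exists>(m::nat) d V. A \<subseteq> (\<Union>i<m. V i) \<and> 0 < d \<and> real m * d powr s < \<epsilon> \<and>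
        (\<forall>i<m. \<forall>x\<in>V i. \<forall>y\<in>V i. dist x y \<le> d)"
  shows "hausdorff_measure s A = 0"
  unfolding hausdorff_measure_eq_0_iff
proof (intro allI impI)
  fix \<delta> \<epsilon> :: real assume \<delta>: "0 < \<delta>" and \<epsilon>: "0 < \<epsilon>"
  have "0 < min \<epsilon> (\<delta> powr s)" using \<delta> \<epsilon> by simp
  then obtain m d and V :: "nat \<Rightarrow> 'a set" where V: "A \<subseteq> (\<Union>i<m. V i)" "0 < d" "real m * d powr s < min \<epsilon> (\<delta> powr s)"
    "\<forall>i<m. \<forall>x\<in>V i. \<forall>y\<in>V i. dist x y \<le> d" using cover by meson
  define U where "U i = (if i < m then V i else {})" for i
  have dU: "dist x y \<le> d" if "x \<in> U i" "y \<in> U i" for x y i using V(4) that by (auto simp: U_def split: if_splits)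
  have bU: "bounded (U i)" and diU: "diameter (U i) \<le> d" for i
    using dU V(2) by (auto intro!: bounded_if_dist_le diameter_le_dist)
  have "diameter (U i) \<le> \<delta>" for i
  proof (cases "i < m")
    case True
    then have "1 * d powr s \<le> real m * d powr s" using V(2) by (intro mult_right_mono) auto
    then have "d powr s < \<delta> powr s" using V(3) by simp
    then have "d < \<delta>" using s \<delta> V(2) powr_less_mono2[of s \<delta> d] powr_mono2[of s \<delta> d] by (meson less_eq_real_def not_le)
    then show ?thesis using diU[of i] by simp
  qed (use \<delta> in \<open>simp add: U_def\<close>)
  moreover have "A \<subseteq> (\<Union>i. U i)" using V(1) by (auto simp: U_def)
  moreover have "(\<Sum>i. diam_pow s (U i)) < ennreal \<epsilon>"
  proof -
    have "(\<Sum>i. diam_pow s (U i)) = (\<Sum>i<m. diam_pow s (U i))"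
      by (rule suminf_finite) (auto simp: U_def diam_pow_def)
    also have "\<dots> \<le> (\<Sum>i<m. ennreal (d powr s))"
    proof (rule sum_mono)
      fix i
      have "diameter (U i) powr s \<le> d powr s" using diU[of i] diameter_ge_0[OF bU[of i]] s by (intro powr_mono2) auto
      then show "diam_pow s (U i) \<le> ennreal (d powr s)" using s by (auto simp: diam_pow_def ennreal_leI)
    qed
    also have "\<dots> = ennreal (real m * d powr s)" by (simp add: ennreal_mult ennreal_of_nat_eq_real_of_nat)
    also have "\<dots> < ennreal \<epsilon>" using V(3) \<epsilon> by (intro ennreal_lessI) auto
    finally show ?thesis .
  qed
  ultimately show "\<exists>U. A \<subseteq> (\<Union>i. U i) \<and> (\<forall>i::nat. bounded (U i) \<and> diameter (U i) \<le> \<delta>) \<and> (\<Sum>i. diam_pow s (U i)) < ennreal \<epsilon>"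
    using bU by blast
qed

text \<open>
The length 8 exceeds \<open>2 * pi\<close>, so that the interval parametrizes the unit circle.
\<close>

lemma hausdorff_null_interval:
  assumes s: "1 < s"
  shows "hausdorff_measure s {0..8::real} = 0"
proof (rule hausdorff_null_finite_covers)
  fix \<epsilon> :: real assume \<epsilon>: "0 < \<epsilon>"
  have "((\<lambda>x. 9 * x powr (1 - s)) \<longlongrightarrow> 9 * 0) at_top"
    using s by (intro tendsto_intros tendsto_neg_powr filterlim_ident) auto
  then have "\<forall>\<^sub>F x in at_top. 9 * x powr (1 - s) < \<epsilon>" using \<epsilon> by (intro order_tendstoD) auto
  then obtain x0 where x0: "\<And>x. x \<ge> x0 \<Longrightarrow> 9 * x powr (1 - s) < \<epsilon>" unfolding eventually_at_top_linorder by blast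
  obtain n :: nat where n: "max 1 x0 \<le> real n" using real_arch_simple by blast
  then have n1: "1 \<le> real n" "0 < n" and nx: "9 * real n powr (1 - s) < \<epsilon>" using x0[of "real n"] by auto
  define V where "V i = {real i / n .. (real i + 1) / n}" for i
  show "\<exists>m d V. {0..8::real} \<subseteq> (\<Union>i<m. V i) \<and> 0 < d \<and> real m * d powr s < \<epsilon> \<and> (\<forall>i<m. \<forall>x\<in>V i. \<forall>y\<in>V i. dist x y \<le> d)"
  proof (intro exI conjI)
    show "{0..8::real} \<subseteq> (\<Union>i<8 * n + 1. V i)"
    proof
      fix x :: real assume x: "x \<in> {0..8}"
      define i where "i = nat \<lfloor>x * n\<rfloor>"
      have "real i \<le> x * n" "x * n < real i + 1" using x by (auto simp: i_def)
      then have "x \<in> V i" using n1 by (simp add: V_def field_simps)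
      moreover have "i < 8 * n + 1"
      proof -
        have "x * real n \<le> 8 * real n" using x n1 by (intro mult_right_mono) auto
        then show ?thesis using \<open>real i \<le> x * n\<close> by linarith
      qed
      ultimately show "x \<in> (\<Union>i<8 * n + 1. V i)" by blast
    qed
    show "0 < 1 / real n" using n1 by simp
    show "\<forall>i<8 * n + 1. \<forall>x\<in>V i. \<forall>y\<in>V i. dist x y \<le> 1 / real n"
    proof (intro allI impI ballI)
      fix i x y assume "x \<in> V i" "y \<in> V i"
      then show "dist x y \<le> 1 / real n" by (auto simp: V_def dist_real_def add_divide_distrib)
    qed
    have "real (8 * n + 1) * (1 / real n) powr s \<le> (9 * real n) * (1 / real n) powr s"
      using n1 by (intro mult_right_mono) auto
    also have "\<dots> = 9 * real n powr (1 - s)" using n1 by (simp add: powr_divide powr_diff)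
    finally show "real (8 * n + 1) * (1 / real n) powr s < \<epsilon>" using nx by simp
  qed
qed (use s in auto)

text \<open>
The measure on \<open>A\<close> is transported from Lebesgue measure by \<open>\<phi>\<close>: a piece of diameter \<open>d\<close> of \<open>A\<close>
carries at most the mass \<open>c * d powr s\<close>, so no cover can be cheaper than the total mass over \<open>c\<close>.
\<close>

lemma mass_distribution:
  fixes \<phi> :: "'a::metric_space \<Rightarrow> 'b::euclidean_space"
  assumes s: "0 < s" and c: "0 \<le> c"
    and mass: "\<And>U. \<lbrakk>bounded U; U \<subseteq> A; U \<noteq> {}\<rbrakk> \<Longrightarrow> \<exists>V\<in>sets lborel. \<phi> ` U \<subseteq> V \<and> emeasure lborel V \<le> ennreal (c * diameter U powr s)"
    and W: "W \<in> sets lborel" "W \<subseteq> \<phi> ` A" "0 < emeasure lborel W"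
  shows "hausdorff_measure s A \<noteq> 0"
proof
  assume null: "hausdorff_measure s A = 0"
  have "emeasure lborel W \<le> 0 + ennreal \<epsilon>" if \<epsilon>: "0 < \<epsilon>" for \<epsilon>
  proof -
    \<comment> \<open>The denominator \<open>c + 1\<close> instead of \<open>c\<close> covers the case \<open>c = 0\<close>.\<close>
    have "0 < \<epsilon> / (c + 1)" using \<epsilon> c by simp
    then obtain U :: "nat \<Rightarrow> 'a set" where U: "A \<subseteq> (\<Union>i. U i)" "\<forall>i. bounded (U i) \<and> diameter (U i) \<le> 1" "(\<Sum>i. diam_pow s (U i)) < ennreal (\<epsilon> / (c + 1))"
      using null zero_less_one[where 'a = real] unfolding hausdorff_measure_eq_0_iff by meson
    have "\<forall>i. \<exists>V. V \<in> sets lborel \<and> \<phi> ` (U i \<inter> A) \<subseteq> V \<and> emeasure lborel V \<le> ennreal c * diam_pow s (U i)"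
    proof
      fix i
      show "\<exists>V. V \<in> sets lborel \<and> \<phi> ` (U i \<inter> A) \<subseteq> V \<and> emeasure lborel V \<le> ennreal c * diam_pow s (U i)"
      proof (cases "U i \<inter> A = {}")
        case False
        have b: "bounded (U i)" using U(2) by blast
        then have bA: "bounded (U i \<inter> A)" by (rule bounded_subset) blast
        obtain V where V: "V \<in> sets lborel" "\<phi> ` (U i \<inter> A) \<subseteq> V" "emeasure lborel V \<le> ennreal (c * diameter (U i \<inter> A) powr s)"
          using mass[OF bA _ False] by blast
        have "diameter (U i \<inter> A) powr s \<le> diameter (U i) powr s"
          using b bA s diameter_ge_0[OF bA] by (intro powr_mono2 diameter_subset) auto
        then have "ennreal (c * diameter (U i \<inter> A) powr s) \<le> ennreal (c * diameter (U i) powr s)"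
          using c by (intro ennreal_leI mult_left_mono)
        also have "\<dots> = ennreal c * diam_pow s (U i)" using False s c by (auto simp: diam_pow_def ennreal_mult)
        finally show ?thesis using V by (intro exI[of _ V]) auto
      qed (auto intro: exI[of _ "{}"])
    qed
    then obtain V where V: "\<forall>i. V i \<in> sets lborel \<and> \<phi> ` (U i \<inter> A) \<subseteq> V i \<and> emeasure lborel (V i) \<le> ennreal c * diam_pow s (U i)"
      by (rule choice[THEN exE])
    have "W \<subseteq> (\<Union>i. V i)"
    proof
      fix w assume "w \<in> W"
      then obtain x where x: "x \<in> A" "w = \<phi> x" using W by blast
      then obtain i where "x \<in> U i" using U(1) by blast
      then show "w \<in> (\<Union>i. V i)" using V x by blast
    qed
    then have "emeasure lborel W \<le> emeasure lborel (\<Union>i. V i)" using V by (intro emeasure_mono) auto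
    also have "\<dots> \<le> (\<Sum>i. emeasure lborel (V i))" using V by (intro emeasure_subadditive_countably) auto
    also have "\<dots> \<le> (\<Sum>i. ennreal c * diam_pow s (U i))" using V by (intro suminf_le) auto
    also have "\<dots> = ennreal c * (\<Sum>i. diam_pow s (U i))" by (rule ennreal_suminf_cmult)
    also have "\<dots> \<le> ennreal c * ennreal (\<epsilon> / (c + 1))" using U(3) by (intro mult_left_mono) (auto intro: less_imp_le)
    also have "\<dots> = ennreal (c * (\<epsilon> / (c + 1)))" using c \<epsilon> by (intro ennreal_mult[symmetric]) auto
    also have "\<dots> \<le> ennreal \<epsilon>" using c \<epsilon> by (intro ennreal_leI) (simp add: field_simps)
    finally show ?thesis by simp
  qed
  then have "emeasure lborel W \<le> 0" by (rule ennreal_le_epsilon)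
  then show False using W(3) by simp
qed

text \<open>
Every vertical line through a small disc in \<open>G\<close> leaves the bounded set \<open>G\<close> and so meets the frontier.
Hence the projection of the frontier to the real axis contains an interval.
\<close>

lemma frontier_not_hausdorff_1_null:
  fixes G :: "complex set"
  assumes "open G" "bounded G" "G \<noteq> {}"
  shows "hausdorff_measure 1 (frontier G) \<noteq> 0"
proof -
  obtain x where "x \<in> G" using assms by blast
  then obtain r where r: "0 < r" "ball x r \<subseteq> G" using assms(1) open_contains_ball by blast
  obtain B where B: "\<And>z. z \<in> G \<Longrightarrow> norm z \<le> B" using assms(2) unfolding bounded_iff by blast
  have "{Re x - r<..<Re x + r} \<subseteq> Re ` frontier G"
  proof
    fix t assume t: "t \<in> {Re x - r<..<Re x + r}"
    define S where "S = {w. Re w = t}"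
    have "convex S" unfolding S_def convex_def by (auto simp flip: distrib_right)
    then have "connected S" by (rule convex_connected)
    moreover have "Complex t (Im x) \<in> S \<inter> G"
    proof -
      have "dist x (Complex t (Im x)) = \<bar>Re x - t\<bar>" by (simp add: dist_norm cmod_def)
      then show ?thesis using t r(2) by (auto simp: S_def subset_iff)
    qed
    moreover have "Complex t (B + 1) \<in> S - G"
    proof -
      have "B < norm (Complex t (B + 1))" using abs_Im_le_cmod[of "Complex t (B + 1)"] by simp
      then show ?thesis using B[of "Complex t (B + 1)"] by (auto simp: S_def)
    qed
    ultimately have "S \<inter> frontier G \<noteq> {}" using connected_Int_frontier[of S G] by blast
    then show "t \<in> Re ` frontier G" by (auto simp: S_def)
  qed
  then show ?thesis
  proof (rule mass_distribution[of 1 2 "frontier G" Re "{Re x - r<..<Re x + r}", rotated 4])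
    fix U :: "complex set" assume U: "bounded U" "U \<noteq> {}"
    then obtain u where u: "u \<in> U" by blast
    have "Re ` U \<subseteq> {Re u - diameter U..Re u + diameter U}"
    proof
      fix t assume "t \<in> Re ` U"
      then obtain w where w: "w \<in> U" "t = Re w" by blast
      have "\<bar>Re (w - u)\<bar> \<le> diameter U"
        using abs_Re_le_cmod[of "w - u"] diameter_bounded_bound[OF U(1) w(1) u] by (simp add: dist_norm)
      then show "t \<in> {Re u - diameter U..Re u + diameter U}" using w by auto
    qed
    moreover have "emeasure lborel {Re u - diameter U..Re u + diameter U} \<le> ennreal (2 * diameter U powr 1)"
      using diameter_ge_0[OF U(1)] by simp
    ultimately show "\<exists>V\<in>sets lborel. Re ` U \<subseteq> V \<and> emeasure lborel V \<le> ennreal (2 * diameter U powr 1)"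
      by (intro bexI[of _ "{Re u - diameter U..Re u + diameter U}"]) auto
  qed (use r in auto)
qed

text \<open>
The exponents below 1 are excluded by the single value \<open>s = 1\<close>, since null sets are monotone in the
exponent.
\<close>

lemma hausdorff_dim_eqI:
  fixes A :: "'a::metric_space set"
  assumes \<beta>: "1 \<le> \<beta>" and upper: "\<And>s. \<beta> < s \<Longrightarrow> hausdorff_measure s A = 0"
    and lower1: "hausdorff_measure 1 A \<noteq> 0"
    and lower: "\<And>s. 1 < s \<Longrightarrow> s < \<beta> \<Longrightarrow> hausdorff_measure s A \<noteq> 0"
  shows "hausdorff_dim A = ereal \<beta>"
proof (rule antisym)
  show "hausdorff_dim A \<le> ereal \<beta>"
  proof (rule ereal_le_epsilon2)
    fix e :: real assume "0 < e"
    then have "hausdorff_dim A \<le> ereal (\<beta> + e)"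
      unfolding hausdorff_dim_def using \<beta> upper by (intro INF_lower) auto
    then show "hausdorff_dim A \<le> ereal \<beta> + ereal e" by simp
  qed
  show "ereal \<beta> \<le> hausdorff_dim A"
    unfolding hausdorff_dim_def
  proof (rule INF_greatest)
    fix s assume s: "s \<in> {s. 0 \<le> s \<and> hausdorff_measure s A = 0}"
    have "\<not> s \<le> 1" using hausdorff_null_exponent_mono[of s A 1] s lower1 by auto
    then have "\<not> s < \<beta>" using lower[of s] s by auto
    then show "ereal \<beta> \<le> ereal s" by simp
  qed
qed

section \<open>Sums of Cauchy kernels that trace a segment\<close>

text \<open>
The key inequality for univalence. Here \<open>u1\<close> and \<open>u2\<close> range over the disc \<open>norm (u - 1) \<le> 1\<close>, which
touches the imaginary axis at 0, and \<open>q\<close> deviates from 1 at most linearly in \<open>u1\<close> and \<open>u2\<close>.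
If \<open>Re (u1 * u2) \<ge> 0\<close>, all terms have positive real part. Otherwise \<open>u1\<close> and \<open>u2\<close> lie on the same side
of the real axis, and after multiplication by \<open>u1 * u2\<close> all terms have imaginary parts of the same
sign. For \<open>q\<close> this uses that the real parts of \<open>u1\<close> and \<open>u2\<close> are at least quadratic in their size,
that is, the strict convexity of the disc, which beats the linear deviation of \<open>q\<close>.
\<close>

lemma perturbed_kernel_sum_nonzero:
  fixes u1 u2 q :: complex and m s :: "'i \<Rightarrow> real" and \<eta> :: real
  assumes disc1: "(norm u1)\<^sup>2 \<le> 2 * Re u1" and disc2: "(norm u2)\<^sup>2 \<le> 2 * Re u2"
    and q: "norm (q - 1) \<le> \<eta> * (norm u1 + norm u2)" and \<eta>: "0 \<le> \<eta>" "\<eta> < 1/6"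
    and s: "\<And>i. i \<in> I \<Longrightarrow> 0 < s i" and m: "\<And>i. i \<in> I \<Longrightarrow> 0 \<le> m i"
  shows "q + (\<Sum>i\<in>I. of_real (m i) / ((of_real (s i) + u1) * (of_real (s i) + u2))) \<noteq> 0"
proof -
  define A where "A = (\<lambda>i. (of_real (s i) + u1) * (of_real (s i) + u2))"
  define x1 y1 x2 y2 where xy: "x1 = Re u1" "y1 = Im u1" "x2 = Re u2" "y2 = Im u2"
  have n1: "(norm u1)\<^sup>2 = x1\<^sup>2 + y1\<^sup>2" and n2: "(norm u2)\<^sup>2 = x2\<^sup>2 + y2\<^sup>2"
    by (auto simp: cmod_power2 xy)
  have x0: "0 \<le> x1" "0 \<le> x2"
    using disc1 disc2 zero_le_power2[of "norm u1"] zero_le_power2[of "norm u2"] unfolding xy by linarith+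
  have le2: "norm u \<le> 2" if "(norm u)\<^sup>2 \<le> 2 * Re u" for u :: complex
  proof -
    have "norm u * norm u \<le> 2 * norm u"
      using that complex_Re_le_cmod[of u] by (simp add: power2_eq_square)
    then show ?thesis by (cases "u = 0") auto
  qed
  have "\<eta> * (norm u1 + norm u2) \<le> \<eta> * 4"
    using le2[OF disc1] le2[OF disc2] \<eta> by (intro mult_left_mono) auto
  with q have q4: "norm (q - 1) \<le> 4 * \<eta>" by simp
  have Req: "Re q \<ge> 1 - 4 * \<eta>"
    using q4 abs_Re_le_cmod[of "q - 1"] by auto
  have ImA: "Im q \<le> \<eta> * (norm u1 + norm u2)" "- Im q \<le> \<eta> * (norm u1 + norm u2)"
    using q abs_Im_le_cmod[of "q - 1"] by auto
  show ?thesis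
  proof (cases "0 \<le> Re (u1 * u2)")
    case True
    have "0 \<le> Re (of_real (m i) / A i)" if "i \<in> I" for i
    proof -
      have "Re (A i) = (s i)\<^sup>2 + s i * (x1 + x2) + Re (u1 * u2)"
        by (simp add: A_def xy algebra_simps power2_eq_square)
      then have "0 \<le> Re (A i)" using True x0 s[OF that] by simp
      then show ?thesis using m[OF that] by (simp add: Re_complex_div_ge_0)
    qed
    then have "0 \<le> Re (\<Sum>i\<in>I. of_real (m i) / A i)" by (simp add: sum_nonneg)
    then have "0 < Re (q + (\<Sum>i\<in>I. of_real (m i) / A i))" using Req \<eta> by simp
    then show ?thesis unfolding A_def by fastforce
  next
    case False
    then have neg: "x1 * x2 < y1 * y2" by (simp add: xy)
    then have yy: "0 < y1 * y2" using x0 by (smt (verit) mult_nonneg_nonneg)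
    \<comment> \<open>Both imaginary parts have the same sign; \<open>\<tau>\<close> is that sign.\<close>
    define \<tau> where "\<tau> = sgn y1"
    have \<tau>: "\<tau> * y1 = \<bar>y1\<bar>" "\<tau> * y2 = \<bar>y2\<bar>" "\<bar>\<tau>\<bar> = 1" "\<bar>y1\<bar> > 0" "\<bar>y2\<bar> > 0"
      using yy by (auto simp: \<tau>_def sgn_if zero_less_mult_iff)
    have "0 \<le> \<tau> * Im (u1 * u2 * (of_real (m i) / A i))" if "i \<in> I" for i
    proof -
      have "\<tau> * Im (u1 * u2 * cnj (A i)) = (s i)\<^sup>2 * (x1 * (\<tau> * y2) + x2 * (\<tau> * y1))
           + s i * ((x2\<^sup>2 + y2\<^sup>2) * (\<tau> * y1) + (x1\<^sup>2 + y1\<^sup>2) * (\<tau> * y2))"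
        by (simp add: A_def xy algebra_simps power2_eq_square)
      also have "\<dots> \<ge> 0" using x0 s[OF that] unfolding \<tau> by (intro add_nonneg_nonneg mult_nonneg_nonneg) auto
      finally have *: "0 \<le> \<tau> * Im (u1 * u2 * cnj (A i))" .
      have "u1 * u2 * (of_real (m i) / A i) = of_real (m i / (norm (A i))\<^sup>2) * (u1 * u2 * cnj (A i))"
        by (cases "A i = 0") (auto simp: complex_norm_square field_simps simp del: of_real_power)
      moreover have "Im (of_real k * w) = k * Im w" for k w by simp
      ultimately have "\<tau> * Im (u1 * u2 * (of_real (m i) / A i)) = m i / (norm (A i))\<^sup>2 * (\<tau> * Im (u1 * u2 * cnj (A i)))"
        by (simp only: mult.left_commute[of "u1 * u2"]) (simp only: mult.left_commute)
      then show ?thesis using * m[OF that] by simp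
    qed
    then have S: "0 \<le> \<tau> * Im (u1 * u2 * (\<Sum>i\<in>I. of_real (m i) / A i))"
      by (simp add: sum_distrib_left sum_nonneg Im_sum del: Im_complex_of_real times_complex.sel)
    define M where "M = x1 * \<bar>y2\<bar> + x2 * \<bar>y1\<bar>"
    have M2: "(norm u1)\<^sup>2 * \<bar>y2\<bar> + (norm u2)\<^sup>2 * \<bar>y1\<bar> \<le> 2 * M"
      unfolding M_def using mult_right_mono[OF disc1, of "\<bar>y2\<bar>"] mult_right_mono[OF disc2, of "\<bar>y1\<bar>"]
      by (simp add: xy algebra_simps)
    have "norm u1 > 0" "norm u2 > 0" using \<tau> by (auto simp: xy)
    then have Mpos: "0 < M" using M2 \<tau> by (smt (verit) mult_pos_pos zero_less_power)
    have y: "\<bar>y1\<bar> \<le> norm u1" "\<bar>y2\<bar> \<le> norm u2" by (simp_all add: xy abs_Im_le_cmod)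
    have "\<tau> * Im (u1 * u2 * q) = M * Re q - (y1 * y2 - x1 * x2) * (\<tau> * Im q)"
    proof -
      have "\<tau> * Im (u1 * u2 * q) = (x1 * (\<tau> * y2) + x2 * (\<tau> * y1)) * Re q - (y1 * y2 - x1 * x2) * (\<tau> * Im q)"
        by (simp add: xy algebra_simps)
      then show ?thesis unfolding \<tau> M_def .
    qed
    also have "\<dots> \<ge> M * Re q - (y1 * y2) * (\<eta> * (norm u1 + norm u2))"
    proof -
      have "\<tau> * Im q \<le> \<eta> * (norm u1 + norm u2)" using ImA \<tau>(3) by (auto simp: abs_if split: if_splits)
      then have "(y1 * y2 - x1 * x2) * (\<tau> * Im q) \<le> (y1 * y2 - x1 * x2) * (\<eta> * (norm u1 + norm u2))"
        using neg by (intro mult_left_mono) auto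
      also have "\<dots> \<le> (y1 * y2) * (\<eta> * (norm u1 + norm u2))"
        using x0 \<eta> by (intro mult_right_mono) auto
      finally show ?thesis by simp
    qed
    finally have lower: "M * Re q - (y1 * y2) * (\<eta> * (norm u1 + norm u2)) \<le> \<tau> * Im (u1 * u2 * q)" .
    have "(y1 * y2) * (\<eta> * (norm u1 + norm u2)) \<le> \<eta> * (2 * M)"
    proof -
      have "\<bar>y1\<bar> * \<bar>y2\<bar> * norm u1 \<le> (norm u1)\<^sup>2 * \<bar>y2\<bar>"
        using mult_right_mono[OF y(1), of "\<bar>y2\<bar> * norm u1"] by (simp add: power2_eq_square algebra_simps)
      moreover have "\<bar>y1\<bar> * \<bar>y2\<bar> * norm u2 \<le> (norm u2)\<^sup>2 * \<bar>y1\<bar>"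
        using mult_right_mono[OF y(2), of "\<bar>y1\<bar> * norm u2"] by (simp add: power2_eq_square algebra_simps)
      ultimately have "\<bar>y1\<bar> * \<bar>y2\<bar> * (norm u1 + norm u2) \<le> 2 * M" using M2 by (simp add: algebra_simps)
      moreover have "\<bar>y1\<bar> * \<bar>y2\<bar> = y1 * y2" using yy by (simp add: abs_mult[symmetric])
      ultimately show ?thesis using mult_left_mono[of "y1 * y2 * (norm u1 + norm u2)" "2 * M" \<eta>] \<eta>
        by (simp add: algebra_simps)
    qed
    with lower have "\<tau> * Im (u1 * u2 * q) \<ge> M * (Re q - 2 * \<eta>)" by (simp add: algebra_simps)
    moreover have "M * (Re q - 2 * \<eta>) > 0" using Mpos Req \<eta> by (intro mult_pos_pos) auto
    ultimately have "0 < \<tau> * Im (u1 * u2 * (q + (\<Sum>i\<in>I. of_real (m i) / A i)))"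
      using S by (simp only: distrib_left plus_complex.sel)
    then show ?thesis unfolding A_def by fastforce
  qed
qed

definition tooth :: "nat \<Rightarrow> real \<Rightarrow> complex \<Rightarrow> complex" where
  "tooth N e u = (\<Sum>i<N. of_real (e / 2^i) / (of_real (e / 2^i) + u)) / of_nat N"

text \<open>
The divided difference of \<open>tooth N e\<close>, with the opposite sign. It also makes sense on the diagonal,
where it is minus the derivative, and a map is univalent with nonvanishing derivative if
and only if its divided difference has no zero.
\<close>

definition tooth_dd :: "nat \<Rightarrow> real \<Rightarrow> complex \<Rightarrow> complex \<Rightarrow> complex" where
  "tooth_dd N e u1 u2 =
     (\<Sum>i<N. of_real (e / 2^i / N) / ((of_real (e / 2^i) + u1) * (of_real (e / 2^i) + u2)))"

text \<open>
In the right half plane a kernel \<open>s / (s + u)\<close> is dominated by \<open>s / norm u\<close>, whatever \<open>s\<close> is.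
\<close>

lemma norm_add_pos_ge:
  fixes u :: complex
  assumes "0 \<le> Re u" "0 \<le> s"
  shows "norm u \<le> norm (of_real s + u)" "s \<le> norm (of_real s + u)"
proof -
  have "(norm u)\<^sup>2 \<le> (norm (of_real s + u))\<^sup>2"
    using assms by (simp only: cmod_power2) (simp add: power2_eq_square algebra_simps)
  then show "norm u \<le> norm (of_real s + u)" by (rule power2_le_imp_le) simp
  show "s \<le> norm (of_real s + u)" using complex_Re_le_cmod[of "of_real s + u"] assms by simp
qed

lemma add_pos_nonzero: "0 \<le> Re u \<Longrightarrow> 0 < s \<Longrightarrow> of_real s + (u::complex) \<noteq> 0"
  by (metis (no_types) Re_complex_of_real add.commute add_strict_increasing less_irrefl plus_complex.sel(1) zero_complex.sel(1))

lemma tooth_diff: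
  assumes "0 \<le> Re u1" "0 \<le> Re u2" "0 < e"
  shows "tooth N e u1 - tooth N e u2 = (u2 - u1) * tooth_dd N e u1 u2"
proof -
  have "of_real (e / 2^i) / (of_real (e / 2^i) + u1) / of_nat N - of_real (e / 2^i) / (of_real (e / 2^i) + u2) / of_nat N
       = (u2 - u1) * (of_real (e / 2^i / N) / ((of_real (e / 2^i) + u1) * (of_real (e / 2^i) + u2)))" for i
  proof -
    have nz: "of_real (e / 2^i) + u1 \<noteq> 0" "of_real (e / 2^i) + u2 \<noteq> 0"
      by (rule add_pos_nonzero; use assms in simp)+
    have gen: "E / X / M - E / Y / M = (Y - X) * (E / M / (X * Y))" if "X \<noteq> 0" "Y \<noteq> 0" for E X Y M :: complex
      using that by (cases "M = 0") (simp_all add: field_simps)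
    have "(of_real (e / 2^i) + u2) - (of_real (e / 2^i) + u1) = u2 - u1" by simp
    then show ?thesis using gen[OF nz, of "of_real (e / 2^i)" "of_nat N"] by simp
  qed
  then show ?thesis
    by (simp add: tooth_def tooth_dd_def sum_divide_distrib sum_distrib_left flip: sum_subtractf)
qed

lemma sum_halves_le: "0 \<le> e \<Longrightarrow> (\<Sum>i<N. e / 2^i) \<le> 2 * (e::real)"
proof -
  assume "0 \<le> e"
  have "(\<Sum>i<N. e / 2^i) = e * (2 - 2 / 2^N)"
    by (induction N) (auto simp: field_simps)
  also have "\<dots> \<le> e * 2" using \<open>0 \<le> e\<close> by (intro mult_left_mono) auto
  finally show ?thesis by simp
qed

lemma sum_halves_div_le: "0 \<le> e \<Longrightarrow> (\<Sum>i<N. e / 2^i / real N) \<le> 2 * e"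
proof (cases "N = 0")
  case False
  assume "0 \<le> e"
  have "(\<Sum>i<N. e / 2^i / real N) \<le> (\<Sum>i<N. e / 2^i)"
    using False \<open>0 \<le> e\<close> by (intro sum_mono) (auto simp: divide_simps mult_le_cancel_left1)
  with sum_halves_le[OF \<open>0 \<le> e\<close>, of N] show ?thesis by linarith
qed auto

lemma norm_tooth_le:
  assumes "0 \<le> Re u" "0 < e"
  shows "norm u * norm (tooth N e u) \<le> 2 * e"
proof -
  have "norm u * norm (of_real (e / 2^i) / (of_real (e / 2^i) + u) / of_nat N) \<le> e / 2^i / real N" for i
  proof -
    have 1: "norm u \<le> norm (of_real (e / 2^i) + u)" "e / 2^i \<le> norm (of_real (e / 2^i) + u)"
      using assms by (intro norm_add_pos_ge; simp)+
    have "norm u * (e / 2^i / norm (of_real (e / 2^i) + u)) \<le> e / 2^i"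
    proof -
      have p: "0 < norm (of_real (e / 2^i) + u)" using 1(2) assms by (smt (verit) divide_pos_pos zero_less_power)
      have "norm u * (e / 2^i) \<le> norm (of_real (e / 2^i) + u) * (e/2^i)"
        using 1 assms by (intro mult_right_mono) auto
      then show ?thesis using p by (simp add: field_simps)
    qed
    then have "norm u * (e / 2^i / norm (of_real (e / 2^i) + u)) / real N \<le> e / 2^i / real N"
      by (rule divide_right_mono) simp
    then show ?thesis using assms by (simp add: norm_divide norm_power norm_mult abs_of_pos)
  qed
  then have "(\<Sum>i<N. norm u * norm (of_real (e / 2^i) / (of_real (e / 2^i) + u) / of_nat N)) \<le> (\<Sum>i<N. e / 2^i / real N)"
    by (intro sum_mono)
  also have "\<dots> \<le> 2 * e" using assms by (intro sum_halves_div_le) auto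
  finally have *: "norm u * (\<Sum>i<N. norm (of_real (e / 2^i) / (of_real (e / 2^i) + u) / of_nat N)) \<le> 2 * e"
    by (simp add: sum_distrib_left)
  have "norm (tooth N e u) \<le> (\<Sum>i<N. norm (of_real (e / 2^i) / (of_real (e / 2^i) + u) / of_nat N))"
    unfolding tooth_def sum_divide_distrib by (rule norm_sum)
  then show ?thesis using * by (meson mult_left_mono norm_ge_zero order_trans)
qed

lemma norm_tooth_dd_le:
  assumes "r \<le> norm u1" "r \<le> norm u2" "0 < r" "0 \<le> Re u1" "0 \<le> Re u2" "0 < e"
  shows "norm (tooth_dd N e u1 u2) \<le> 2 * e / r\<^sup>2"
proof -
  have "norm (of_real (e / 2^i / N) / ((of_real (e / 2^i) + u1) * (of_real (e / 2^i) + u2))) \<le> e / 2^i / N / r\<^sup>2" for i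
  proof -
    have 1: "r \<le> norm (of_real (e / 2^i) + u1)" "r \<le> norm (of_real (e / 2^i) + u2)"
      using norm_add_pos_ge(1)[of u1 "e/2^i"] norm_add_pos_ge(1)[of u2 "e/2^i"] assms by auto
    then have "r * r \<le> norm (of_real (e / 2^i) + u1) * norm (of_real (e / 2^i) + u2)"
      using assms by (intro mult_mono) auto
    then have "e / 2^i / N / (norm (of_real (e / 2^i) + u1) * norm (of_real (e / 2^i) + u2)) \<le> e / 2^i / N / (r * r)"
    proof (intro divide_left_mono)
      have "0 < r * r" using assms by simp
      then show "0 < norm (of_real (e / 2^i) + u1) * norm (of_real (e / 2^i) + u2) * (r * r)"
        using \<open>r * r \<le> _\<close> by (meson less_le_trans mult_pos_pos)
    qed (use assms in auto)
    then show ?thesis using assms by (simp add: norm_divide norm_mult norm_power power2_eq_square)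
  qed
  then have "norm (tooth_dd N e u1 u2) \<le> (\<Sum>i<N. e / 2^i / N / r\<^sup>2)"
    unfolding tooth_dd_def by (rule sum_norm_le)
  also have "\<dots> = (\<Sum>i<N. e / 2^i / N) / r\<^sup>2" by (simp add: sum_divide_distrib)
  also have "\<dots> \<le> 2 * e / r\<^sup>2" using sum_halves_div_le[of e N] assms by (intro divide_right_mono) auto
  finally show ?thesis .
qed

lemma norm_tooth_dd_diff_le:
  assumes "r \<le> norm u1" "r \<le> norm u2" "r \<le> norm v1" "r \<le> norm v2" "0 < r"
    "0 \<le> Re u1" "0 \<le> Re u2" "0 \<le> Re v1" "0 \<le> Re v2" "0 < e"
  shows "norm (tooth_dd N e u1 u2 - tooth_dd N e v1 v2) \<le> 2 * e / r^3 * (norm (u1 - v1) + norm (u2 - v2))"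
proof -
  let ?d = "norm (u1 - v1) + norm (u2 - v2)"
  let ?t = "\<lambda>i u1 u2. of_real (e / 2^i / N) / ((of_real (e / 2^i) + u1) * (of_real (e / 2^i) + u2)) :: complex"
  have "norm (?t i u1 u2 - ?t i v1 v2) \<le> e / 2^i / N / r^3 * ?d" for i
  proof -
    have ge: "r \<le> norm (of_real (e / 2^i) + w)" if "w \<in> {u1,u2,v1,v2}" for w
      using norm_add_pos_ge(1)[of w "e/2^i"] assms that by auto
    define A1 A2 B1 B2 where AB: "A1 = of_real (e / 2^i) + u1" "A2 = of_real (e / 2^i) + u2"
      "B1 = of_real (e / 2^i) + v1" "B2 = of_real (e / 2^i) + v2"
    have ge': "r \<le> norm A1" "r \<le> norm A2" "r \<le> norm B1" "r \<le> norm B2" using ge by (auto simp: AB)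
    then have nz: "A1 \<noteq> 0" "A2 \<noteq> 0" "B1 \<noteq> 0" "B2 \<noteq> 0" using assms by auto
    have "1 / (A1 * A2) - 1 / (B1 * B2) = (B1 - A1) / (A1 * B1 * A2) + (B2 - A2) / (B1 * A2 * B2)"
      using nz by (simp add: field_simps)
    then have "norm (1 / (A1 * A2) - 1 / (B1 * B2)) \<le> norm (B1 - A1) / norm (A1 * B1 * A2) + norm (B2 - A2) / norm (B1 * A2 * B2)"
      by (metis norm_divide norm_triangle_ineq)
    also have "\<dots> \<le> norm (B1 - A1) / r^3 + norm (B2 - A2) / r^3"
    proof -
      have "r * r * r \<le> norm (A1 * B1 * A2)" "r * r * r \<le> norm (B1 * A2 * B2)"
        unfolding norm_mult using ge' assms by (intro mult_mono; simp)+
      then show ?thesis using assms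
        by (intro add_mono divide_left_mono) (auto simp: power3_eq_cube nz)
    qed
    also have "\<dots> = ?d / r^3" by (simp add: AB add_divide_distrib norm_minus_commute)
    finally have *: "norm (1 / (A1 * A2) - 1 / (B1 * B2)) \<le> ?d / r^3" .
    have "?t i u1 u2 - ?t i v1 v2 = of_real (e / 2^i / N) * (1 / (A1 * A2) - 1 / (B1 * B2))"
      unfolding AB by (simp add: right_diff_distrib)
    then have "norm (?t i u1 u2 - ?t i v1 v2) = (e / 2^i / N) * norm (1 / (A1 * A2) - 1 / (B1 * B2))"
      using assms by (simp add: norm_mult norm_divide norm_power)
    also have "\<dots> \<le> (e / 2^i / N) * (?d / r^3)" using * assms by (intro mult_left_mono) auto
    finally show ?thesis by (simp add: field_simps)
  qed
  then have "norm (\<Sum>i<N. ?t i u1 u2 - ?t i v1 v2) \<le> (\<Sum>i<N. e / 2^i / N / r^3 * ?d)"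
    by (rule sum_norm_le)
  also have "\<dots> = (\<Sum>i<N. e / 2^i / N) * (?d / r^3)" unfolding sum_distrib_right by (intro sum.cong) (auto simp: field_simps)
  also have "\<dots> \<le> 2 * e * (?d / r^3)" using sum_halves_div_le[of e N] assms by (intro mult_right_mono) auto
  finally show ?thesis unfolding tooth_dd_def by (simp add: sum_subtractf)
qed

lemma norm_tooth_dd_crude:
  assumes "0 \<le> Re u1" "0 \<le> Re u2" "0 < e"
  shows "norm (tooth_dd N e u1 u2) \<le> (\<Sum>i<N. 2^i / e)"
  unfolding tooth_dd_def
proof (rule sum_norm_le)
  fix i assume "i \<in> {..<N}"
  then have N: "real N \<ge> 1" by auto
  let ?s = "e / 2^i"
  have 1: "?s \<le> norm (of_real ?s + u1)" "?s \<le> norm (of_real ?s + u2)"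
    using assms by (intro norm_add_pos_ge; simp)+
  have s: "0 < ?s" using assms by simp
  have "?s * ?s \<le> norm (of_real ?s + u1) * norm (of_real ?s + u2)"
    using 1 s by (intro mult_mono) linarith+
  then have "?s / N / (norm (of_real ?s + u1) * norm (of_real ?s + u2)) \<le> ?s / N / (?s * ?s)"
  proof (intro divide_left_mono)
    have "0 < ?s * ?s" using s by (intro mult_pos_pos)
    then show "0 < norm (of_real ?s + u1) * norm (of_real ?s + u2) * (?s * ?s)"
      using \<open>?s * ?s \<le> _\<close> by (meson less_le_trans mult_pos_pos)
  qed (use s assms in auto)
  also have "\<dots> = 1 / N / ?s" using s by simp
  also have "\<dots> \<le> 1 / ?s" using N s by (intro divide_right_mono) (auto simp: divide_le_eq_1)
  finally show "norm (of_real (e / 2^i / N) / ((of_real (e / 2^i) + u1) * (of_real (e / 2^i) + u2))) \<le> 2^i / e"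
    using assms by (simp add: norm_divide norm_mult norm_power)
qed

text \<open>
Each kernel takes values in the disc with diameter \<open>[0, 1]\<close>.
\<close>

lemma Re_tooth:
  assumes "0 \<le> Re u" "0 < e"
  shows "0 \<le> Re (tooth N e u)" "Re (tooth N e u) \<le> 1"
proof -
  have t: "0 \<le> Re (of_real (e / 2^i) / (of_real (e / 2^i) + u)) \<and> Re (of_real (e / 2^i) / (of_real (e / 2^i) + u)) \<le> 1" for i
  proof -
    define s where "s = e / 2^i"
    have s: "0 < s" using assms by (simp add: s_def)
    have n: "(s + Re u)\<^sup>2 + (Im u)\<^sup>2 > 0" using s assms by (simp add: add_pos_nonneg)
    have "Re (of_real s / (of_real s + u)) = s * (s + Re u) / ((s + Re u)\<^sup>2 + (Im u)\<^sup>2)"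
      by (simp add: Re_divide)
    moreover have "s * (s + Re u) \<le> (s + Re u)\<^sup>2 + (Im u)\<^sup>2"
      using s assms by (simp add: power2_eq_square algebra_simps)
    ultimately show ?thesis using n s assms unfolding s_def[symmetric] by simp
  qed
  have "Re (tooth N e u) = (\<Sum>i<N. Re (of_real (e / 2^i) / (of_real (e / 2^i) + u))) / N"
    by (simp add: tooth_def Re_divide_of_nat)
  moreover have "0 \<le> (\<Sum>i<N. Re (of_real (e / 2^i) / (of_real (e / 2^i) + u)))" by (intro sum_nonneg) (use t in blast)
  moreover have "(\<Sum>i<N. Re (of_real (e / 2^i) / (of_real (e / 2^i) + u))) \<le> (\<Sum>i<N. 1)" by (intro sum_mono) (use t in blast)
  ultimately show "0 \<le> Re (tooth N e u)" "Re (tooth N e u) \<le> 1"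
    by (auto simp: divide_le_eq_1)
qed

lemma tooth_0: "0 < N \<Longrightarrow> 0 < e \<Longrightarrow> tooth N e 0 = 1"
  by (simp add: tooth_def)

text \<open>
Only the few indices with \<open>2^i * t\<close> close to 1 contribute substantially. The case distinction in the
bound is what makes the induction from \<open>t\<close> to \<open>2 * t\<close> work; 4 is an upper bound in both cases.
\<close>

lemma sum_min_geometric_le:
  fixes t :: real
  assumes "0 < t"
  shows "(\<Sum>i<N. min (1 / (2^i * t)) (2^i * t)) \<le> (if 1 \<le> t then 2 / t else 4 - 2 * t)"
  using assms
proof (induction N arbitrary: t)
  case 0
  then show ?case by auto
next
  case (Suc N)
  have "(\<Sum>i<Suc N. min (1 / (2^i * t)) (2^i * t)) = min (1 / t) t + (\<Sum>i<N. min (1 / (2^i * (2 * t))) (2^i * (2 * t)))"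
    by (simp add: sum.lessThan_Suc_shift mult.assoc mult.left_commute del: sum.lessThan_Suc)
  also have "\<dots> \<le> min (1 / t) t + (if 1 \<le> 2 * t then 2 / (2 * t) else 4 - 2 * (2 * t))"
    using Suc.IH[of "2 * t"] Suc.prems by simp
  also have "\<dots> \<le> (if 1 \<le> t then 2 / t else 4 - 2 * t)"
  proof (cases "1 \<le> t")
    case True
    then show ?thesis by (simp add: min_def)
  next
    case False
    then have lt: "t < 1" by simp
    then have m: "min (1 / t) t \<le> t" by simp
    show ?thesis
    proof (cases "1 \<le> 2 * t")
      case True
      have "(3 * t - 1) * (1 - t) \<ge> 0" using lt True by simp
      then have "t + 1 / t \<le> 4 - 2 * t" using Suc.prems by (simp add: field_simps)
      then show ?thesis using True False m by simp
    next
      case 2: False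
      then show ?thesis using m False Suc.prems by simp
    qed
  qed
  finally show ?case .
qed

text \<open>
The kernel at scale \<open>s\<close> is nearly real both for \<open>u\<close> much smaller and for \<open>u\<close> much larger than \<open>s\<close>.
With geometric scales, only a bounded number out of the \<open>N\<close> kernels is far from real at a given \<open>u\<close>.
\<close>

lemma abs_Im_tooth_le:
  assumes "0 \<le> Re u" "0 < e"
  shows "\<bar>Im (tooth N e u)\<bar> \<le> 4 / real N"
proof (cases "Im u = 0")
  case True
  then have "Im (of_real s / (of_real s + u)) = 0" for s by (simp add: Im_divide)
  then have "Im (tooth N e u) = 0" by (simp add: tooth_def Im_divide_of_nat del: of_real_divide)
  then show ?thesis by simp
next
  case False
  define t where "t = \<bar>Im u\<bar> / e"
  have t: "0 < t" using False assms by (simp add: t_def)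
  have "\<bar>Im (of_real (e / 2^i) / (of_real (e / 2^i) + u))\<bar> \<le> min (1 / (2^i * t)) (2^i * t)" for i
  proof -
    define s where "s = e / 2^i"
    have s: "0 < s" using assms by (simp add: s_def)
    have y: "0 < \<bar>Im u\<bar>" using False by simp
    have "\<bar>Im (of_real s / (of_real s + u))\<bar> = s * \<bar>Im u\<bar> / ((s + Re u)\<^sup>2 + (Im u)\<^sup>2)"
      using s by (simp add: Im_divide abs_mult)
    also have "\<dots> \<le> s * \<bar>Im u\<bar> / (s\<^sup>2 + (Im u)\<^sup>2)"
      using s assms by (intro divide_left_mono add_mono power_mono mult_pos_pos order_refl)
        (auto intro!: add_pos_nonneg zero_less_power)
    finally have *: "\<bar>Im (of_real s / (of_real s + u))\<bar> \<le> s * \<bar>Im u\<bar> / (s\<^sup>2 + (Im u)\<^sup>2)" .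
    have "s * \<bar>Im u\<bar> / (s\<^sup>2 + (Im u)\<^sup>2) \<le> s * \<bar>Im u\<bar> / (Im u)\<^sup>2"
      using s y by (intro divide_left_mono) (auto intro!: mult_pos_pos add_pos_nonneg)
    also have "\<dots> = s / \<bar>Im u\<bar>" using y by (simp add: power2_eq_square divide_simps flip: abs_mult)
    also have "\<dots> = 1 / (2^i * t)" using y assms by (simp add: s_def t_def field_simps)
    finally have 1: "s * \<bar>Im u\<bar> / (s\<^sup>2 + (Im u)\<^sup>2) \<le> 1 / (2^i * t)" .
    have "s * \<bar>Im u\<bar> / (s\<^sup>2 + (Im u)\<^sup>2) \<le> s * \<bar>Im u\<bar> / s\<^sup>2"
      using s y by (intro divide_left_mono) (auto intro!: mult_pos_pos add_pos_nonneg)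
    also have "\<dots> = \<bar>Im u\<bar> / s" using s by (simp add: power2_eq_square)
    also have "\<dots> = 2^i * t" using assms by (simp add: s_def t_def field_simps)
    finally show ?thesis using * 1 unfolding s_def by linarith
  qed
  then have "(\<Sum>i<N. \<bar>Im (of_real (e / 2^i) / (of_real (e / 2^i) + u))\<bar>) \<le> (\<Sum>i<N. min (1 / (2^i * t)) (2^i * t))"
    by (intro sum_mono)
  also have "\<dots> \<le> (if 1 \<le> t then 2 / t else 4 - 2 * t)" by (rule sum_min_geometric_le[OF t])
  also have "\<dots> \<le> 4" using t by (auto simp: divide_simps)
  finally have *: "(\<Sum>i<N. \<bar>Im (of_real (e / 2^i) / (of_real (e / 2^i) + u))\<bar>) \<le> 4" .
  have "\<bar>Im (tooth N e u)\<bar> = \<bar>\<Sum>i<N. Im (of_real (e / 2^i) / (of_real (e / 2^i) + u))\<bar> / N"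
    by (simp add: tooth_def Im_divide_of_nat)
  also have "\<dots> \<le> (\<Sum>i<N. \<bar>Im (of_real (e / 2^i) / (of_real (e / 2^i) + u))\<bar>) / N"
    by (intro divide_right_mono sum_abs) simp
  also have "\<dots> \<le> 4 / N" using * by (intro divide_right_mono) simp_all
  finally show ?thesis .
qed

text \<open>
The coordinate \<open>u\<close> in which the unit disc becomes the disc \<open>norm (u - 1) < 1\<close> in the right half plane
and the boundary point \<open>\<zeta>\<close> becomes 0.
\<close>

definition hp_coord :: "complex \<Rightarrow> complex \<Rightarrow> complex" where
  "hp_coord \<zeta> z = 1 - cnj \<zeta> * z"

lemma norm_hp_coord: "norm \<zeta> = 1 \<Longrightarrow> norm (hp_coord \<zeta> z) = norm (z - \<zeta>)"
proof -
  assume z: "norm \<zeta> = 1"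
  then have "cnj \<zeta> * \<zeta> = 1" by (metis complex_norm_square mult.commute of_real_1 one_power2)
  then have "hp_coord \<zeta> z = cnj \<zeta> * (\<zeta> - z)" by (simp add: hp_coord_def algebra_simps)
  then show ?thesis using z by (simp add: norm_mult norm_minus_commute)
qed

lemma hp_coord_disc:
  assumes "norm \<zeta> = 1" "norm z \<le> 1"
  shows "(norm (hp_coord \<zeta> z))\<^sup>2 \<le> 2 * Re (hp_coord \<zeta> z)"
proof -
  define w where "w = cnj \<zeta> * z"
  have "norm w \<le> 1" using assms by (simp add: w_def norm_mult)
  then have "(norm w)\<^sup>2 \<le> 1" by (simp add: power_le_one)
  then have "(Re w)\<^sup>2 + (Im w)\<^sup>2 \<le> 1" by (simp add: cmod_power2)
  moreover have "hp_coord \<zeta> z = 1 - w" by (simp add: hp_coord_def w_def)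
  ultimately show ?thesis by (simp only: cmod_power2) (simp add: power2_eq_square algebra_simps)
qed

lemma Re_hp_coord_nonneg: "norm \<zeta> = 1 \<Longrightarrow> norm z \<le> 1 \<Longrightarrow> 0 \<le> Re (hp_coord \<zeta> z)"
  using hp_coord_disc[of \<zeta> z] by (smt (verit) zero_le_power2)

lemma hp_coord_diff: "hp_coord \<zeta> z - hp_coord \<zeta> w = cnj \<zeta> * (w - z)"
  by (simp add: hp_coord_def algebra_simps)

section \<open>Univalence of the partial sums\<close>

text \<open>
The data of a comb: the tooth with index \<open>n\<close> sits at the point \<open>\<zeta> n\<close> of the circle, in a gap of radius
\<open>g n\<close> that is free from the other centres; it consists of \<open>N n\<close> kernels of scale at most \<open>e n\<close>, and
\<open>a n\<close> fixes its direction and length.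
\<close>

locale comb_data =
  fixes \<zeta> :: "nat \<Rightarrow> complex" and g :: "nat \<Rightarrow> real" and N :: "nat \<Rightarrow> nat"
    and a :: "nat \<Rightarrow> complex" and e :: "nat \<Rightarrow> real"
begin

definition tooth_fun :: "nat \<Rightarrow> complex \<Rightarrow> complex" where
  "tooth_fun k z = \<zeta> k * a k * tooth (N k) (e k) (hp_coord (\<zeta> k) z)"

definition tooth_fun_dd :: "nat \<Rightarrow> complex \<Rightarrow> complex \<Rightarrow> complex" where
  "tooth_fun_dd k z w = a k * tooth_dd (N k) (e k) (hp_coord (\<zeta> k) z) (hp_coord (\<zeta> k) w)"

text \<open>
Sums over arbitrary index sets are needed because the estimates near one tooth leave out its
summand.
\<close>

definition F :: "nat set \<Rightarrow> complex \<Rightarrow> complex" where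
  "F J z = z + (\<Sum>k\<in>J. tooth_fun k z)"

definition dd :: "nat set \<Rightarrow> complex \<Rightarrow> complex \<Rightarrow> complex" where
  "dd J z w = 1 + (\<Sum>k\<in>J. tooth_fun_dd k z w)"

text \<open>
The radius at \<open>\<zeta> k\<close> inside which a point counts as lying on the tooth \<open>k\<close>. The fraction \<open>1/16\<close> of the
gap is small enough for \<open>99/100 * (15/16) - 12/100 > 1/2\<close>, which gives \<open>tooth_separation\<close>.
\<close>

definition gam :: "nat \<Rightarrow> real" where "gam k = g k / 16"

text \<open>
The permitted influence of tooth \<open>k\<close> outside its own radius. It sums to at most \<open>g m / 100\<close> over the
indices from \<open>m\<close> on, so the later teeth change the picture around an earlier tooth only slightly in
comparison with its gap.
\<close>

definition eta :: "nat \<Rightarrow> real" where "eta k = g k / 2^k / 200"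

abbreviation away :: "nat \<Rightarrow> complex \<Rightarrow> bool" where
  "away k z \<equiv> gam k \<le> norm (z - \<zeta> k)"

end

text \<open>
By the choice of \<open>a n\<close> the tooth leaves the boundary along its normal. The assumption \<open>dominated\<close> says
that the new tooth is a small perturbation for pairs of points away from it. It is conditional on
the nonvanishing of the preceding divided difference, which is only proved later, so that the sizes
\<open>e n\<close> can be chosen by recursion beforehand.
\<close>

locale comb = comb_data +
  assumes norm_zeta: "\<And>n. norm (\<zeta> n) = 1"
    and g_pos: "\<And>n. 0 < g n" and g_0: "g 0 \<le> 1" and g_Suc: "\<And>n. g (Suc n) \<le> g n / 2"
    and sep: "\<And>k n. k < n \<Longrightarrow> g k \<le> norm (\<zeta> n - \<zeta> k)"
    and N_ge: "\<And>n. 1600 / g n \<le> real (N n)"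
    and a_eq: "\<And>n. a n = dd {..<n} (\<zeta> n) (\<zeta> n)"
    and e_pos: "\<And>n. 0 < e n" and e_le: "\<And>n. 4 * e n \<le> eta n * gam n ^ 3"
    and dominated: "\<And>n z w. \<lbrakk>\<And>z w. norm z \<le> 1 \<Longrightarrow> norm w \<le> 1 \<Longrightarrow> dd {..<n} z w \<noteq> 0;
          norm z \<le> 1; norm w \<le> 1; away n z; away n w\<rbrakk> \<Longrightarrow> norm (tooth_fun_dd n z w) < norm (dd {..<n} z w)"
begin

lemma g_mono: "m \<le> n \<Longrightarrow> g n \<le> g m"
proof (induction rule: dec_induct)
  case (step n)
  then show ?case using g_Suc[of n] g_pos[of n] by linarith
qed simp

lemma g_le: "g n \<le> 1 / 2^n"
proof (induction n)
  case (Suc n)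
  have "g n / 2 \<le> 1 / 2 ^ n / 2" using Suc by (intro divide_right_mono) auto
  moreover have "1 / 2 ^ Suc n = 1 / 2 ^ n / (2::real)" by simp
  ultimately show ?case using g_Suc[of n] by linarith
qed (use g_0 in simp)

lemma g_le1: "g n \<le> 1"
  using g_mono[of 0 n] g_0 by simp

lemma gam_pos: "0 < gam n" and gam_le: "gam n \<le> 1/16"
  using g_pos[of n] g_le1[of n] by (auto simp: gam_def)

lemma eta_pos: "0 < eta n"
  using g_pos by (simp add: eta_def)

lemma sum_eta_le:
  assumes "finite J" "\<And>j. j \<in> J \<Longrightarrow> m \<le> j"
  shows "sum eta J \<le> g m / 100"
proof -
  obtain n where n: "J \<subseteq> {..<n}" using assms(1) finite_nat_iff_bounded by blast
  have "sum eta J \<le> (\<Sum>j\<in>J. g m / 200 / 2^j)"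
  proof (intro sum_mono)
    fix j assume "j \<in> J"
    then have "g j \<le> g m" using assms(2) g_mono by blast
    then show "eta j \<le> g m / 200 / 2^j" by (simp add: eta_def divide_simps)
  qed
  also have "\<dots> \<le> (\<Sum>j<n. g m / 200 / 2^j)" using n g_pos[of m] by (intro sum_mono2) auto
  also have "\<dots> \<le> 2 * (g m / 200)" using g_pos[of m] by (intro sum_halves_le) simp
  finally show ?thesis by simp
qed

lemma sum_eta_le': "finite J \<Longrightarrow> sum eta J \<le> 1 / 100"
  using sum_eta_le[of J 0] g_0 by simp

text \<open>
The three powers bound a tooth, its divided difference and the Lipschitz constant of the latter
at distance \<open>gam n\<close> from its centre.
\<close>

lemma e_bounds: "4 * e n / gam n \<le> eta n" "4 * e n / (gam n)^2 \<le> eta n" "4 * e n / (gam n)^3 \<le> eta n"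
proof -
  show 3: "4 * e n / (gam n)^3 \<le> eta n" using e_le[of n] gam_pos[of n] by (simp add: divide_simps)
  have "gam n ^ 3 \<le> gam n ^ 2" "gam n ^ 3 \<le> gam n ^ 1"
    using gam_pos[of n] gam_le[of n] by (intro power_decreasing; simp)+
  then have "4 * e n / gam n^2 \<le> 4 * e n / gam n^3" "4 * e n / gam n^1 \<le> 4 * e n / gam n^3"
    using e_pos[of n] gam_pos[of n] by (intro divide_left_mono; simp)+
  then show "4 * e n / gam n \<le> eta n" "4 * e n / (gam n)^2 \<le> eta n" using 3 by simp_all
qed

lemma norm_tooth_fun_le:
  assumes "norm (a k) \<le> 2" "norm z \<le> 1"
  shows "norm (z - \<zeta> k) * norm (tooth_fun k z) \<le> 4 * e k"
proof -
  have *: "norm (hp_coord (\<zeta> k) z) * norm (tooth (N k) (e k) (hp_coord (\<zeta> k) z)) \<le> 2 * e k"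
    using assms norm_zeta e_pos by (intro norm_tooth_le Re_hp_coord_nonneg)
  have "norm (z - \<zeta> k) * norm (tooth_fun k z) = norm (a k) * (norm (hp_coord (\<zeta> k) z) * norm (tooth (N k) (e k) (hp_coord (\<zeta> k) z)))"
    by (simp add: tooth_fun_def norm_mult norm_zeta norm_hp_coord)
  also have "\<dots> \<le> 2 * (2 * e k)" by (rule mult_mono[OF assms(1) *]) auto
  finally show ?thesis by simp
qed

lemma tooth_fun_away:
  assumes "norm (a k) \<le> 2" "norm z \<le> 1" "away k z"
  shows "norm (tooth_fun k z) \<le> eta k"
proof -
  have "gam k * norm (tooth_fun k z) \<le> norm (z - \<zeta> k) * norm (tooth_fun k z)" using assms by (intro mult_right_mono) auto
  also have "\<dots> \<le> 4 * e k" using assms by (intro norm_tooth_fun_le)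
  finally have "norm (tooth_fun k z) \<le> 4 * e k / gam k" using gam_pos[of k] by (simp add: field_simps)
  then show ?thesis using e_bounds(1)[of k] by linarith
qed

lemma tooth_fun_dd_away:
  assumes "norm (a k) \<le> 2" "norm z \<le> 1" "norm w \<le> 1" "away k z" "away k w"
  shows "norm (tooth_fun_dd k z w) \<le> eta k"
proof -
  have "norm (tooth_dd (N k) (e k) (hp_coord (\<zeta> k) z) (hp_coord (\<zeta> k) w)) \<le> 2 * e k / (gam k)\<^sup>2"
    using assms gam_pos e_pos by (intro norm_tooth_dd_le Re_hp_coord_nonneg) (auto simp: norm_hp_coord norm_zeta)
  then have "norm (tooth_fun_dd k z w) \<le> 2 * (2 * e k / (gam k)\<^sup>2)"
    unfolding tooth_fun_dd_def norm_mult using assms by (intro mult_mono) auto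
  then show ?thesis using e_bounds(2)[of k] by simp
qed

lemma tooth_fun_dd_lip:
  assumes "norm (a k) \<le> 2" "norm z \<le> 1" "norm w \<le> 1" "norm z' \<le> 1" "norm w' \<le> 1"
    "away k z" "away k w" "away k z'" "away k w'"
  shows "norm (tooth_fun_dd k z w - tooth_fun_dd k z' w') \<le> eta k * (norm (z - z') + norm (w - w'))"
proof -
  let ?d = "norm (z - z') + norm (w - w')"
  have "norm (tooth_dd (N k) (e k) (hp_coord (\<zeta> k) z) (hp_coord (\<zeta> k) w) - tooth_dd (N k) (e k) (hp_coord (\<zeta> k) z') (hp_coord (\<zeta> k) w'))
     \<le> 2 * e k / (gam k)^3 * (norm (hp_coord (\<zeta> k) z - hp_coord (\<zeta> k) z') + norm (hp_coord (\<zeta> k) w - hp_coord (\<zeta> k) w'))"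
    using assms gam_pos e_pos by (intro norm_tooth_dd_diff_le Re_hp_coord_nonneg) (auto simp: norm_hp_coord norm_zeta)
  also have "\<dots> = 2 * e k / (gam k)^3 * ?d" by (simp add: hp_coord_diff norm_mult norm_zeta norm_minus_commute)
  finally have *: "norm (tooth_dd (N k) (e k) (hp_coord (\<zeta> k) z) (hp_coord (\<zeta> k) w) - tooth_dd (N k) (e k) (hp_coord (\<zeta> k) z') (hp_coord (\<zeta> k) w')) \<le> 2 * e k / (gam k)^3 * ?d" .
  have "norm (tooth_fun_dd k z w - tooth_fun_dd k z' w') \<le> 2 * (2 * e k / (gam k)^3 * ?d)"
    unfolding tooth_fun_dd_def right_diff_distrib[symmetric] norm_mult using * assms by (intro mult_mono) auto
  also have "\<dots> = (4 * e k / (gam k)^3) * ?d" by simp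
  also have "\<dots> \<le> eta k * ?d" using e_bounds(3)[of k] by (intro mult_right_mono) auto
  finally show ?thesis .
qed

lemma dd_near_1':
  assumes "finite J" "\<And>k. k \<in> J \<Longrightarrow> norm (a k) \<le> 2" "norm z \<le> 1" "norm w \<le> 1"
    "\<And>k. k \<in> J \<Longrightarrow> away k z \<and> away k w"
  shows "norm (dd J z w - 1) \<le> 1 / 100"
proof -
  have "norm (dd J z w - 1) \<le> sum eta J" unfolding dd_def using assms by (auto intro!: sum_norm_le tooth_fun_dd_away)
  then show ?thesis using sum_eta_le'[OF assms(1)] by linarith
qed

lemma centres_apart: "k \<noteq> n \<Longrightarrow> g (min k n) \<le> norm (\<zeta> n - \<zeta> k)"
  using sep[of k n] sep[of n k] by (auto simp: norm_minus_commute min_def)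

text \<open>
The radii \<open>gam\<close> are small fractions of the gaps, so every point is on at most one tooth.
\<close>

lemma near_away:
  assumes "norm (z - \<zeta> k) \<le> gam k" "j \<noteq> k"
  shows "away j z"
proof -
  have 1: "g (min j k) \<le> norm (\<zeta> k - \<zeta> j)" using centres_apart[of j k] assms by simp
  have 2: "g j \<le> g (min j k)" "g k \<le> g (min j k)" by (intro g_mono; simp)+
  have "norm (\<zeta> k - \<zeta> j) \<le> norm (z - \<zeta> j) + norm (z - \<zeta> k)"
    by (metis norm_minus_commute norm_diff_triangle_ineq diff_add_cancel add.commute norm_triangle_sub norm_triangle_le_diff dist_norm dist_triangle dist_commute)
  then show ?thesis using 1 2 assms g_pos[of k] g_pos[of j] unfolding gam_def by linarith
qed

lemma zeta_away: "j \<noteq> n \<Longrightarrow> away j (\<zeta> n)"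
  using near_away[of "\<zeta> n" n j] gam_pos[of n] by simp

lemma norm_a: "norm (a n - 1) \<le> 1/100"
proof (induction n rule: less_induct)
  case (less n)
  have "norm (a k) \<le> 2" if "k < n" for k
    using less[OF that] norm_triangle_sub[of "a k" 1] by auto
  then show ?case unfolding a_eq[of n] using zeta_away norm_zeta
    by (intro dd_near_1') auto
qed

lemma norm_a_le: "norm (a n) \<le> 101/100" and norm_a_ge: "99/100 \<le> norm (a n)"
  using norm_a[of n] norm_triangle_sub[of "a n" 1] norm_triangle_sub[of 1 "a n"] by (auto simp: norm_minus_commute)

lemma norm_a_le_2: "norm (a n) \<le> 2" using norm_a_le[of n] by simp

lemma dd_near_1:
  assumes "finite J" "norm z \<le> 1" "norm w \<le> 1"
    "\<And>k. k \<in> J \<Longrightarrow> away k z" "\<And>k. k \<in> J \<Longrightarrow> away k w"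
  shows "norm (dd J z w - 1) \<le> 1 / 100"
  using assms norm_a_le_2 by (intro dd_near_1') auto

text \<open>
This replaces a bound on the second derivative. It is stated for divided differences since the set
of points away from all teeth is not convex.
\<close>

lemma dd_lip:
  assumes J: "finite J" and "norm z \<le> 1" "norm w \<le> 1" "norm z' \<le> 1" "norm w' \<le> 1"
    "\<And>k. k \<in> J \<Longrightarrow> away k z" "\<And>k. k \<in> J \<Longrightarrow> away k w" "\<And>k. k \<in> J \<Longrightarrow> away k z'" "\<And>k. k \<in> J \<Longrightarrow> away k w'"
  shows "norm (dd J z w - dd J z' w') \<le> 1 / 100 * (norm (z - z') + norm (w - w'))"
proof -
  let ?d = "norm (z - z') + norm (w - w')"
  have "norm (dd J z w - dd J z' w') = norm (\<Sum>k\<in>J. tooth_fun_dd k z w - tooth_fun_dd k z' w')"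
    by (simp add: dd_def sum_subtractf)
  also have "\<dots> \<le> (\<Sum>k\<in>J. eta k * ?d)" using assms norm_a_le_2 by (intro sum_norm_le tooth_fun_dd_lip) auto
  also have "\<dots> = sum eta J * ?d" by (simp add: sum_distrib_right)
  also have "\<dots> \<le> 1/100 * ?d" using sum_eta_le'[OF J] by (intro mult_right_mono) auto
  finally show ?thesis .
qed

lemma tooth_fun_diff:
  assumes "norm z \<le> 1" "norm w \<le> 1"
  shows "tooth_fun k z - tooth_fun k w = (z - w) * tooth_fun_dd k z w"
proof -
  have "tooth_fun k z - tooth_fun k w = \<zeta> k * a k * ((hp_coord (\<zeta> k) w - hp_coord (\<zeta> k) z) * tooth_dd (N k) (e k) (hp_coord (\<zeta> k) z) (hp_coord (\<zeta> k) w))"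
    unfolding tooth_fun_def right_diff_distrib[symmetric] using assms norm_zeta e_pos
    by (subst tooth_diff) (auto intro!: Re_hp_coord_nonneg)
  also have "hp_coord (\<zeta> k) w - hp_coord (\<zeta> k) z = cnj (\<zeta> k) * (z - w)" by (rule hp_coord_diff)
  also have "\<zeta> k * a k * (cnj (\<zeta> k) * (z - w) * X) = (\<zeta> k * cnj (\<zeta> k)) * ((z - w) * (a k * X))" for X
    by (simp add: algebra_simps)
  also have "\<zeta> k * cnj (\<zeta> k) = 1" using norm_zeta[of k] by (metis complex_norm_square of_real_1 one_power2)
  finally show ?thesis by (simp add: tooth_fun_dd_def)
qed

lemma F_diff:
  assumes "norm z \<le> 1" "norm w \<le> 1"
  shows "F J z - F J w = (z - w) * dd J z w"
proof -
  have "F J z - F J w = (z - w) + (\<Sum>k\<in>J. tooth_fun k z - tooth_fun k w)" by (simp add: F_def sum_subtractf)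
  also have "\<dots> = (z - w) * dd J z w" using assms by (simp add: tooth_fun_diff dd_def sum_distrib_left algebra_simps)
  finally show ?thesis .
qed

lemma dd_sym: "dd J z w = dd J w z"
  by (simp add: dd_def tooth_fun_dd_def tooth_dd_def mult.commute)

lemma dd_remove: "finite J \<Longrightarrow> k \<in> J \<Longrightarrow> dd J z w = dd (J - {k}) z w + tooth_fun_dd k z w"
  by (simp add: dd_def sum.remove algebra_simps)

lemma F_remove: "finite J \<Longrightarrow> k \<in> J \<Longrightarrow> F J z = F (J - {k}) z + tooth_fun k z"
  by (simp add: F_def sum.remove algebra_simps)

text \<open>
The points of the circle at which another tooth could still be attached to \<open>F {..<n}\<close>.
\<close>

definition free :: "nat \<Rightarrow> complex \<Rightarrow> bool" where
  "free n \<xi> \<longleftrightarrow> norm \<xi> = 1 \<and> (\<forall>j<n. g j \<le> norm (\<xi> - \<zeta> j))"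

lemma free_zeta: "free n (\<zeta> n)"
  using norm_zeta sep by (simp add: free_def)

lemma free_away: "free n \<xi> \<Longrightarrow> j < n \<Longrightarrow> away j \<xi>"
  using g_pos[of j] unfolding free_def gam_def by force

text \<open>
The position along the tooth \<open>k\<close>, between 0 at its base and 1 at its tip.
\<close>

definition height :: "nat \<Rightarrow> complex \<Rightarrow> real" where
  "height k z = Re (tooth (N k) (e k) (hp_coord (\<zeta> k) z))"

lemma height: "norm z \<le> 1 \<Longrightarrow> 0 \<le> height k z" "norm z \<le> 1 \<Longrightarrow> height k z \<le> 1"
  unfolding height_def using norm_zeta e_pos by (auto intro!: Re_tooth Re_hp_coord_nonneg)

lemma tooth_height:
  assumes "norm z \<le> 1"
  shows "norm (tooth (N k) (e k) (hp_coord (\<zeta> k) z) - of_real (height k z)) \<le> g k / 400"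
proof -
  let ?t = "tooth (N k) (e k) (hp_coord (\<zeta> k) z)"
  have N: "0 < real (N k)" using N_ge[of k] g_pos[of k] by (smt (verit) zero_less_divide_iff)
  have "?t - of_real (height k z) = \<i> * of_real (Im ?t)" by (simp add: complex_eq_iff height_def)
  then have "norm (?t - of_real (height k z)) = \<bar>Im ?t\<bar>" by (simp add: norm_mult)
  also have "\<dots> \<le> 4 / real (N k)" using assms norm_zeta e_pos by (intro abs_Im_tooth_le Re_hp_coord_nonneg)
  also have "\<dots> \<le> g k / 400" using N_ge[of k] N g_pos[of k] by (simp add: field_simps)
  finally show ?thesis .
qed

lemma tooth_fun_height:
  assumes "norm z \<le> 1"
  shows "norm (tooth_fun k z - \<zeta> k * a k * of_real (height k z)) \<le> g k / 390"
proof -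
  have "norm (tooth_fun k z - \<zeta> k * a k * of_real (height k z)) = norm (a k) * norm (tooth (N k) (e k) (hp_coord (\<zeta> k) z) - of_real (height k z))"
    by (simp add: tooth_fun_def norm_mult norm_zeta flip: right_diff_distrib)
  also have "\<dots> \<le> 101/100 * (g k / 400)" using norm_a_le tooth_height[OF assms] by (intro mult_mono) auto
  also have "\<dots> \<le> g k / 390" using g_pos[of k] by simp
  finally show ?thesis .
qed

text \<open>
Compares a point on the tooth \<open>k\<close> with a point on the normal at a free point \<open>\<xi>\<close> of the boundary. Up to
an error that is small relative to the distance \<open>d\<close> of \<open>\<xi>\<close> from \<open>\<zeta> k\<close>, the difference is that of the
radial comb over the unit circle, multiplied by the derivative \<open>A\<close> at \<open>\<xi>\<close> of the map without the
tooth \<open>k\<close>. Such relative precision is available because the derivatives at \<open>\<xi>\<close> and at \<open>\<zeta> k\<close>, which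
determine the directions of the two normals, differ by a small multiple of \<open>d\<close>.
\<close>

lemma tooth_position:
  assumes z: "norm z \<le> 1" "norm (z - \<zeta> k) \<le> gam k" and k: "k < n" and \<xi>: "free n \<xi>"
    and t: "0 \<le> t" "t \<le> 1"
  defines "A \<equiv> dd ({..<n} - {k}) \<xi> \<xi>" and "d \<equiv> norm (\<xi> - \<zeta> k)"
  shows "norm (F {..<n} z - F {..<n} \<xi> - of_real t * \<xi> * dd {..<n} \<xi> \<xi>
           - A * ((z - \<xi>) + of_real (height k z) * \<zeta> k - of_real t * \<xi>)) \<le> 12/100 * d"
    and "norm (A - 1) \<le> 1/100"
proof -
  define J where "J = {..<n} - {k}"
  have J: "finite J" "{..<n} - {k} = J" by (simp_all add: J_def)
  have n\<xi>: "norm \<xi> = 1" and gd: "g k \<le> d" using \<xi> k by (auto simp: free_def d_def)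
  have d0: "0 < d" using gd g_pos[of k] by linarith
  have Jz: "away j z" if "j \<in> J" for j using near_away[OF z(2)] that by (auto simp: J_def)
  have J\<xi>: "away j \<xi>" if "j \<in> J" for j using free_away[OF \<xi>] that by (auto simp: J_def)
  have J\<zeta>: "away j (\<zeta> k)" if "j \<in> J" for j using zeta_away that by (auto simp: J_def)
  show A1: "norm (A - 1) \<le> 1/100" unfolding A_def J using J J\<xi> n\<xi> by (intro dd_near_1) auto
  then have A: "norm A \<le> 101/100" using norm_triangle_sub[of A 1] by simp
  define x where "x = height k z"
  define \<tau> where "\<tau> = tooth (N k) (e k) (hp_coord (\<zeta> k) z)"
  have x: "0 \<le> x" "x \<le> 1" using height z by (auto simp: x_def)
  have \<tau>x: "norm (\<tau> - of_real x) \<le> g k / 400" using tooth_height[OF z(1)] by (simp add: \<tau>_def x_def)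
  have \<tau>2: "norm \<tau> \<le> 2"
    using norm_triangle_sub[of \<tau> "of_real x"] \<tau>x x g_le1[of k] by simp
  have z\<xi>: "norm (z - \<xi>) \<le> 17/16 * d" "norm (z - \<xi>) \<le> 2"
  proof -
    have "norm (z - \<xi>) \<le> norm (z - \<zeta> k) + d" unfolding d_def
      by (metis dist_norm dist_triangle2 norm_minus_commute)
    then show "norm (z - \<xi>) \<le> 17/16 * d" using z gd by (simp add: gam_def)
    show "norm (z - \<xi>) \<le> 2" using norm_triangle_ineq4[of z \<xi>] z n\<xi> by simp
  qed
  \<comment> \<open>\<open>E1\<close> is the error of linearizing the map without tooth \<open>k\<close>, \<open>E2\<close> the error in direction and width of tooth \<open>k\<close>.\<close>
  define E1 where "E1 = (z - \<xi>) * (dd J z \<xi> - A)"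
  define E2 where "E2 = \<zeta> k * (a k - A) * \<tau> + A * \<zeta> k * (\<tau> - of_real x)"
  have "norm E1 \<le> 3/100 * d"
  proof -
    have "norm (dd J z \<xi> - A) \<le> 1/100 * (norm (z - \<xi>) + norm (\<xi> - \<xi>))"
      unfolding A_def J using z n\<xi> J Jz J\<xi> by (intro dd_lip) auto
    then have "norm E1 \<le> norm (z - \<xi>) * (1/100 * norm (z - \<xi>))"
      unfolding E1_def norm_mult by (intro mult_left_mono) auto
    also have "\<dots> \<le> 2 * (1/100 * (17/16 * d))" using z\<xi> by (intro mult_mono) auto
    finally show ?thesis using d0 by simp
  qed
  moreover have "norm E2 \<le> 7/100 * d"
  proof -
    \<comment> \<open>The earlier teeth are accounted for exactly by \<open>a k\<close>; only the later ones contribute an error.\<close>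
    have "dd J (\<zeta> k) (\<zeta> k) = a k + (\<Sum>j\<in>{k<..<n}. tooth_fun_dd j (\<zeta> k) (\<zeta> k))"
    proof -
      have "J = {..<k} \<union> {k<..<n}" using k by (auto simp: J_def)
      then have "(\<Sum>j\<in>J. tooth_fun_dd j (\<zeta> k) (\<zeta> k)) = (\<Sum>j<k. tooth_fun_dd j (\<zeta> k) (\<zeta> k)) + (\<Sum>j\<in>{k<..<n}. tooth_fun_dd j (\<zeta> k) (\<zeta> k))"
        by (simp add: sum.union_disjoint disjoint_iff)
      then show ?thesis unfolding a_eq[of k] dd_def by simp
    qed
    moreover have "norm (\<Sum>j\<in>{k<..<n}. tooth_fun_dd j (\<zeta> k) (\<zeta> k)) \<le> sum eta {k<..<n}"
      using norm_a_le_2 norm_zeta zeta_away by (intro sum_norm_le tooth_fun_dd_away) auto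
    moreover have "sum eta {k<..<n} \<le> g k / 100" by (intro sum_eta_le) auto
    ultimately have "norm (a k - dd J (\<zeta> k) (\<zeta> k)) \<le> d / 100" using gd by (simp add: norm_minus_commute)
    moreover have "norm (dd J (\<zeta> k) (\<zeta> k) - A) \<le> 1/100 * (norm (\<zeta> k - \<xi>) + norm (\<zeta> k - \<xi>))"
      unfolding A_def J using n\<xi> J J\<zeta> J\<xi> norm_zeta by (intro dd_lip) auto
    moreover have "norm (a k - A) \<le> norm (a k - dd J (\<zeta> k) (\<zeta> k)) + norm (dd J (\<zeta> k) (\<zeta> k) - A)"
      by (metis diff_add_cancel add_diff_eq norm_triangle_ineq)
    ultimately have aA: "norm (a k - A) \<le> 3/100 * d" by (simp add: d_def norm_minus_commute)
    have "norm (a k - A) * norm \<tau> \<le> (3/100 * d) * 2"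
      using aA \<tau>2 d0 by (intro mult_mono) auto
    then have "norm (\<zeta> k * (a k - A) * \<tau>) \<le> 3/100 * d * 2"
      by (simp add: norm_mult norm_zeta)
    moreover have "norm (A * \<zeta> k * (\<tau> - of_real x)) \<le> 101/100 * (g k / 400)"
      unfolding norm_mult norm_zeta mult_1_right using A \<tau>x by (intro mult_mono) auto
    ultimately show ?thesis unfolding E2_def using norm_triangle_ineq[of "\<zeta> k * (a k - A) * \<tau>" "A * \<zeta> k * (\<tau> - of_real x)"] gd d0
      by simp
  qed
  moreover have eta: "eta k \<le> d / 200"
  proof -
    have "g k / 2^k \<le> g k" using g_pos[of k] by (simp add: divide_simps mult_le_cancel_left1)
    then show ?thesis using gd by (simp add: eta_def)
  qed
  moreover have "norm (tooth_fun k \<xi>) \<le> eta k" using norm_a_le_2 n\<xi> free_away[OF \<xi> k] by (intro tooth_fun_away) auto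
  moreover have "norm (of_real t * \<xi> * tooth_fun_dd k \<xi> \<xi>) \<le> eta k"
  proof -
    have "norm (tooth_fun_dd k \<xi> \<xi>) \<le> eta k" using norm_a_le_2 n\<xi> free_away[OF \<xi> k] by (intro tooth_fun_dd_away) auto
    then have "t * norm (tooth_fun_dd k \<xi> \<xi>) \<le> 1 * eta k" using t by (intro mult_mono) auto
    then show ?thesis using t n\<xi> by (simp add: norm_mult)
  qed
  moreover have eq: "F {..<n} z - F {..<n} \<xi> - of_real t * \<xi> * dd {..<n} \<xi> \<xi>
           - A * ((z - \<xi>) + of_real (height k z) * \<zeta> k - of_real t * \<xi>) = E1 + E2 - tooth_fun k \<xi> - of_real t * \<xi> * tooth_fun_dd k \<xi> \<xi>"
  proof -
    have "F {..<n} z - F {..<n} \<xi> = (F J z - F J \<xi>) + tooth_fun k z - tooth_fun k \<xi>"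
      using F_remove[of "{..<n}" k] k unfolding J by simp
    moreover have "F J z - F J \<xi> = (z - \<xi>) * dd J z \<xi>" using z n\<xi> by (intro F_diff) auto
    moreover have "dd {..<n} \<xi> \<xi> = A + tooth_fun_dd k \<xi> \<xi>" using dd_remove[of "{..<n}" k] k by (simp add: A_def)
    moreover have "tooth_fun k z = \<zeta> k * a k * \<tau>" by (simp add: tooth_fun_def \<tau>_def)
    ultimately show ?thesis unfolding E1_def E2_def x_def by (simp add: algebra_simps)
  qed
  moreover have "norm (E1 + E2 - tooth_fun k \<xi> - of_real t * \<xi> * tooth_fun_dd k \<xi> \<xi>) \<le> norm E1 + norm E2 + norm (tooth_fun k \<xi>) + norm (of_real t * \<xi> * tooth_fun_dd k \<xi> \<xi>)"
    by (smt (verit) norm_triangle_ineq norm_triangle_ineq4)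
  ultimately show "norm (F {..<n} z - F {..<n} \<xi> - of_real t * \<xi> * dd {..<n} \<xi> \<xi>
           - A * ((z - \<xi>) + of_real (height k z) * \<zeta> k - of_real t * \<xi>)) \<le> 12/100 * d"
    unfolding eq using d0 by linarith
qed

end

text \<open>
The nearest point projection onto the closed unit disc does not increase distances.
\<close>

lemma radial_distance:
  fixes \<xi> \<zeta>' :: complex
  assumes "norm \<xi> = 1" "norm \<zeta>' = 1" "1 \<le> r" "1 \<le> s"
  shows "norm (\<xi> - \<zeta>') \<le> norm (of_real r * \<xi> - of_real s * \<zeta>')"
proof -
  have n1: "(Re \<xi>)\<^sup>2 + (Im \<xi>)\<^sup>2 = 1" "(Re \<zeta>')\<^sup>2 + (Im \<zeta>')\<^sup>2 = 1"
    using assms by (simp_all flip: cmod_power2)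
  define c where "c = Re \<xi> * Re \<zeta>' + Im \<xi> * Im \<zeta>'"
  have e: "(norm (of_real r * \<xi> - of_real s * \<zeta>'))\<^sup>2 = r\<^sup>2 * ((Re \<xi>)\<^sup>2 + (Im \<xi>)\<^sup>2) + s\<^sup>2 * ((Re \<zeta>')\<^sup>2 + (Im \<zeta>')\<^sup>2) - 2 * (r * s) * c"
    for r s by (simp only: cmod_power2) (simp add: c_def power2_eq_square algebra_simps)
  have "c \<le> 1"
    using sum_squares_ge_zero[of "Re \<xi> - Re \<zeta>'" "Im \<xi> - Im \<zeta>'"] n1 by (simp add: c_def power2_eq_square algebra_simps)
  moreover have "1 \<le> r * s" using mult_mono[of 1 r 1 s] assms by simp
  ultimately have "(1 - c) * (r * s - 1) \<ge> 0" by simp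
  moreover have "(r - s)\<^sup>2 \<ge> 0" by simp
  ultimately have "2 - 2 * c \<le> r\<^sup>2 + s\<^sup>2 - 2 * (r * s) * c" by (simp add: power2_eq_square algebra_simps)
  then have "(norm (\<xi> - \<zeta>'))\<^sup>2 \<le> (norm (of_real r * \<xi> - of_real s * \<zeta>'))\<^sup>2"
    using e[of 1 1] e[of r s] n1 by simp
  then show ?thesis by (rule power2_le_imp_le) simp
qed

context comb begin

text \<open>
Normals at different points of the comb stay apart along their whole length.
\<close>

lemma tooth_separation:
  assumes z: "norm z \<le> 1" "norm (z - \<zeta> k) \<le> gam k" and k: "k < n" and \<xi>: "free n \<xi>"
    and t: "0 \<le> t" "t \<le> 1"
  shows "norm (\<xi> - \<zeta> k) / 2 \<le> norm (F {..<n} z - F {..<n} \<xi> - of_real t * \<xi> * dd {..<n} \<xi> \<xi>)"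
proof -
  define A d where "A = dd ({..<n} - {k}) \<xi> \<xi>" and "d = norm (\<xi> - \<zeta> k)"
  define x where "x = height k z"
  define V where "V = (z - \<xi>) + of_real x * \<zeta> k - of_real t * \<xi>"
  have n\<xi>: "norm \<xi> = 1" and gd: "g k \<le> d" using \<xi> k by (auto simp: free_def d_def)
  have x: "0 \<le> x" using height z by (simp add: x_def)
  have "d \<le> norm (of_real (1 + t) * \<xi> - of_real (1 + x) * \<zeta> k)"
    unfolding d_def using n\<xi> norm_zeta t x by (intro radial_distance) auto
  also have "of_real (1 + t) * \<xi> - of_real (1 + x) * \<zeta> k = (z - \<zeta> k) - V"
    by (simp add: V_def algebra_simps)
  also have "norm \<dots> \<le> norm (z - \<zeta> k) + norm V" by (rule norm_triangle_ineq4)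
  finally have V: "15/16 * d \<le> norm V" using z gd by (simp add: gam_def)
  have A: "99/100 \<le> norm A"
    using norm_triangle_sub[of 1 A] tooth_position(2)[OF assms] by (simp add: A_def norm_minus_commute)
  have "99/100 * (15/16 * d) \<le> norm A * norm V" using A V by (intro mult_mono) (auto simp: d_def)
  moreover have "norm A * norm V \<le> norm (F {..<n} z - F {..<n} \<xi> - of_real t * \<xi> * dd {..<n} \<xi> \<xi>) + 12/100 * d"
    using tooth_position(1)[OF assms] norm_triangle_sub[of "A * V" "F {..<n} z - F {..<n} \<xi> - of_real t * \<xi> * dd {..<n} \<xi> \<xi>"]
    unfolding norm_mult[symmetric] A_def d_def V_def x_def by (simp add: norm_minus_commute)
  moreover have "0 \<le> d" by (simp add: d_def)
  ultimately show ?thesis unfolding d_def[symmetric] by linarith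
qed

text \<open>
Teeth whose centres approach \<open>\<xi>\<close> converge to the normal at \<open>\<xi>\<close>, at equal heights.
\<close>

lemma tooth_proximity:
  assumes z: "norm z \<le> 1" "norm (z - \<zeta> k) \<le> gam k" and k: "k < n" and \<xi>: "free n \<xi>"
  shows "norm (F {..<n} z - F {..<n} \<xi> - of_real (height k z) * \<xi> * dd {..<n} \<xi> \<xi>) \<le> 3 * norm (\<xi> - \<zeta> k)"
proof -
  define A d where "A = dd ({..<n} - {k}) \<xi> \<xi>" and "d = norm (\<xi> - \<zeta> k)"
  define x where "x = height k z"
  define V where "V = (z - \<xi>) + of_real x * \<zeta> k - of_real x * \<xi>"
  have n\<xi>: "norm \<xi> = 1" and gd: "g k \<le> d" using \<xi> k by (auto simp: free_def d_def)
  have x: "0 \<le> x" "x \<le> 1" using height z by (simp_all add: x_def)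
  note pos = tooth_position[OF z k \<xi> height(1)[OF z(1), of k] height(2)[OF z(1), of k]]
  have "V = (z - \<zeta> k) + of_real (1 + x) * (\<zeta> k - \<xi>)" by (simp add: V_def algebra_simps)
  then have "norm V \<le> norm (z - \<zeta> k) + norm (of_real (1 + x) * (\<zeta> k - \<xi>))" by (simp only: norm_triangle_ineq)
  also have "\<dots> \<le> d / 16 + 2 * d"
  proof (rule add_mono)
    show "norm (of_real (1 + x) * (\<zeta> k - \<xi>)) \<le> 2 * d"
      unfolding norm_mult d_def norm_minus_commute[of \<xi>] using x by (intro mult_right_mono) (auto simp: norm_of_real simp del: of_real_add)
  qed (use z gd in \<open>simp add: gam_def\<close>)
  finally have V: "norm V \<le> 33/16 * d" by simp
  have A: "norm A \<le> 101/100"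
    using norm_triangle_sub[of A 1] pos(2) by (simp add: A_def)
  have "norm A * norm V \<le> 101/100 * (33/16 * d)" using A V by (intro mult_mono) auto
  moreover have "norm (F {..<n} z - F {..<n} \<xi> - of_real x * \<xi> * dd {..<n} \<xi> \<xi>) \<le> norm A * norm V + 12/100 * d"
    using pos(1) norm_triangle_sub[of "F {..<n} z - F {..<n} \<xi> - of_real x * \<xi> * dd {..<n} \<xi> \<xi>" "A * V"]
    unfolding norm_mult[symmetric] A_def d_def V_def x_def by simp
  moreover have "0 \<le> d" by (simp add: d_def)
  ultimately show ?thesis unfolding d_def[symmetric] x_def[symmetric] by linarith
qed

text \<open>
Induction over the teeth. For a pair away from all the earlier teeth the convexity argument
\<open>perturbed_kernel_sum_nonzero\<close> applies. If one point lies on an earlier tooth and the other is away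
from the new one, the new summand is dominated. If the other point is on the new tooth,
the images are separated by \<open>tooth_separation\<close> with the new tooth as normal.
\<close>

lemma dd_nonzero: "norm z \<le> 1 \<Longrightarrow> norm w \<le> 1 \<Longrightarrow> dd {..<n} z w \<noteq> 0"
proof (induction n arbitrary: z w)
  case 0
  then show ?case by (simp add: dd_def)
next
  case (Suc n)
  have dSuc: "dd {..<Suc n} z w = dd {..<n} z w + tooth_fun_dd n z w" for z w by (simp add: dd_def)
  have FSuc: "F {..<Suc n} z = F {..<n} z + tooth_fun n z" for z by (simp add: F_def)
  have mixed: "dd {..<Suc n} z w \<noteq> 0"
    if z: "norm z \<le> 1" and w: "norm w \<le> 1" and k: "k < n" "\<not> away k w" for z w k
  proof -
    have wk: "norm (w - \<zeta> k) \<le> gam k" using k by simp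
    have wn: "away n w" using near_away[OF wk, of n] k by simp
    show ?thesis
    proof (cases "away n z")
      case True
      have "norm (tooth_fun_dd n z w) < norm (dd {..<n} z w)"
        using dominated[of n z w] Suc.IH z w True wn by blast
      then show ?thesis unfolding dSuc by (metis add_eq_0_iff2 norm_minus_cancel less_irrefl)
    next
      case False
      define x d where "x = height n z" and "d = norm (\<zeta> n - \<zeta> k)"
      have gd: "g n \<le> d" using sep[OF k(1)] g_mono[of k n] k by (simp add: d_def)
      have x: "0 \<le> x" "x \<le> 1" using height z by (simp_all add: x_def)
      have 1: "d / 2 \<le> norm (F {..<n} w - F {..<n} (\<zeta> n) - of_real x * \<zeta> n * a n)"
        using tooth_separation[OF w wk k(1) free_zeta x] by (simp add: d_def a_eq[of n])
      have 2: "norm (tooth_fun n z - \<zeta> n * a n * of_real x) \<le> g n / 390"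
        using tooth_fun_height[OF z] by (simp add: x_def)
      have 3: "norm (F {..<n} z - F {..<n} (\<zeta> n)) \<le> g n / 10"
      proof -
        have "away j z" if "j < n" for j using near_away[of z n j] False that by simp
        then have "norm (dd {..<n} z (\<zeta> n) - 1) \<le> 1/100"
          using z norm_zeta zeta_away by (intro dd_near_1) auto
        then have "norm (dd {..<n} z (\<zeta> n)) \<le> 101/100"
          using norm_triangle_sub[of "dd {..<n} z (\<zeta> n)" 1] by simp
        moreover have "norm (z - \<zeta> n) \<le> g n / 16" using False by (simp add: gam_def)
        ultimately have "norm (z - \<zeta> n) * norm (dd {..<n} z (\<zeta> n)) \<le> g n / 16 * (101/100)"
          using g_pos[of n] by (intro mult_mono) auto
        moreover have "F {..<n} z - F {..<n} (\<zeta> n) = (z - \<zeta> n) * dd {..<n} z (\<zeta> n)"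
          using z norm_zeta by (intro F_diff) auto
        ultimately show ?thesis using g_pos[of n] by (simp add: norm_mult)
      qed
      have 4: "norm (tooth_fun n w) \<le> g n / 200"
      proof -
        have "g n / 2^n \<le> g n" using g_pos[of n] by (simp add: divide_simps mult_le_cancel_left1)
        then show ?thesis using tooth_fun_away[OF norm_a_le_2 w wn] by (simp add: eta_def)
      qed
      have "F {..<n} w - F {..<n} (\<zeta> n) - of_real x * \<zeta> n * a n
          = (F {..<Suc n} w - F {..<Suc n} z) + (F {..<n} z - F {..<n} (\<zeta> n)) + (tooth_fun n z - \<zeta> n * a n * of_real x) - tooth_fun n w"
        by (simp add: FSuc)
      then have "d / 2 \<le> norm (F {..<Suc n} w - F {..<Suc n} z) + g n / 10 + g n / 390 + g n / 200"
        using 1 2 3 4 by (smt (verit) norm_triangle_ineq norm_triangle_ineq4)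
      then have "F {..<Suc n} w \<noteq> F {..<Suc n} z" using gd g_pos[of n] by auto
      then show ?thesis using F_diff[OF w z, of "{..<Suc n}"] dd_sym[of _ w z] by auto
    qed
  qed
  show ?case
  proof (cases "(\<forall>k<n. away k z) \<and> (\<forall>k<n. away k w)")
    case False
    then show ?thesis using mixed Suc.prems dd_sym by metis
  next
    case True
    have an: "a n \<noteq> 0" using norm_a_ge[of n] by auto
    define q where "q = dd {..<n} z w / a n"
    have "norm (dd {..<n} z w - a n) \<le> 1/100 * (norm (z - \<zeta> n) + norm (w - \<zeta> n))"
      unfolding a_eq[of n] using Suc.prems True norm_zeta zeta_away by (intro dd_lip) auto
    then have "norm (dd {..<n} z w - a n) / norm (a n) \<le> 1/100 * (norm (z - \<zeta> n) + norm (w - \<zeta> n)) / (99/100)"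
      using norm_a_ge[of n] by (intro frac_le) auto
    moreover have "q - 1 = (dd {..<n} z w - a n) / a n" using an by (simp add: q_def diff_divide_distrib)
    then have "norm (q - 1) = norm (dd {..<n} z w - a n) / norm (a n)" by (simp only: norm_divide)
    ultimately have "norm (q - 1) \<le> 1/100 * (norm (z - \<zeta> n) + norm (w - \<zeta> n)) / (99/100)" by simp
    also have "\<dots> \<le> 1/50 * (norm (z - \<zeta> n) + norm (w - \<zeta> n))" by simp
    finally have "norm (q - 1) \<le> 1/50 * (norm (hp_coord (\<zeta> n) z) + norm (hp_coord (\<zeta> n) w))"
      unfolding norm_hp_coord[OF norm_zeta] .
    then have "q + tooth_dd (N n) (e n) (hp_coord (\<zeta> n) z) (hp_coord (\<zeta> n) w) \<noteq> 0"
      unfolding tooth_dd_def using Suc.prems norm_zeta e_pos less_imp_le[OF e_pos]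
      by (intro perturbed_kernel_sum_nonzero[where \<eta> = "1/50"] hp_coord_disc) auto
    moreover have "dd {..<Suc n} z w = a n * (q + tooth_dd (N n) (e n) (hp_coord (\<zeta> n) z) (hp_coord (\<zeta> n) w))"
      using an by (simp add: dSuc tooth_fun_dd_def q_def distrib_left)
    ultimately show ?thesis using an by simp
  qed
qed

end

section \<open>The limit map and the accumulation set of the teeth\<close>

context comb begin

lemma hp_coord_plus_nonzero: "norm z \<le> 1 \<Longrightarrow> 0 < s \<Longrightarrow> of_real s + hp_coord (\<zeta> k) z \<noteq> 0"
  using norm_zeta by (intro add_pos_nonzero Re_hp_coord_nonneg) auto

lemma tooth_fun_holomorphic: "tooth_fun k holomorphic_on ball 0 1"
proof -
  have "of_real (e k) / 2^i + (1 - cnj (\<zeta> k) * z) \<noteq> 0" if "z \<in> ball 0 1" for z :: complex and i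
    using hp_coord_plus_nonzero[of z "e k / 2^i" k] that e_pos[of k] by (simp add: hp_coord_def)
  then have *: "(\<lambda>z. \<zeta> k * a k * tooth (N k) (e k) (1 - cnj (\<zeta> k) * z)) holomorphic_on ball 0 1"
    unfolding tooth_def by (cases "N k = 0") (auto intro!: holomorphic_intros)
  show ?thesis using * unfolding tooth_fun_def hp_coord_def .
qed

lemma tooth_fun_continuous: "continuous_on (cball 0 1) (tooth_fun k)"
proof -
  have "of_real (e k) / 2^i + (1 - cnj (\<zeta> k) * z) \<noteq> 0" if "z \<in> cball 0 1" for z :: complex and i
    using hp_coord_plus_nonzero[of z "e k / 2^i" k] that e_pos[of k] by (simp add: hp_coord_def)
  then have *: "continuous_on (cball 0 1) (\<lambda>z. \<zeta> k * a k * tooth (N k) (e k) (1 - cnj (\<zeta> k) * z))"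
    unfolding tooth_def by (cases "N k = 0") (auto intro!: continuous_intros)
  show ?thesis using * unfolding tooth_fun_def hp_coord_def .
qed

lemma F_holomorphic: "F J holomorphic_on ball 0 1"
  unfolding F_def[abs_def] using tooth_fun_holomorphic by (intro holomorphic_intros)

lemma F_continuous: "continuous_on (cball 0 1) (F J)"
  unfolding F_def[abs_def] using tooth_fun_continuous by (intro continuous_intros)

lemma F_inj: "inj_on (F {..<n}) (cball 0 1)"
proof (rule inj_onI)
  fix z w assume zw: "z \<in> cball 0 1" "w \<in> cball 0 1" "F {..<n} z = F {..<n} w"
  then have "(z - w) * dd {..<n} z w = 0" using F_diff[of z w "{..<n}"] by simp
  then show "z = w" using dd_nonzero[of z w n] zw by simp
qed

lemma gam_to_0: "gam \<longlonglongrightarrow> 0" and g_to_0: "g \<longlonglongrightarrow> 0"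
proof -
  show 1: "g \<longlonglongrightarrow> 0"
  proof (rule tendsto_sandwich[OF _ _ tendsto_const LIMSEQ_inverse_realpow_zero[of 2]])
    show "\<forall>\<^sub>F n in sequentially. 0 \<le> g n" using g_pos less_imp_le by (intro always_eventually) blast
    show "\<forall>\<^sub>F n in sequentially. g n \<le> inverse (2 ^ n)" using g_le by (auto simp: inverse_eq_divide)
  qed simp
  show "gam \<longlonglongrightarrow> 0" unfolding gam_def[abs_def] using tendsto_divide[OF 1 tendsto_const[of 16]] by simp
qed

lemma summable_eta: "summable eta"
  by (rule summableI_nonneg_bounded[where x = "1/100"]) (rule less_imp_le[OF eta_pos], rule sum_eta_le', simp)

text \<open>
Every point of the closed disc, including those on the circle, is away from all teeth but at most
one. Hence the series for \<open>f\<close> converges on the closed disc and not only inside.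
\<close>

lemma ev_away:
  assumes "norm z \<le> 1"
  shows "\<forall>\<^sub>F k in sequentially. away k z"
proof (cases "\<exists>k. norm (z - \<zeta> k) \<le> gam k")
  case True
  then obtain k where "norm (z - \<zeta> k) \<le> gam k" by blast
  then have "\<forall>j\<ge>Suc k. away j z" using near_away by (metis not_less_eq_eq order_refl)
  then show ?thesis unfolding eventually_sequentially by blast
next
  case False
  then show ?thesis by (auto intro!: always_eventually simp: not_le less_imp_le)
qed

definition f :: "complex \<Rightarrow> complex" where "f z = z + (\<Sum>k. tooth_fun k z)"

lemma F_tendsto:
  assumes "norm z \<le> 1" shows "(\<lambda>n. F {..<n} z) \<longlonglongrightarrow> f z"
proof -
  have "summable (\<lambda>k. tooth_fun k z)"
    by (rule summable_comparison_test_ev[OF _ summable_eta])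
      (use ev_away[OF assms] in \<open>eventually_elim, use assms norm_a_le_2 tooth_fun_away in blast\<close>)
  then show ?thesis unfolding F_def f_def by (intro tendsto_intros summable_LIMSEQ)
qed

lemma F_uniform:
  assumes "r < 1"
  shows "uniform_limit (cball 0 r) (\<lambda>n. F {..<n}) f sequentially"
proof -
  have "\<forall>\<^sub>F n in sequentially. gam n < 1 - r" using gam_to_0 assms by (intro order_tendstoD) auto
  then have "\<forall>\<^sub>F n in sequentially. \<forall>z\<in>cball 0 r. norm (tooth_fun n z) \<le> eta n"
  proof eventually_elim
    case (elim n)
    show ?case
    proof
      fix z :: complex assume z: "z \<in> cball 0 r"
      then have "1 - r \<le> norm (z - \<zeta> n)"
        using norm_triangle_ineq2[of "\<zeta> n" z] norm_zeta[of n] by (simp add: norm_minus_commute)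
      then show "norm (tooth_fun n z) \<le> eta n" using elim z assms norm_a_le_2 by (intro tooth_fun_away) auto
    qed
  qed
  then have "uniform_limit (cball 0 r) (\<lambda>n z. \<Sum>k<n. tooth_fun k z) (\<lambda>z. \<Sum>k. tooth_fun k z) sequentially"
    using summable_eta by (rule Weierstrass_m_test_ev)
  then show ?thesis unfolding F_def[abs_def] f_def[abs_def] by (intro uniform_limit_intros)
qed

lemma F_uniform_compact:
  assumes "compact K" "K \<subseteq> ball 0 1"
  shows "uniform_limit K (\<lambda>n. F {..<n}) f sequentially"
proof -
  have "\<exists>r<1. K \<subseteq> cball 0 r"
  proof (cases "K = {}")
    case False
    obtain x where x: "x \<in> K" "\<forall>y\<in>K. norm y \<le> norm x"
      using continuous_attains_sup[OF assms(1) False continuous_on_norm_id] by blast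
    then show ?thesis using assms(2) by (intro exI[of _ "norm x"]) auto
  qed (auto intro: exI[of _ 0])
  then show ?thesis using F_uniform uniform_limit_on_subset by blast
qed

lemma f_holomorphic: "f holomorphic_on ball 0 1"
proof (rule holomorphic_uniform_sequence[OF open_ball F_holomorphic])
  fix x :: complex assume "x \<in> ball 0 1"
  then obtain d where d: "0 < d" "cball x d \<subseteq> ball 0 1"
    using open_contains_cball open_ball by blast
  then show "\<exists>d>0. cball x d \<subseteq> ball 0 1 \<and> uniform_limit (cball x d) (\<lambda>n. F {..<n}) f sequentially"
    using F_uniform_compact[of "cball x d"] by auto
qed

lemma away_interior: "norm z \<le> 1/2 \<Longrightarrow> away k z"
  using norm_triangle_ineq2[of "\<zeta> k" z] norm_zeta[of k] gam_le[of k] by (simp add: norm_minus_commute)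

lemma f_nonconstant: "\<not> f constant_on ball 0 1"
proof
  assume "f constant_on ball 0 1"
  then have eq: "f (1/2) = f 0" unfolding constant_on_def by (metis centre_in_ball dist_0_norm mem_ball norm_divide norm_numeral norm_one zero_less_one one_less_numeral_iff semiring_norm(76) divide_less_eq_1_pos zero_less_numeral)
  have "1/4 \<le> norm (F {..<n} (1/2) - F {..<n} 0)" for n
  proof -
    have "norm (dd {..<n} (1/2) 0 - 1) \<le> 1/100" by (intro dd_near_1 away_interior) auto
    then have "1/2 \<le> norm (dd {..<n} (1/2) 0)"
      using norm_triangle_ineq3[of "dd {..<n} (1/2) 0" 1] by simp
    moreover have "norm (F {..<n} (1/2) - F {..<n} 0) = norm ((1/2 - 0) * dd {..<n} (1/2) 0)"
      by (subst F_diff) auto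
    ultimately show ?thesis unfolding norm_mult by simp
  qed
  moreover have "(\<lambda>n. norm (F {..<n} (1/2) - F {..<n} 0)) \<longlonglongrightarrow> norm (f (1/2) - f 0)"
    by (intro tendsto_intros F_tendsto) auto
  ultimately have "1/4 \<le> norm (f (1/2) - f 0)"
    by (intro LIMSEQ_le_const) auto
  then show False using eq by simp
qed

lemma f_inj: "inj_on f (ball 0 1)"
proof (rule Hurwitz_injective[where \<F> = "\<lambda>n. F {..<n}", OF open_ball connected_ball])
  show "inj_on (F {..<n}) (ball 0 1)" for n using F_inj by (rule inj_on_subset) auto
qed (use F_holomorphic f_holomorphic F_uniform_compact f_nonconstant in auto)

lemma norm_tooth_fun_le_2: "norm z \<le> 1 \<Longrightarrow> norm (tooth_fun k z) \<le> 2"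
proof -
  assume z: "norm z \<le> 1"
  have "norm (\<zeta> k * a k * of_real (height k z)) \<le> 101/100 * 1"
    unfolding norm_mult norm_zeta mult_1_left norm_of_real using height[OF z, of k] norm_a_le by (intro mult_mono) auto
  then show ?thesis using tooth_fun_height[OF z, of k] norm_triangle_sub[of "tooth_fun k z" "\<zeta> k * a k * of_real (height k z)"] g_le1[of k]
    by simp
qed

lemma norm_F_le:
  assumes z: "norm z \<le> 1" shows "norm (F {..<n} z) \<le> 4"
proof -
  have *: "norm (\<Sum>k\<in>J. tooth_fun k z) \<le> 1/100" if "finite J" "\<And>k. k \<in> J \<Longrightarrow> away k z" for J
  proof -
    have "norm (\<Sum>k\<in>J. tooth_fun k z) \<le> sum eta J" using that z norm_a_le_2 by (intro sum_norm_le tooth_fun_away) auto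
    then show ?thesis using sum_eta_le'[OF that(1)] by linarith
  qed
  show ?thesis
  proof (cases "\<exists>k<n. \<not> away k z")
    case False
    then have "norm (\<Sum>k<n. tooth_fun k z) \<le> 1/100" by (intro *) auto
    then show ?thesis using z norm_triangle_ineq[of z "\<Sum>k<n. tooth_fun k z"] by (simp add: F_def)
  next
    case True
    then obtain k where k: "k < n" "\<not> away k z" by blast
    have "norm (\<Sum>j\<in>{..<n}-{k}. tooth_fun j z) \<le> 1/100" using k near_away[of z k] by (intro *) auto
    moreover have "F {..<n} z = z + (\<Sum>j\<in>{..<n}-{k}. tooth_fun j z) + tooth_fun k z"
      using F_remove[of "{..<n}" k z] k by (simp add: F_def)
    ultimately show ?thesis using z norm_tooth_fun_le_2[OF z, of k] norm_triangle_ineq[of z "\<Sum>j\<in>{..<n}-{k}. tooth_fun j z"]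
       norm_triangle_ineq[of "z + (\<Sum>j\<in>{..<n}-{k}. tooth_fun j z)" "tooth_fun k z"] by simp
  qed
qed

lemma norm_f_le: "norm z \<le> 1 \<Longrightarrow> norm (f z) \<le> 4"
  using tendsto_norm[OF F_tendsto[of z]] norm_F_le by (intro LIMSEQ_le_const2) auto

lemma f_lipschitz_limit:
  assumes "norm z \<le> 1" "norm w \<le> 1" "\<And>n. norm (dd {..<n} z w) \<le> L"
  shows "norm (f z - f w) \<le> L * norm (z - w)"
proof (rule LIMSEQ_le_const2)
  show "(\<lambda>n. norm (F {..<n} z - F {..<n} w)) \<longlonglongrightarrow> norm (f z - f w)"
    using assms by (intro tendsto_intros F_tendsto) auto
  have "norm (F {..<n} z - F {..<n} w) \<le> L * norm (z - w)" for n
    using F_diff[OF assms(1,2), of "{..<n}"] mult_right_mono[OF assms(3)[of n], of "norm (z - w)"]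
    by (simp add: norm_mult mult.commute)
  then show "\<exists>N. \<forall>n\<ge>N. norm (F {..<n} z - F {..<n} w) \<le> L * norm (z - w)" by blast
qed

lemma f_lipschitz_away:
  assumes "norm z \<le> 1" "norm w \<le> 1" "\<And>k. away k z" "\<And>k. away k w"
  shows "norm (f z - f w) \<le> 2 * norm (z - w)"
proof (rule f_lipschitz_limit[OF assms(1,2)])
  fix n
  have "norm (dd {..<n} z w - 1) \<le> 1/100" using assms by (intro dd_near_1) auto
  then show "norm (dd {..<n} z w) \<le> 2" using norm_triangle_sub[of "dd {..<n} z w" 1] by simp
qed

lemma f_lipschitz_near:
  assumes "norm z \<le> 1" "norm w \<le> 1" "norm (z - \<zeta> k) \<le> gam k" "norm (w - \<zeta> k) \<le> gam k"
  shows "norm (f z - f w) \<le> (2 + 2 * (\<Sum>i<N k. 2^i / e k)) * norm (z - w)"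
proof (rule f_lipschitz_limit[OF assms(1,2)])
  fix n
  have S: "0 \<le> (\<Sum>i<N k. 2^i / e k)" using e_pos[of k] by (intro sum_nonneg) auto
  have "norm (dd ({..<n} - {k}) z w - 1) \<le> 1/100" using assms near_away[of _ k] by (intro dd_near_1) auto
  then have 1: "norm (dd ({..<n} - {k}) z w) \<le> 2" using norm_triangle_sub[of "dd ({..<n} - {k}) z w" 1] by simp
  have "norm (tooth_dd (N k) (e k) (hp_coord (\<zeta> k) z) (hp_coord (\<zeta> k) w)) \<le> (\<Sum>i<N k. 2^i / e k)"
    using assms norm_zeta e_pos by (intro norm_tooth_dd_crude Re_hp_coord_nonneg) auto
  then have "norm (tooth_fun_dd k z w) \<le> 2 * (\<Sum>i<N k. 2^i / e k)"
    unfolding tooth_fun_dd_def norm_mult using norm_a_le_2 by (intro mult_mono) auto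
  then show "norm (dd {..<n} z w) \<le> 2 + 2 * (\<Sum>i<N k. 2^i / e k)"
    using 1 S norm_triangle_ineq[of "dd ({..<n} - {k}) z w" "tooth_fun_dd k z w"] dd_remove[of "{..<n}" k z w]
    by (cases "k < n") auto
qed

text \<open>
The derivative of \<open>f\<close> at a boundary point in the sense of divided differences.
\<close>

definition slope :: "complex \<Rightarrow> complex" where "slope \<xi> = 1 + (\<Sum>k. tooth_fun_dd k \<xi> \<xi>)"

definition P :: "complex \<Rightarrow> real \<Rightarrow> complex" where "P \<xi> t = f \<xi> + of_real t * \<xi> * slope \<xi>"

abbreviation PN :: "nat \<Rightarrow> complex \<Rightarrow> real \<Rightarrow> complex" where
  "PN n \<xi> t \<equiv> F {..<n} \<xi> + of_real t * \<xi> * dd {..<n} \<xi> \<xi>"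

definition allfree :: "complex \<Rightarrow> bool" where "allfree \<xi> \<longleftrightarrow> (\<forall>n. free n \<xi>)"

lemma allfree_norm: "allfree \<xi> \<Longrightarrow> norm \<xi> = 1"
  by (auto simp: allfree_def free_def)

lemma allfree_away: "allfree \<xi> \<Longrightarrow> away k \<xi>"
  using free_away[of "Suc k" \<xi> k] by (auto simp: allfree_def)

lemma P_tendsto:
  assumes "allfree \<xi>" shows "(\<lambda>n. PN n \<xi> t) \<longlonglongrightarrow> P \<xi> t"
proof -
  have n: "norm \<xi> \<le> 1" using allfree_norm[OF assms] by simp
  have "summable (\<lambda>k. tooth_fun_dd k \<xi> \<xi>)"
    by (rule summable_comparison_test_ev[OF _ summable_eta])
      (use n norm_a_le_2 tooth_fun_dd_away allfree_away[OF assms] in \<open>auto intro!: always_eventually\<close>)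
  then have "(\<lambda>n. dd {..<n} \<xi> \<xi>) \<longlonglongrightarrow> slope \<xi>" unfolding dd_def slope_def by (intro tendsto_intros summable_LIMSEQ)
  then show ?thesis unfolding P_def by (intro tendsto_intros F_tendsto n)
qed

lemma P_separation:
  assumes z: "norm z \<le> 1" "norm (z - \<zeta> k) \<le> gam k" and \<xi>: "allfree \<xi>" and t: "0 \<le> t" "t \<le> 1"
  shows "norm (\<xi> - \<zeta> k) / 2 \<le> norm (f z - P \<xi> t)"
proof (rule LIMSEQ_le_const)
  show "(\<lambda>n. norm (F {..<n} z - PN n \<xi> t)) \<longlonglongrightarrow> norm (f z - P \<xi> t)"
    using z \<xi> by (intro tendsto_intros F_tendsto P_tendsto) auto
  have "norm (\<xi> - \<zeta> k) / 2 \<le> norm (F {..<n} z - PN n \<xi> t)" if "Suc k \<le> n" for n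
    using tooth_separation[OF z _ _ t, of n \<xi>] \<xi> that by (simp add: allfree_def algebra_simps)
  then show "\<exists>N. \<forall>n\<ge>N. norm (\<xi> - \<zeta> k) / 2 \<le> norm (F {..<n} z - PN n \<xi> t)" by blast
qed

lemma P_proximity:
  assumes z: "norm z \<le> 1" "norm (z - \<zeta> k) \<le> gam k" and \<xi>: "allfree \<xi>"
  shows "norm (f z - P \<xi> (height k z)) \<le> 3 * norm (\<xi> - \<zeta> k)"
proof (rule LIMSEQ_le_const2)
  show "(\<lambda>n. norm (F {..<n} z - PN n \<xi> (height k z))) \<longlonglongrightarrow> norm (f z - P \<xi> (height k z))"
    using z \<xi> by (intro tendsto_intros F_tendsto P_tendsto) auto
  have "norm (F {..<n} z - PN n \<xi> (height k z)) \<le> 3 * norm (\<xi> - \<zeta> k)" if "Suc k \<le> n" for n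
    using tooth_proximity[OF z, of n \<xi>] \<xi> that by (simp add: allfree_def algebra_simps)
  then show "\<exists>N. \<forall>n\<ge>N. norm (F {..<n} z - PN n \<xi> (height k z)) \<le> 3 * norm (\<xi> - \<zeta> k)" by blast
qed

text \<open>
The normal at a boundary point leads out of the image. Away from the teeth the map is so close to
the identity that the strict convexity of the disc decides, which explains the quadratic bound.
\<close>

lemma P_separation_away:
  assumes z: "norm z \<le> 1" "\<And>k. away k z" and \<xi>: "allfree \<xi>" and t: "0 \<le> t"
  shows "(norm (z - \<xi>))\<^sup>2 / 4 \<le> norm (f z - P \<xi> t)"
proof (rule LIMSEQ_le_const)
  show "(\<lambda>n. norm (F {..<n} z - PN n \<xi> t)) \<longlonglongrightarrow> norm (f z - P \<xi> t)"
    using z \<xi> by (intro tendsto_intros F_tendsto P_tendsto) auto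
  have "(norm (z - \<xi>))\<^sup>2 / 4 \<le> norm (F {..<n} z - PN n \<xi> t)" for n
  proof -
    have n\<xi>: "norm \<xi> = 1" using allfree_norm[OF \<xi>] .
    define A where "A = dd {..<n} \<xi> \<xi>"
    define u where "u = hp_coord \<xi> z"
    have nu: "norm u = norm (z - \<xi>)" using norm_hp_coord n\<xi> by (simp add: u_def)
    have A: "norm (A - 1) \<le> 1/100" unfolding A_def using n\<xi> allfree_away[OF \<xi>] by (intro dd_near_1) auto
    then have A': "99/100 \<le> norm A" using norm_triangle_sub[of 1 A] by (simp add: norm_minus_commute)
    define q where "q = dd {..<n} z \<xi> / A"
    have A0: "A \<noteq> 0" using A' by auto
    have "norm (dd {..<n} z \<xi> - A) \<le> 1/100 * (norm (z - \<xi>) + norm (\<xi> - \<xi>))"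
      unfolding A_def using z n\<xi> allfree_away[OF \<xi>] by (intro dd_lip) auto
    then have "norm (dd {..<n} z \<xi> - A) / norm A \<le> 1/100 * (norm (z - \<xi>) + norm (\<xi> - \<xi>)) / (99/100)"
      using A' by (intro frac_le) auto
    also have "\<dots> \<le> 1/50 * norm u" by (simp add: nu)
    finally have "norm (dd {..<n} z \<xi> - A) / norm A \<le> 1/50 * norm u" .
    moreover have "q - 1 = (dd {..<n} z \<xi> - A) / A" using A0 by (simp add: q_def diff_divide_distrib)
    ultimately have q: "norm (q - 1) \<le> 1/50 * norm u" by (simp add: norm_divide)
    have "norm (u * (q - 1)) \<le> 1/50 * (norm u)\<^sup>2"
      unfolding norm_mult using mult_left_mono[OF q, of "norm u"] by (simp add: power2_eq_square)
    have Re_uq: "Re (u * q + of_real t) = Re u + Re (u * (q - 1)) + t" by (simp add: algebra_simps)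
    have "Re (u * (q - 1)) \<ge> - (1/50 * (norm u)\<^sup>2)" using \<open>norm (u * (q - 1)) \<le> _\<close> abs_Re_le_cmod[of "u * (q - 1)"] by linarith
    moreover have "(norm u)\<^sup>2 \<le> 2 * Re u" unfolding u_def using hp_coord_disc n\<xi> z by blast
    ultimately have "1/3 * (norm u)\<^sup>2 \<le> Re (u * q + of_real t)" using t zero_le_power2[of "norm u"]
      unfolding Re_uq by linarith
    also have "\<dots> \<le> norm (u * q + of_real t)" by (rule complex_Re_le_cmod)
    finally have "99/100 * (1/3 * (norm u)\<^sup>2) \<le> norm A * norm (u * q + of_real t)"
      using A' by (intro mult_mono) auto
    also have "norm A * norm (u * q + of_real t) = norm (- \<xi> * (A * (u * q + of_real t)))"
      by (simp add: norm_mult n\<xi>)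
    also have "- \<xi> * (A * (u * q + of_real t)) = F {..<n} z - PN n \<xi> t"
    proof -
      have "\<xi> * cnj \<xi> = 1" using n\<xi> by (metis complex_norm_square of_real_1 one_power2)
      then have "- \<xi> * u = z - \<xi>" by (simp add: u_def hp_coord_def algebra_simps)
      moreover have "A * q = dd {..<n} z \<xi>" using A0 by (simp add: q_def)
      moreover have "- \<xi> * (A * (u * q + of_real t)) = (- \<xi> * u) * (A * q) - of_real t * \<xi> * A" by (simp add: algebra_simps)
      moreover have "F {..<n} z - F {..<n} \<xi> = (z - \<xi>) * dd {..<n} z \<xi>" using z n\<xi> by (intro F_diff) auto
      ultimately show ?thesis by (simp only: A_def[symmetric] diff_diff_eq[symmetric])
    qed
    finally show ?thesis using zero_le_power2[of "norm u"] unfolding nu by linarith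
  qed
  then show "\<exists>N. \<forall>n\<ge>N. (norm (z - \<xi>))\<^sup>2 / 4 \<le> norm (F {..<n} z - PN n \<xi> t)" by blast
qed

text \<open>
Up to small relative errors \<open>P\<close> is the map \<open>(\<xi>, t) \<mapsto> (1 + t) * \<xi>\<close>, which is bi-Lipschitz by
\<open>radial_distance\<close>.
\<close>

lemma P_bilipschitz:
  assumes \<xi>: "allfree \<xi>" "allfree \<xi>'" and t: "0 \<le> t" "t \<le> 1" "0 \<le> t'" "t' \<le> 1"
  shows "norm (\<xi> - \<xi>') / 2 \<le> norm (P \<xi> t - P \<xi>' t')" "\<bar>t - t'\<bar> / 2 \<le> norm (P \<xi> t - P \<xi>' t')"
    "norm (P \<xi> t - P \<xi>' t') \<le> 3 * (norm (\<xi> - \<xi>') + \<bar>t - t'\<bar>)"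
proof -
  define d s where "d = norm (\<xi> - \<xi>')" and "s = \<bar>t - t'\<bar>"
  have s0: "0 \<le> s" by (simp add: s_def)
  note n = allfree_norm[OF \<xi>(1)] allfree_norm[OF \<xi>(2)] and aw = allfree_away[OF \<xi>(1)] allfree_away[OF \<xi>(2)]
  have d: "0 \<le> d" "d \<le> 2" using norm_triangle_ineq4[of \<xi> \<xi>'] n by (auto simp: d_def)
  define V where "V = of_real (1 + t) * \<xi> - of_real (1 + t') * \<xi>'"
  have V1: "d \<le> norm V" unfolding d_def V_def using n t by (intro radial_distance) auto
  have V2: "s \<le> norm V"
    using norm_triangle_ineq3[of "of_real (1 + t) * \<xi>" "of_real (1 + t') * \<xi>'"] n t
    by (simp add: V_def s_def norm_mult norm_of_real del: of_real_add)
  have "V = of_real (1 + t) * (\<xi> - \<xi>') + of_real (t - t') * \<xi>'" by (simp add: V_def algebra_simps)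
  then have "norm V \<le> norm (of_real (1 + t) * (\<xi> - \<xi>')) + norm (of_real (t - t') * \<xi>')" by (simp only: norm_triangle_ineq)
  also have "\<dots> = (1 + t) * d + s" using n t by (simp add: norm_mult norm_of_real d_def s_def del: of_real_add of_real_diff)
  also have "\<dots> \<le> 2 * d + s" using t d by (intro add_mono mult_right_mono) auto
  finally have V3: "norm V \<le> 2 * d + s" .
  have est: "norm (PN n \<xi> t - PN n \<xi>' t') \<le> 3 * (d + s) \<and> 9/10 * norm V \<le> norm (PN n \<xi> t - PN n \<xi>' t')" for n
  proof -
    define A A' B where "A = dd {..<n} \<xi> \<xi>" and "A' = dd {..<n} \<xi>' \<xi>'" and "B = dd {..<n} \<xi> \<xi>'"
    have A: "norm (A - 1) \<le> 1/100" unfolding A_def using n aw by (intro dd_near_1) auto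
    then have A2: "norm A \<le> 101/100" "99/100 \<le> norm A"
      using norm_triangle_sub[of A 1] norm_triangle_sub[of 1 A] by (auto simp: norm_minus_commute)
    have "norm (B - A) \<le> 1/100 * (norm (\<xi> - \<xi>) + norm (\<xi>' - \<xi>))"
      unfolding A_def B_def using n aw by (intro dd_lip) auto
    then have BA: "norm (B - A) \<le> 1/100 * d" by (simp add: d_def norm_minus_commute)
    have "norm (A - A') \<le> 1/100 * (norm (\<xi> - \<xi>') + norm (\<xi> - \<xi>'))"
      unfolding A_def A'_def using n aw by (intro dd_lip) auto
    then have AA: "norm (A - A') \<le> 2/100 * d" by (simp add: d_def)
    define E where "E = (\<xi> - \<xi>') * (B - A) + of_real t' * \<xi>' * (A - A')"
    have "norm ((\<xi> - \<xi>') * (B - A)) \<le> 2 * (1/100 * d)"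
      unfolding norm_mult d_def[symmetric] using BA d by (intro mult_mono) auto
    moreover have "norm (of_real t' * \<xi>' * (A - A')) \<le> 1 * (2/100 * d)"
      unfolding norm_mult n using AA d t by (intro mult_mono) auto
    ultimately have E: "norm E \<le> 4/100 * d"
      using norm_triangle_ineq[of "(\<xi> - \<xi>') * (B - A)" "of_real t' * \<xi>' * (A - A')"] by (simp add: E_def)
    have "F {..<n} \<xi> - F {..<n} \<xi>' = (\<xi> - \<xi>') * B" unfolding B_def using n by (intro F_diff) auto
    then have "PN n \<xi> t - PN n \<xi>' t' = (\<xi> - \<xi>') * B + of_real t * \<xi> * A - of_real t' * \<xi>' * A'"
      by (simp add: A_def A'_def)
    also have "\<dots> = A * V + E" by (simp add: V_def E_def algebra_simps)
    finally have eq: "PN n \<xi> t - PN n \<xi>' t' = A * V + E" .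
    have "norm (A * V) \<le> 101/100 * norm V" "99/100 * norm V \<le> norm (A * V)"
      unfolding norm_mult using A2 by (intro mult_right_mono; simp)+
    then show ?thesis
      unfolding eq using E V1 V3 norm_triangle_ineq[of "A * V" E] norm_triangle_ineq2[of "A * V" "- E"] d s0
      by auto
  qed
  have lim: "(\<lambda>n. norm (PN n \<xi> t - PN n \<xi>' t')) \<longlonglongrightarrow> norm (P \<xi> t - P \<xi>' t')"
    using \<xi> by (intro tendsto_intros P_tendsto)
  have "9/10 * norm V \<le> norm (P \<xi> t - P \<xi>' t')" using est by (intro LIMSEQ_le_const[OF lim]) auto
  then show "norm (\<xi> - \<xi>') / 2 \<le> norm (P \<xi> t - P \<xi>' t')" "\<bar>t - t'\<bar> / 2 \<le> norm (P \<xi> t - P \<xi>' t')"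
    using V1 V2 d s0 unfolding d_def[symmetric] s_def[symmetric] by linarith+
  show "norm (P \<xi> t - P \<xi>' t') \<le> 3 * (norm (\<xi> - \<xi>') + \<bar>t - t'\<bar>)"
    using est unfolding d_def s_def by (intro LIMSEQ_le_const2[OF lim]) auto
qed

end

section \<open>The boundary of the comb domain\<close>

text \<open>
The set \<open>C\<close> consists exactly of the points of accumulation of the centres.
\<close>

locale comb_limit = comb +
  fixes C :: "complex set"
  assumes C_compact: "compact C"
    and C_free: "\<And>\<xi> k. \<xi> \<in> C \<Longrightarrow> norm \<xi> = 1 \<and> g k \<le> norm (\<xi> - \<zeta> k)"
    and C_near: "\<And>k. \<exists>\<xi>\<in>C. norm (\<xi> - \<zeta> k) \<le> 2 * g k"
    and C_acc: "\<And>\<xi> \<delta> m. \<xi> \<in> C \<Longrightarrow> 0 < \<delta> \<Longrightarrow> \<exists>k\<ge>m. norm (\<xi> - \<zeta> k) < \<delta>"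
begin

lemma C_allfree: "\<xi> \<in> C \<Longrightarrow> allfree \<xi>"
  using C_free by (auto simp: allfree_def free_def)

definition K :: "complex set" where "K = (\<lambda>(\<xi>, t). P \<xi> t) ` (C \<times> {0..1})"

definition G :: "complex set" where "G = f ` ball 0 1"

lemma K_compact: "compact K"
  unfolding K_def
proof (rule compact_continuous_image[OF _ compact_Times[OF C_compact compact_Icc]])
  have "dist (P \<xi> t) (P \<xi>' t') \<le> 6 * dist (\<xi>, t) (\<xi>', t')" if "\<xi> \<in> C" "\<xi>' \<in> C" "t \<in> {0..1}" "t' \<in> {0..1}" for \<xi> \<xi>' t t'
  proof -
    have "dist (P \<xi> t) (P \<xi>' t') \<le> 3 * (dist \<xi> \<xi>' + dist t t')"
      using P_bilipschitz(3)[of \<xi> \<xi>' t t'] C_allfree that by (simp add: dist_norm)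
    moreover have "dist \<xi> \<xi>' \<le> dist (\<xi>, t) (\<xi>', t')" "dist t t' \<le> dist (\<xi>, t) (\<xi>', t')"
      by (metis dist_fst_le fst_conv, metis dist_snd_le snd_conv)
    ultimately show ?thesis by simp
  qed
  then have "6-lipschitz_on (C \<times> {0..1}) (\<lambda>(\<xi>, t). P \<xi> t)"
    by (intro lipschitz_onI) auto
  then show "continuous_on (C \<times> {0..1}) (\<lambda>(\<xi>, t). P \<xi> t)"
    by (rule lipschitz_on_continuous_on)
qed

lemma G_open: "open G" and G_connected: "connected G" and G_bounded: "bounded G"
  and G_simply_connected: "simply_connected G"
proof -
  show "open G" unfolding G_def using f_holomorphic f_inj by (intro open_mapping_thm3) auto
  have cont: "continuous_on (ball 0 1) f" using f_holomorphic by (rule holomorphic_on_imp_continuous_on)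
  then show "connected G" unfolding G_def by (intro connected_continuous_image) auto
  show "bounded G" unfolding G_def bounded_iff using norm_f_le by (intro exI[of _ 4]) auto
  obtain h where "homeomorphism (ball 0 1) G f h"
  proof (rule invariance_of_domain_homeomorphism[of "ball 0 1" f])
    show "thesis" if "homeomorphism (ball 0 1) (f ` ball 0 1) f h" for h
      using that \<open>\<And>h. homeomorphism (ball 0 1) G f h \<Longrightarrow> thesis\<close> by (simp add: G_def)
  qed (use cont f_inj in auto)
  then have "G homeomorphic ball (0::complex) 1" using homeomorphic_def homeomorphic_sym by blast
  then show "simply_connected G"
    using homeomorphic_simply_connected_eq convex_imp_simply_connected[OF convex_ball] by blast
qed

lemma K_disjoint_G: "K \<inter> G = {}"
proof -
  have False if z: "z \<in> ball 0 1" and \<xi>: "\<xi> \<in> C" and t: "t \<in> {0..1}" and eq: "P \<xi> t = f z" for z \<xi> t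
  proof -
    have nz: "norm z \<le> 1" using z by simp
    show False
    proof (cases "\<exists>k. norm (z - \<zeta> k) \<le> gam k")
      case True
      then obtain k where "norm (z - \<zeta> k) \<le> gam k" by blast
      then have "norm (\<xi> - \<zeta> k) / 2 \<le> norm (f z - P \<xi> t)" using nz C_allfree[OF \<xi>] t by (intro P_separation) auto
      then show False using C_free[OF \<xi>, of k] g_pos[of k] eq by simp
    next
      case False
      then have "(norm (z - \<xi>))\<^sup>2 / 4 \<le> norm (f z - P \<xi> t)" using nz C_allfree[OF \<xi>] t by (intro P_separation_away) (auto simp: not_le less_imp_le)
      then have "z = \<xi>" using eq by (simp add: power2_eq_square mult_le_0_iff)
      then show False using z C_free[OF \<xi>, of 0] by simp
    qed
  qed
  note no = this
  show ?thesis
  proof (rule equals0I)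
    fix p assume "p \<in> K \<inter> G"
    then have "p \<in> K" "p \<in> G" by auto
    then obtain \<xi> t where "p = P \<xi> t" "\<xi> \<in> C" "t \<in> {0..1}" unfolding K_def by auto
    moreover obtain z where "z \<in> ball 0 1" "p = f z" using \<open>p \<in> G\<close> unfolding G_def by auto
    ultimately show False using no[of z \<xi> t] by simp
  qed
qed

text \<open>
On the radius that ends at \<open>\<zeta> k\<close> the height is a continuous real function that decreases from 1 at
the circle to less than \<open>eta k\<close> at distance \<open>gam k\<close>.
\<close>

lemma tooth_reaches_height:
  assumes "eta k < t" "t < 1"
  obtains z where "z \<in> ball 0 1" "norm (z - \<zeta> k) \<le> gam k" "height k z = t"
proof -
  define Z where "Z = (\<lambda>s. (1 - of_real s) * \<zeta> k)"
  have sfacZ: "hp_coord (\<zeta> k) (Z s) = of_real s" for s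
  proof -
    have "cnj (\<zeta> k) * \<zeta> k = 1" using norm_zeta[of k] by (metis complex_norm_square mult.commute of_real_1 one_power2)
    moreover have "hp_coord (\<zeta> k) (Z s) = 1 - (1 - of_real s) * (cnj (\<zeta> k) * \<zeta> k)" by (simp add: hp_coord_def Z_def)
    ultimately show ?thesis by simp
  qed
  have nZ: "norm (Z s) \<le> 1" if "0 \<le> s" "s \<le> gam k" for s
  proof -
    have "norm (1 - complex_of_real s) = \<bar>1 - s\<bar>" by (metis norm_of_real of_real_1 of_real_diff)
    then show ?thesis using that gam_le[of k] norm_zeta by (simp add: Z_def norm_mult)
  qed
  have Zk: "Z s - \<zeta> k = - of_real s * \<zeta> k" for s by (simp add: Z_def algebra_simps)
  have "continuous_on {0..gam k} (\<lambda>s. height k (Z s))"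
  proof -
    have "continuous_on {0..gam k} (\<lambda>s. tooth_fun k (Z s))"
    proof (rule continuous_on_compose2[OF tooth_fun_continuous])
      show "continuous_on {0..gam k} Z" unfolding Z_def by (intro continuous_intros)
    qed (use nZ in auto)
    moreover have "height k (Z s) = Re (tooth_fun k (Z s) / (\<zeta> k * a k))" for s
    proof -
      have "\<zeta> k * a k \<noteq> 0" using norm_zeta[of k] norm_a_ge[of k] by auto
      then show ?thesis by (simp add: height_def tooth_fun_def)
    qed
    ultimately show ?thesis using norm_zeta[of k] norm_a_ge[of k] by (auto intro!: continuous_intros)
  qed
  moreover have "height k (Z 0) = 1"
  proof -
    have "0 < N k" using N_ge[of k] g_pos[of k] by (smt (verit) zero_less_divide_iff of_nat_0_less_iff)
    then show ?thesis using e_pos[of k] by (simp add: height_def sfacZ tooth_0)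
  qed
  moreover have "height k (Z (gam k)) < t"
  proof -
    have "norm (complex_of_real (gam k)) * norm (tooth (N k) (e k) (of_real (gam k))) \<le> 2 * e k"
      using gam_pos[of k] e_pos[of k] by (intro norm_tooth_le) auto
    then have "norm (tooth (N k) (e k) (of_real (gam k))) \<le> 2 * e k / gam k" using gam_pos[of k] by (simp add: field_simps)
    also have "\<dots> \<le> 4 * e k / gam k" using gam_pos[of k] e_pos[of k] by (intro divide_right_mono) auto
    also have "\<dots> \<le> eta k" by (rule e_bounds)
    finally show ?thesis using assms complex_Re_le_cmod[of "tooth (N k) (e k) (of_real (gam k))"] by (simp add: height_def sfacZ)
  qed
  ultimately obtain s where s: "0 \<le> s" "s \<le> gam k" "height k (Z s) = t"
    using IVT2'[of "\<lambda>s. height k (Z s)" "gam k" t 0] assms gam_pos[of k] by auto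
  have "s \<noteq> 0" using s assms \<open>height k (Z 0) = 1\<close> by auto
  then have "\<bar>1 - s\<bar> < 1" using s gam_le[of k] by auto
  moreover have "norm (1 - complex_of_real s) = \<bar>1 - s\<bar>" by (metis norm_of_real of_real_1 of_real_diff)
  ultimately have "Z s \<in> ball 0 1" using norm_zeta by (simp add: Z_def norm_mult)
  moreover have "norm (Z s - \<zeta> k) \<le> gam k" using s norm_zeta by (simp add: Zk norm_mult)
  ultimately show ?thesis using that s by blast
qed

lemma K_subset_closure_G: "K \<subseteq> closure G"
proof
  fix p assume "p \<in> K"
  then obtain \<xi> t where \<xi>: "\<xi> \<in> C" and t: "0 \<le> t" "t \<le> 1" and p: "p = P \<xi> t" by (auto simp: K_def)
  show "p \<in> closure G" unfolding closure_approachable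
  proof (intro allI impI)
    fix \<delta> :: real assume \<delta>: "0 < \<delta>"
    define \<delta>' where "\<delta>' = min \<delta> 1 / 8"
    have \<delta>': "0 < \<delta>'" "\<delta>' \<le> 1/8" "8 * \<delta>' \<le> \<delta>" using \<delta> by (auto simp: \<delta>'_def)
    define t' where "t' = max \<delta>' (min t (1 - \<delta>'))"
    have t': "\<delta>' \<le> t'" "t' < 1" "\<bar>t' - t\<bar> \<le> \<delta>'" using \<delta>' t by (auto simp: t'_def)
    have "\<forall>\<^sub>F k in sequentially. g k < \<delta>'" using g_to_0 \<delta>' by (intro order_tendstoD) auto
    then obtain m where m: "\<And>k. k \<ge> m \<Longrightarrow> g k < \<delta>'" unfolding eventually_sequentially by blast
    obtain k where k: "k \<ge> m" "norm (\<xi> - \<zeta> k) < \<delta>'" using C_acc[OF \<xi> \<delta>'(1)] by blast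
    have "g k / 2^k \<le> g k" using g_pos[of k] by (simp add: divide_simps mult_le_cancel_left1)
    then have "eta k < t'" using m[OF k(1)] t' \<delta>' by (simp add: eta_def)
    then obtain z where z: "z \<in> ball 0 1" "norm (z - \<zeta> k) \<le> gam k" "height k z = t'"
      using t' tooth_reaches_height by blast
    have "norm (f z - P \<xi> t') \<le> 3 * norm (\<xi> - \<zeta> k)"
      using P_proximity[of z k \<xi>] z C_allfree[OF \<xi>] by simp
    moreover have "norm (P \<xi> t' - P \<xi> t) \<le> 3 * (norm (\<xi> - \<xi>) + \<bar>t' - t\<bar>)"
      using C_allfree[OF \<xi>] t t' \<delta>' by (intro P_bilipschitz) auto
    ultimately have "dist (f z) p \<le> 3 * \<delta>' + 3 * \<delta>'"
      using k t' norm_triangle_ineq[of "f z - P \<xi> t'" "P \<xi> t' - P \<xi> t"] by (simp add: p dist_norm)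
    then show "\<exists>y\<in>G. dist y p < \<delta>" using z \<delta>' by (auto simp: G_def intro!: bexI[of _ z])
  qed
qed

lemma K_subset_frontier: "K \<subseteq> frontier G"
  using K_subset_closure_G K_disjoint_G interior_subset[of G] by (auto simp: frontier_def)

text \<open>
The index 0 stands for the part of the circle away from all teeth and \<open>Suc k\<close> for the base of
tooth \<open>k\<close>. The map \<open>f\<close> is Lipschitz on each of these parts, but it need not be continuous on the
whole circle.
\<close>

definition arc :: "nat \<Rightarrow> complex set" where
  "arc n = (if n = 0 then {z. norm z = 1 \<and> (\<forall>k. away k z)} else {z. norm z = 1 \<and> norm (z - \<zeta> (n - 1)) \<le> gam (n - 1)})"

lemma f_lipschitz_arc: "\<exists>L\<ge>0. L-lipschitz_on (arc n) f"
proof (cases n)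
  case 0
  have "2-lipschitz_on (arc n) f"
    using f_lipschitz_away by (intro lipschitz_onI) (auto simp: arc_def 0 dist_norm)
  then show ?thesis by (intro exI[of _ 2]) auto
next
  case (Suc k)
  have S: "0 \<le> (\<Sum>i<N k. 2^i / e k)" using e_pos[of k] by (intro sum_nonneg) auto
  have "(2 + 2 * (\<Sum>i<N k. 2^i / e k))-lipschitz_on (arc n) f"
    using f_lipschitz_near S by (intro lipschitz_onI) (auto simp: arc_def Suc dist_norm)
  then show ?thesis using S by (intro exI[of _ "2 + 2 * (\<Sum>i<N k. 2^i / e k)"]) auto
qed

lemma boundary_value_of_sequence:
  assumes z: "\<And>j::nat. norm (z j) \<le> 1 \<and> z j \<in> A" and lim: "z \<longlonglongrightarrow> \<omega>" and A: "closed A"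
    and fz: "(\<lambda>j. f (z j)) \<longlonglongrightarrow> w" and L: "\<And>x y. \<lbrakk>norm x \<le> 1; norm y \<le> 1; x \<in> A; y \<in> A\<rbrakk> \<Longrightarrow> norm (f x - f y) \<le> L * norm (x - y)"
  shows "\<omega> \<in> A" "w = f \<omega>"
proof -
  show A\<omega>: "\<omega> \<in> A" using z lim A by (metis closed_sequentially)
  have n: "norm \<omega> \<le> 1" using z tendsto_norm[OF lim] by (intro LIMSEQ_le_const2[OF tendsto_norm[OF lim]]) auto
  have "(\<lambda>j. f (z j) - f \<omega>) \<longlonglongrightarrow> 0"
  proof (rule Lim_null_comparison)
    show "\<forall>\<^sub>F j in sequentially. norm (f (z j) - f \<omega>) \<le> L * norm (z j - \<omega>)"
      using L z n A\<omega> by (intro always_eventually) auto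
    have "(\<lambda>j. z j - \<omega>) \<longlonglongrightarrow> 0" using lim by (simp add: LIM_zero)
    then show "(\<lambda>j. L * norm (z j - \<omega>)) \<longlonglongrightarrow> 0" using tendsto_mult_right_zero tendsto_norm_zero by blast
  qed
  then have "(\<lambda>j. f (z j)) \<longlonglongrightarrow> f \<omega>" by (simp add: LIM_zero_iff)
  then show "w = f \<omega>" using fz LIMSEQ_unique by blast
qed

lemma closed_near: "closed {z. norm (z - \<zeta> k) \<le> gam k}"
  by (intro closed_Collect_le continuous_intros)

lemma closed_away: "closed {z. \<forall>k. away k z}"
  by (intro closed_Collect_all closed_Collect_le continuous_intros)

text \<open>
A boundary point is a limit of values \<open>f (z j)\<close> with \<open>z j\<close> tending to a point \<open>\<omega>\<close> of the circle. If
infinitely many \<open>z j\<close> are on one tooth, or infinitely many are on none, then \<open>f\<close> is Lipschitz along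
these and the limit is \<open>f \<omega>\<close>. Otherwise the \<open>z j\<close> run through infinitely many teeth, which approach
\<open>K\<close> by \<open>P_proximity\<close>.
\<close>

lemma frontier_subset: "frontier G \<subseteq> K \<union> (\<Union>n. f ` arc n)"
proof
  fix w assume w: "w \<in> frontier G"
  have "w \<in> closure G" "w \<notin> G" using w unfolding frontier_def interior_open[OF G_open] by simp_all
  then obtain y where y: "\<forall>j. y j \<in> G" "y \<longlonglongrightarrow> w" using closure_sequential[of w G] by auto
  have "\<forall>j. \<exists>z. z \<in> ball 0 1 \<and> y j = f z" using y(1) unfolding G_def image_iff by blast
  then obtain z0 where "\<forall>j. z0 j \<in> ball 0 1 \<and> y j = f (z0 j)" by (rule choice[THEN exE])
  then have z0: "\<And>j. z0 j \<in> ball 0 1" "\<And>j. y j = f (z0 j)" by simp_all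
  have "seq_compact (cball (0::complex) 1)" by (rule compact_imp_seq_compact) simp
  moreover have "\<forall>n. z0 n \<in> cball 0 1" using z0 by (metis ball_subset_cball subsetD)
  ultimately obtain \<omega> r where r: "\<omega> \<in> cball 0 1" "strict_mono (r::nat\<Rightarrow>nat)" "(z0 \<circ> r) \<longlonglongrightarrow> \<omega>"
    by (rule seq_compactE)
  define z where "z = z0 \<circ> r"
  have z: "z j \<in> ball 0 1" "norm (z j) \<le> 1" for j using z0(1)[of "r j"] by (auto simp: z_def)
  have z\<omega>: "z \<longlonglongrightarrow> \<omega>" using r by (simp add: z_def)
  have fz: "(\<lambda>j. f (z j)) \<longlonglongrightarrow> w"
    using LIMSEQ_subseq_LIMSEQ[OF y(2) r(2)] z0(2) by (simp add: z_def o_def)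
  have \<omega>1: "norm \<omega> = 1"
  proof (rule ccontr)
    assume "norm \<omega> \<noteq> 1"
    then have \<omega>: "\<omega> \<in> ball 0 1" using r by simp
    have "isCont f \<omega>"
      using holomorphic_on_imp_continuous_on[OF f_holomorphic] \<omega> continuous_on_interior[of "ball 0 1" f \<omega>] by simp
    then have "(\<lambda>j. f (z j)) \<longlonglongrightarrow> f \<omega>" using z\<omega> by (rule isCont_tendsto_compose)
    then have "w = f \<omega>" using fz LIMSEQ_unique by blast
    then show False using \<omega> \<open>w \<notin> G\<close> by (auto simp: G_def)
  qed
  have sub: "w \<in> f ` ({z. norm z = 1} \<inter> A)"
    if A: "closed A" and inf: "\<exists>\<^sub>F j in sequentially. z j \<in> A"
      and L: "\<And>x y. \<lbrakk>norm x \<le> 1; norm y \<le> 1; x \<in> A; y \<in> A\<rbrakk> \<Longrightarrow> norm (f x - f y) \<le> L * norm (x - y)" for A L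
  proof -
    have "infinite {j. z j \<in> A}" using inf unfolding cofinite_eq_sequentially[symmetric] frequently_cofinite by simp
    then obtain s :: "nat \<Rightarrow> nat" where s: "strict_mono s" "\<And>n. s n \<in> {j. z j \<in> A}"
      using infinite_enumerate by blast
    have zs: "norm ((z \<circ> s) j) \<le> 1 \<and> (z \<circ> s) j \<in> A" for j using z(2) s(2)[of j] by simp
    have "(\<lambda>j. f ((z \<circ> s) j)) \<longlonglongrightarrow> w" using LIMSEQ_subseq_LIMSEQ[OF fz s(1)] by (simp add: o_def)
    then have "\<omega> \<in> A \<and> w = f \<omega>"
      using boundary_value_of_sequence[OF zs LIMSEQ_subseq_LIMSEQ[OF z\<omega> s(1)] A _ L] by blast
    then show ?thesis using \<omega>1 by auto
  qed
  show "w \<in> K \<union> (\<Union>n. f ` arc n)"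
  proof (cases "\<exists>k. \<exists>\<^sub>F j in sequentially. norm (z j - \<zeta> k) \<le> gam k")
    case True
    then obtain k where k: "\<exists>\<^sub>F j in sequentially. norm (z j - \<zeta> k) \<le> gam k" by blast
    have "w \<in> f ` ({z. norm z = 1} \<inter> {z. norm (z - \<zeta> k) \<le> gam k})"
    proof (rule sub[OF closed_near])
      show "\<exists>\<^sub>F j in sequentially. z j \<in> {z. norm (z - \<zeta> k) \<le> gam k}" using k by simp
    qed (rule f_lipschitz_near, auto)
    moreover have "{z. norm z = 1} \<inter> {z. norm (z - \<zeta> k) \<le> gam k} = arc (Suc k)" by (auto simp: arc_def)
    ultimately show ?thesis by blast
  next
    case False
    then have near: "\<forall>\<^sub>F j in sequentially. \<not> norm (z j - \<zeta> k) \<le> gam k" for k by (simp add: frequently_def)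
    show ?thesis
    proof (cases "\<exists>\<^sub>F j in sequentially. \<forall>k. away k (z j)")
      case True
      then have aw: "\<exists>\<^sub>F j in sequentially. z j \<in> {z. \<forall>k. away k z}" by simp
      have "w \<in> f ` ({z. norm z = 1} \<inter> {z. \<forall>k. away k z})"
        by (rule sub[OF closed_away aw], rule f_lipschitz_away) auto
      moreover have "{z. norm z = 1} \<inter> {z. \<forall>k. away k z} = arc 0" by (auto simp: arc_def)
      ultimately show ?thesis by blast
    next
      case False
      then have ev: "\<forall>\<^sub>F j in sequentially. \<not> (\<forall>k. away k (z j))" by (simp add: frequently_def)
      have "w \<in> closure K" unfolding closure_approachable
      proof (intro allI impI)
        fix \<delta> :: real assume \<delta>: "0 < \<delta>"
        then have "\<forall>\<^sub>F k in sequentially. g k < \<delta> / 12" using g_to_0 by (intro order_tendstoD) auto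
        then obtain m where m: "\<And>k. k \<ge> m \<Longrightarrow> g k < \<delta> / 12" unfolding eventually_sequentially by blast
        have "\<forall>\<^sub>F j in sequentially. \<forall>k\<in>{..<m}. \<not> norm (z j - \<zeta> k) \<le> gam k"
          using near by (intro eventually_ball_finite) auto
        moreover have "\<forall>\<^sub>F j in sequentially. dist (f (z j)) w < \<delta> / 2" using fz \<delta> by (intro tendstoD) auto
        ultimately have "\<forall>\<^sub>F j in sequentially. \<exists>p\<in>K. dist p w < \<delta>" using ev
        proof eventually_elim
          case (elim j)
          then obtain k where k: "norm (z j - \<zeta> k) \<le> gam k" "k \<ge> m" by (metis lessThan_iff not_le less_imp_le)
          obtain \<xi> where \<xi>: "\<xi> \<in> C" "norm (\<xi> - \<zeta> k) \<le> 2 * g k" using C_near by blast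
          have "norm (f (z j) - P \<xi> (height k (z j))) \<le> 3 * norm (\<xi> - \<zeta> k)"
            using z k C_allfree[OF \<xi>(1)] by (intro P_proximity) auto
          also have "\<dots> < \<delta> / 2" using \<xi> m[OF k(2)] by simp
          finally have "dist (P \<xi> (height k (z j))) w < \<delta>"
            using elim dist_triangle_half_r[of "f (z j)" "P \<xi> (height k (z j))" \<delta> w] by (simp add: dist_norm)
          moreover have "P \<xi> (height k (z j)) \<in> K" using \<xi> height[OF z(2), of k] by (auto simp: K_def)
          ultimately show ?case by blast
        qed
        then show "\<exists>p\<in>K. dist p w < \<delta>" using eventually_happens'[OF sequentially_bot] by blast
      qed
      then show ?thesis using compact_imp_closed[OF K_compact] by simp
    qed
  qed
qed

end

section \<open>The comb domain is a Nevanlinna domain\<close>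

lemma has_angular_limit_cong:
  assumes "\<And>z. z \<in> ball 0 1 \<Longrightarrow> g z = h z"
  shows "has_angular_limit g \<zeta> l \<longleftrightarrow> has_angular_limit h \<zeta> l"
proof -
  have "(g \<longlongrightarrow> l) (at \<zeta> within stolz_region M \<zeta>) = (h \<longlongrightarrow> l) (at \<zeta> within stolz_region M \<zeta>)" for M
    by (rule Lim_cong_within) (use assms in \<open>auto simp: stolz_region_def\<close>)
  then show ?thesis by (simp add: has_angular_limit_def)
qed

text \<open>
A multiplier \<open>b\<close> of modulus 1 on the circle that turns the conjugate of \<open>t\<close> into a function \<open>s\<close>
holomorphic in the disc. The bounds by \<open>\<kappa> / norm (z - \<zeta>)\<close> make infinite products of such \<open>b\<close>, and
the sums of the corresponding \<open>s\<close>, converge away from the centres.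
\<close>

definition reflector :: "complex \<Rightarrow> real \<Rightarrow> (complex \<Rightarrow> complex) \<Rightarrow> (complex \<Rightarrow> complex) \<Rightarrow> (complex \<Rightarrow> complex) \<Rightarrow> bool" where
  "reflector \<zeta> \<kappa> t b s \<longleftrightarrow> (b holomorphic_on ball 0 1 \<and> continuous_on (cball 0 1) b \<and>
      s holomorphic_on ball 0 1 \<and> continuous_on (cball 0 1) s \<and>
      (\<forall>z\<in>cball 0 1. norm (b z) \<le> 1 \<and> norm (z - \<zeta>) * norm (b z - 1) \<le> \<kappa> \<and> norm (z - \<zeta>) * norm (s z) \<le> \<kappa>) \<and>
      (\<forall>z\<in>sphere 0 1. norm (b z) = 1 \<and> s z = b z * cnj (t z)))"

definition reflectable :: "complex \<Rightarrow> real \<Rightarrow> (complex \<Rightarrow> complex) \<Rightarrow> bool" where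
  "reflectable \<zeta> \<kappa> t \<longleftrightarrow> (\<exists>b s. reflector \<zeta> \<kappa> t b s)"

lemma reflectable_mono: "reflectable \<zeta> \<kappa> t \<Longrightarrow> \<kappa> \<le> \<kappa>' \<Longrightarrow> reflectable \<zeta> \<kappa>' t"
  unfolding reflectable_def reflector_def by (meson order_trans)

lemma reflectable_zero: "reflectable \<zeta> 0 (\<lambda>_. 0)"
  unfolding reflectable_def reflector_def by (rule exI[of _ "\<lambda>_. 1"], rule exI[of _ "\<lambda>_. 0"]) auto

lemma reflectable_add:
  assumes "reflectable \<zeta> \<kappa> t" "reflectable \<zeta> \<kappa>' t'"
  shows "reflectable \<zeta> (\<kappa> + \<kappa>') (\<lambda>z. t z + t' z)"
proof -
  obtain b s where b: "b holomorphic_on ball 0 1" "continuous_on (cball 0 1) b"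
      "s holomorphic_on ball 0 1" "continuous_on (cball 0 1) s"
      "\<And>z. z \<in> cball 0 1 \<Longrightarrow> norm (b z) \<le> 1 \<and> norm (z - \<zeta>) * norm (b z - 1) \<le> \<kappa> \<and> norm (z - \<zeta>) * norm (s z) \<le> \<kappa>"
      "\<And>z. z \<in> sphere 0 1 \<Longrightarrow> norm (b z) = 1 \<and> s z = b z * cnj (t z)"
    using assms(1) unfolding reflectable_def reflector_def by blast
  obtain b' s' where b': "b' holomorphic_on ball 0 1" "continuous_on (cball 0 1) b'"
      "s' holomorphic_on ball 0 1" "continuous_on (cball 0 1) s'"
      "\<And>z. z \<in> cball 0 1 \<Longrightarrow> norm (b' z) \<le> 1 \<and> norm (z - \<zeta>) * norm (b' z - 1) \<le> \<kappa>' \<and> norm (z - \<zeta>) * norm (s' z) \<le> \<kappa>'"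
      "\<And>z. z \<in> sphere 0 1 \<Longrightarrow> norm (b' z) = 1 \<and> s' z = b' z * cnj (t' z)"
    using assms(2) unfolding reflectable_def reflector_def by blast
  show ?thesis unfolding reflectable_def reflector_def
  proof (rule exI[of _ "\<lambda>z. b z * b' z"], rule exI[of _ "\<lambda>z. s z * b' z + b z * s' z"], intro conjI ballI)
    fix z :: complex assume z: "z \<in> cball 0 1"
    note 1 = b(5)[OF z] and 2 = b'(5)[OF z]
    show "norm (b z * b' z) \<le> 1" unfolding norm_mult using mult_mono[of "norm (b z)" 1 "norm (b' z)" 1] 1 2 by simp
    have "b z * b' z - 1 = (b z - 1) * b' z + (b' z - 1)" by (simp add: algebra_simps)
    then have "norm (b z * b' z - 1) \<le> norm (b z - 1) * norm (b' z) + norm (b' z - 1)"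
      by (metis norm_mult norm_triangle_ineq)
    also have "\<dots> \<le> norm (b z - 1) * 1 + norm (b' z - 1)" using 2 by (intro add_mono mult_left_mono) auto
    finally have "norm (z - \<zeta>) * norm (b z * b' z - 1) \<le> norm (z - \<zeta>) * (norm (b z - 1) + norm (b' z - 1))"
      by (intro mult_left_mono) auto
    then show "norm (z - \<zeta>) * norm (b z * b' z - 1) \<le> \<kappa> + \<kappa>'" using 1 2 by (simp add: distrib_left)
    have "norm (s z * b' z + b z * s' z) \<le> norm (s z) * norm (b' z) + norm (b z) * norm (s' z)"
      by (metis norm_mult norm_triangle_ineq)
    also have "\<dots> \<le> norm (s z) * 1 + 1 * norm (s' z)" using 1 2 by (intro add_mono mult_mono) auto
    finally have "norm (z - \<zeta>) * norm (s z * b' z + b z * s' z) \<le> norm (z - \<zeta>) * (norm (s z) + norm (s' z))"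
      by (intro mult_left_mono) auto
    then show "norm (z - \<zeta>) * norm (s z * b' z + b z * s' z) \<le> \<kappa> + \<kappa>'" using 1 2 by (simp add: distrib_left)
  next
    fix z :: complex assume z: "z \<in> sphere 0 1"
    show "norm (b z * b' z) = 1" using b(6)[OF z] b'(6)[OF z] by (simp add: norm_mult)
    show "s z * b' z + b z * s' z = b z * b' z * cnj (t z + t' z)" using b(6)[OF z] b'(6)[OF z] by (simp add: algebra_simps)
  qed (use b(1-4) b'(1-4) in \<open>auto intro!: holomorphic_intros continuous_intros\<close>)
qed

lemma reflectable_sum:
  assumes "\<And>i. i < n \<Longrightarrow> reflectable \<zeta> (\<kappa> i) (t i)"
  shows "reflectable \<zeta> (\<Sum>i<n. \<kappa> i) (\<lambda>z. \<Sum>i<(n::nat). t i z)"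
  using assms
proof (induction n)
  case (Suc n)
  then show ?case using reflectable_add[of \<zeta> "\<Sum>i<n. \<kappa> i" "\<lambda>z. \<Sum>i<n. t i z" "\<kappa> n" "t n"] by simp
qed (simp add: reflectable_zero)

text \<open>
With \<open>u = 1 - w\<close> the conjugate of \<open>s / (s + u)\<close> on the circle is \<open>s * (1 - u) / (s - (1 + s) * u)\<close>, whose
only pole is \<open>u = s / (1 + s)\<close>. The multiplier is the Blaschke factor of this pole, normalized so that
it tends to 1 with \<open>s\<close> tending to 0.
\<close>

lemma reflectable_kernel:
  assumes \<zeta>: "norm \<zeta> = 1" and s: "0 < s"
  shows "reflectable \<zeta> ((2 + norm c) * s) (\<lambda>z. c * (of_real s / (of_real s + hp_coord \<zeta> z)))"
proof -
  define b where "b = (\<lambda>z. ((1 + of_real s) * hp_coord \<zeta> z - of_real s) / (of_real s + hp_coord \<zeta> z))"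
  define h where "h = (\<lambda>z. - cnj c * (of_real s * (1 - hp_coord \<zeta> z) / (of_real s + hp_coord \<zeta> z)))"
  have nz: "of_real s + hp_coord \<zeta> z \<noteq> 0" if "norm z \<le> 1" for z
    using s Re_hp_coord_nonneg[OF \<zeta> that] by (intro add_pos_nonzero)
  have ge: "norm (z - \<zeta>) \<le> norm (of_real s + hp_coord \<zeta> z)" if "norm z \<le> 1" for z
    using norm_add_pos_ge(1)[OF Re_hp_coord_nonneg[OF \<zeta> that], of s] s by (simp add: norm_hp_coord[OF \<zeta>])
  have sf: "(\<lambda>z. hp_coord \<zeta> z) holomorphic_on S" "continuous_on S (\<lambda>z. hp_coord \<zeta> z)" for S
    unfolding hp_coord_def by (auto intro!: holomorphic_intros continuous_intros)
  have w: "norm (1 - hp_coord \<zeta> z) = norm z" for z by (simp add: hp_coord_def norm_mult \<zeta>)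
  have modulus: "(norm (of_real s + hp_coord \<zeta> z))\<^sup>2 - (norm ((1 + of_real s) * hp_coord \<zeta> z - of_real s))\<^sup>2
      = s * (2 + s) * (1 - (norm z)\<^sup>2)" for z
  proof -
    have "(norm z)\<^sup>2 = (norm (1 - hp_coord \<zeta> z))\<^sup>2" by (simp add: w)
    then show ?thesis by (simp only: cmod_power2) (simp add: power2_eq_square algebra_simps)
  qed
  show ?thesis unfolding reflectable_def reflector_def
  proof (rule exI[of _ b], rule exI[of _ h], intro conjI ballI)
    show "b holomorphic_on ball 0 1" "h holomorphic_on ball 0 1"
      unfolding b_def h_def using nz by (auto intro!: holomorphic_intros sf)
    show "continuous_on (cball 0 1) b" "continuous_on (cball 0 1) h"
      unfolding b_def h_def using nz by (auto intro!: continuous_intros sf)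
  next
    fix z :: complex assume "z \<in> cball 0 1"
    then have z: "norm z \<le> 1" by simp
    let ?D = "of_real s + hp_coord \<zeta> z"
    have D: "0 < norm ?D" using nz[OF z] by simp
    have "(norm z)\<^sup>2 \<le> 1" using z by (simp add: power_le_one)
    then have "0 \<le> s * (2 + s) * (1 - (norm z)\<^sup>2)" using s by simp
    then have "(norm ((1 + of_real s) * hp_coord \<zeta> z - of_real s))\<^sup>2 \<le> (norm ?D)\<^sup>2" using modulus[of z] by linarith
    then have "norm ((1 + of_real s) * hp_coord \<zeta> z - of_real s) \<le> norm ?D" by (rule power2_le_imp_le) simp
    then show "norm (b z) \<le> 1" using D by (simp add: b_def norm_divide divide_le_eq_1)
    have "b z - 1 = - (of_real s * (1 + (1 - hp_coord \<zeta> z))) / ?D"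
      using nz[OF z] by (simp add: b_def field_simps)
    then have "norm (b z - 1) = s * norm (1 + (1 - hp_coord \<zeta> z)) / norm ?D"
      using s by (simp add: norm_divide norm_mult)
    also have "\<dots> \<le> s * 2 / norm ?D"
      using norm_triangle_ineq[of 1 "1 - hp_coord \<zeta> z"] w[of z] z s D by (intro divide_right_mono mult_left_mono) auto
    finally have "norm (z - \<zeta>) * norm (b z - 1) \<le> norm ?D * (s * 2 / norm ?D)" using ge[OF z] by (intro mult_mono) auto
    also have "\<dots> = 2 * s" using D by simp
    also have "\<dots> \<le> (2 + norm c) * s" using s by (intro mult_right_mono) auto
    finally show "norm (z - \<zeta>) * norm (b z - 1) \<le> (2 + norm c) * s" .
    have "norm (h z) = norm c * (s * norm (1 - hp_coord \<zeta> z)) / norm ?D"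
      unfolding h_def using s by (simp only: norm_mult norm_minus_cancel norm_divide complex_mod_cnj norm_of_real) simp
    also have "\<dots> \<le> norm c * (s * 1) / norm ?D"
      using z s by (intro divide_right_mono mult_left_mono) (auto simp: w)
    finally have "norm (z - \<zeta>) * norm (h z) \<le> norm ?D * (norm c * (s * 1) / norm ?D)" using ge[OF z] by (intro mult_mono) auto
    also have "\<dots> = norm c * s" using D by simp
    also have "\<dots> \<le> (2 + norm c) * s" using s by (intro mult_right_mono) auto
    finally show "norm (z - \<zeta>) * norm (h z) \<le> (2 + norm c) * s" .
  next
    fix z :: complex assume "z \<in> sphere 0 1"
    then have z: "norm z = 1" by simp
    let ?u = "hp_coord \<zeta> z"
    have D: "of_real s + ?u \<noteq> 0" using nz z by simp
    have "(norm ((1 + of_real s) * ?u - of_real s))\<^sup>2 = (norm (of_real s + ?u))\<^sup>2" using modulus[of z] z by simp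
    then have n: "norm ((1 + of_real s) * ?u - of_real s) = norm (of_real s + ?u)" by (simp add: power2_eq_iff_nonneg)
    then show "norm (b z) = 1" using D by (simp add: b_def norm_divide)
    have w1: "(1 - ?u) * cnj (1 - ?u) = 1" using w[of z] z complex_norm_square[of "1 - ?u"] by simp
    \<comment> \<open>On the unit circle the conjugate of \<open>u = 1 - w\<close> is \<open>1 - 1 / w\<close>.\<close>
    have cu: "(1 - ?u) * (of_real s + cnj ?u) = of_real s - (1 + of_real s) * ?u"
    proof -
      have "(1 - ?u) * (of_real s + cnj ?u) = (1 - ?u) * (of_real s + 1) - (1 - ?u) * cnj (1 - ?u)"
        by (simp add: algebra_simps)
      then show ?thesis using w1 by (simp add: algebra_simps)
    qed
    have D': "of_real s + cnj ?u \<noteq> 0" using D by (metis complex_cnj_add complex_cnj_complex_of_real complex_cnj_zero_iff)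
    have "b z * (of_real s / (of_real s + cnj ?u)) = - ((1 - ?u) * (of_real s + cnj ?u)) / (of_real s + ?u) * (of_real s / (of_real s + cnj ?u))"
      unfolding cu b_def by simp
    also have "\<dots> = - (of_real s * (1 - ?u) / (of_real s + ?u))"
    proof -
      have "- (W * X) / Y * (S / X) = - (S * W / Y)" if "X \<noteq> 0" for W X Y S :: complex using that by simp
      then show ?thesis using D' by blast
    qed
    finally have "b z * (of_real s / (of_real s + cnj ?u)) = - (of_real s * (1 - ?u) / (of_real s + ?u))" .
    moreover have "cnj (c * (of_real s / (of_real s + ?u))) = cnj c * (of_real s / (of_real s + cnj ?u))" by simp
    ultimately have "b z * cnj (c * (of_real s / (of_real s + ?u))) = cnj c * - (of_real s * (1 - ?u) / (of_real s + ?u))"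
      by (simp only: mult.left_commute)
    then show "h z = b z * cnj (c * (of_real s / (of_real s + ?u)))" unfolding h_def by simp
  qed
qed

context comb begin

lemma tooth_fun_reflectable: "reflectable (\<zeta> k) (8 * e k) (tooth_fun k)"
proof -
  let ?c = "\<zeta> k * a k / of_nat (N k)"
  have N: "1 \<le> N k" using N_ge[of k] g_pos[of k] by (smt (verit) zero_less_divide_iff of_nat_0_less_iff Suc_leI One_nat_def)
  have c: "norm ?c \<le> 2"
  proof -
    have "norm (a k) / real (N k) \<le> 2 / 1" using norm_a_le_2[of k] N by (intro frac_le) auto
    then show ?thesis using norm_zeta by (simp add: norm_divide norm_mult)
  qed
  have "reflectable (\<zeta> k) (\<Sum>i<N k. (2 + norm ?c) * (e k / 2^i))
      (\<lambda>z. \<Sum>i<N k. ?c * (of_real (e k / 2^i) / (of_real (e k / 2^i) + hp_coord (\<zeta> k) z)))"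
    using norm_zeta e_pos by (intro reflectable_sum reflectable_kernel) auto
  moreover have "(\<lambda>z. \<Sum>i<N k. ?c * (of_real (e k / 2^i) / (of_real (e k / 2^i) + hp_coord (\<zeta> k) z))) = tooth_fun k"
    unfolding tooth_fun_def[abs_def] tooth_def by (simp add: sum_distrib_left sum_divide_distrib mult_ac)
  moreover have "(\<Sum>i<N k. (2 + norm ?c) * (e k / 2^i)) \<le> 8 * e k"
  proof -
    have "(2 + norm ?c) * (\<Sum>i<N k. e k / 2^i) \<le> 4 * (2 * e k)"
      using c sum_halves_le[of "e k" "N k"] e_pos[of k] by (intro mult_mono sum_nonneg) auto
    then show ?thesis by (simp add: sum_distrib_left)
  qed
  ultimately show ?thesis using reflectable_mono by metis
qed

definition series_limit :: "(nat \<Rightarrow> complex \<Rightarrow> complex) \<Rightarrow> complex \<Rightarrow> complex" where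
  "series_limit H z = H 0 z + (\<Sum>n. H (Suc n) z - H n z)"

text \<open>
The increments are controlled by the size of the teeth relative to the distance from their
centres. This is the common property of the partial sums of \<open>f\<close>, the partial Blaschke products and
the corresponding numerators. The constant 40 is the largest of those that occur, in the estimate
for the numerators.
\<close>

definition tame :: "(nat \<Rightarrow> complex \<Rightarrow> complex) \<Rightarrow> bool" where
  "tame H \<longleftrightarrow> (\<forall>n. H n holomorphic_on ball 0 1 \<and> continuous_on (cball 0 1) (H n)) \<and>
     (\<forall>n. \<forall>z\<in>cball 0 1. norm (z - \<zeta> n) * norm (H (Suc n) z - H n z) \<le> 40 * e n)"

lemma tame_uniform:
  assumes "tame H" and S: "S \<subseteq> cball 0 1" and r: "0 < r"
    and far: "\<forall>\<^sub>F n in sequentially. \<forall>z\<in>S. r * gam n \<le> norm (z - \<zeta> n)"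
  shows "uniform_limit S H (series_limit H) sequentially"
proof -
  have "\<forall>\<^sub>F n in sequentially. \<forall>z\<in>S. norm (H (Suc n) z - H n z) \<le> 10 / r * eta n"
    using far
  proof eventually_elim
    case (elim n)
    show ?case
    proof
      fix z assume z: "z \<in> S"
      have "r * gam n * norm (H (Suc n) z - H n z) \<le> norm (z - \<zeta> n) * norm (H (Suc n) z - H n z)"
        using elim z by (intro mult_right_mono) auto
      also have "\<dots> \<le> 40 * e n" using assms(1) z S unfolding tame_def by blast
      finally have "norm (H (Suc n) z - H n z) \<le> 10 / r * (4 * e n / gam n)"
        using r gam_pos[of n] by (simp add: field_simps)
      also have "\<dots> \<le> 10 / r * eta n" using r e_bounds(1)[of n] by (intro mult_left_mono) auto
      finally show "norm (H (Suc n) z - H n z) \<le> 10 / r * eta n" .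
    qed
  qed
  then have "uniform_limit S (\<lambda>n z. \<Sum>i<n. H (Suc i) z - H i z) (\<lambda>z. \<Sum>i. H (Suc i) z - H i z) sequentially"
    using summable_mult[OF summable_eta] by (rule Weierstrass_m_test_ev)
  then have "uniform_limit S (\<lambda>n z. H 0 z + (\<Sum>i<n. H (Suc i) z - H i z)) (series_limit H) sequentially"
    unfolding series_limit_def[abs_def] by (intro uniform_limit_intros)
  moreover have "(\<Sum>i<n. H (Suc i) z - H i z) = H n z - H 0 z" for n z by (induction n) auto
  ultimately show ?thesis by simp
qed

lemma tame_uniform_cball:
  assumes "tame H" "r < 1"
  shows "uniform_limit (cball 0 r) H (series_limit H) sequentially"
proof (rule tame_uniform[OF assms(1)])
  show "\<forall>\<^sub>F n in sequentially. \<forall>z\<in>cball 0 r. (1 - r) * gam n \<le> norm (z - \<zeta> n)"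
  proof (intro always_eventually allI ballI)
    fix n and z :: complex assume z: "z \<in> cball 0 r"
    then have "1 - r \<le> norm (z - \<zeta> n)"
      using norm_triangle_ineq2[of "\<zeta> n" z] norm_zeta[of n] by (simp add: norm_minus_commute)
    moreover have "(1 - r) * gam n \<le> (1 - r) * 1" using assms(2) gam_le[of n] by (intro mult_left_mono) auto
    ultimately show "(1 - r) * gam n \<le> norm (z - \<zeta> n)" by simp
  qed
qed (use assms in auto)

lemma tame_holomorphic:
  assumes "tame H" shows "series_limit H holomorphic_on ball 0 1"
proof (rule holomorphic_uniform_sequence[OF open_ball])
  show "H n holomorphic_on ball 0 1" for n using assms by (simp add: tame_def)
  fix x :: complex assume x: "x \<in> ball 0 1"
  define d where "d = (1 - norm x) / 2"
  have "cball x d \<subseteq> cball 0 (1 - d)"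
  proof
    fix y assume "y \<in> cball x d"
    then show "y \<in> cball 0 (1 - d)" using norm_triangle_sub[of y x] by (simp add: d_def dist_norm norm_minus_commute field_simps)
  qed
  moreover have "0 < d" using x by (simp add: d_def)
  moreover then have "cball 0 (1 - d) \<subseteq> ball (0::complex) 1" by auto
  ultimately show "\<exists>d>0. cball x d \<subseteq> ball 0 1 \<and> uniform_limit (cball x d) H (series_limit H) sequentially"
    using tame_uniform_cball[OF assms, of "1 - d"] uniform_limit_on_subset by (intro exI[of _ d]) auto
qed

lemma tame_tendsto:
  assumes "tame H" "z \<in> ball 0 1" shows "(\<lambda>n. H n z) \<longlonglongrightarrow> series_limit H z"
  using tame_uniform_cball[OF assms(1), of "norm z"] assms(2) by (intro tendsto_uniform_limitI) auto

text \<open>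
In a Stolz region with vertex \<open>\<omega>\<close> the distance from \<open>\<zeta> n\<close> is at least \<open>1 / (1 + M)\<close> times that of \<open>\<omega>\<close>,
because \<open>1 - norm z \<le> norm (z - \<zeta> n)\<close>. So convergence is uniform on the region together with its
vertex.
\<close>

lemma tame_angular_limit:
  assumes H: "tame H" and \<omega>: "norm \<omega> = 1" "\<omega> \<notin> range \<zeta>"
  shows "has_angular_limit (series_limit H) \<omega> (series_limit H \<omega>)" "(\<lambda>n. H n \<omega>) \<longlonglongrightarrow> series_limit H \<omega>"
proof -
  have aw: "\<forall>\<^sub>F n in sequentially. away n \<omega>" using \<omega> by (intro ev_away) simp
  have unif: "uniform_limit (insert \<omega> (stolz_region M \<omega>)) H (series_limit H) sequentially" if M: "1 < M" for M
  proof (rule tame_uniform[OF H, of _ "1 / (1 + M)"])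
    show "\<forall>\<^sub>F n in sequentially. \<forall>z\<in>insert \<omega> (stolz_region M \<omega>). 1 / (1 + M) * gam n \<le> norm (z - \<zeta> n)"
      using aw
    proof eventually_elim
      case (elim n)
      show ?case
      proof
        fix z assume "z \<in> insert \<omega> (stolz_region M \<omega>)"
        then have z: "norm (z - \<omega>) \<le> M * (1 - norm z)" using \<omega> by (auto simp: stolz_region_def)
        have "1 - norm z \<le> norm (z - \<zeta> n)"
          using norm_triangle_ineq2[of "\<zeta> n" z] norm_zeta[of n] by (simp add: norm_minus_commute)
        then have "M * (1 - norm z) \<le> M * norm (z - \<zeta> n)" using M by (intro mult_left_mono) auto
        moreover have "norm (\<omega> - \<zeta> n) \<le> norm (z - \<omega>) + norm (z - \<zeta> n)"
          by (metis dist_norm dist_triangle2 dist_commute)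
        ultimately have "gam n \<le> (1 + M) * norm (z - \<zeta> n)" using elim z by (simp add: algebra_simps)
        then show "1 / (1 + M) * gam n \<le> norm (z - \<zeta> n)" using M by (simp add: field_simps)
      qed
    qed
  qed (use M \<omega> in \<open>auto simp: stolz_region_def\<close>)
  show lim: "(\<lambda>n. H n \<omega>) \<longlonglongrightarrow> series_limit H \<omega>"
    using unif[of 2] by (intro tendsto_uniform_limitI) auto
  show "has_angular_limit (series_limit H) \<omega> (series_limit H \<omega>)"
    unfolding has_angular_limit_def
  proof (intro allI impI)
    fix M :: real assume M: "1 < M"
    show "(series_limit H \<longlongrightarrow> series_limit H \<omega>) (at \<omega> within stolz_region M \<omega>)"
    proof (rule swap_uniform_limit[OF _ lim uniform_limit_on_subset[OF unif[OF M]] sequentially_bot])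
      show "\<forall>\<^sub>F n in sequentially. (H n \<longlongrightarrow> H n \<omega>) (at \<omega> within stolz_region M \<omega>)"
      proof (intro always_eventually allI)
        fix n
        have "continuous_on (cball 0 1) (H n)" using H by (simp add: tame_def)
        then have "(H n \<longlongrightarrow> H n \<omega>) (at \<omega> within cball 0 1)" using \<omega> by (simp add: continuous_on)
        then show "(H n \<longlongrightarrow> H n \<omega>) (at \<omega> within stolz_region M \<omega>)"
          by (rule tendsto_within_subset) (auto simp: stolz_region_def)
      qed
    qed auto
  qed
qed

lemma F_tame: "tame (\<lambda>n. F {..<n})"
proof -
  have "norm (z - \<zeta> n) * norm (F {..<Suc n} z - F {..<n} z) \<le> 40 * e n" if "norm z \<le> 1" for n z
    using norm_tooth_fun_le[OF norm_a_le_2 that, of n] e_pos[of n] by (simp add: F_def)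
  then show ?thesis using F_holomorphic F_continuous by (simp add: tame_def)
qed

lemma series_limit_F: "series_limit (\<lambda>n. F {..<n}) = f"
  by (simp add: series_limit_def f_def F_def fun_eq_iff)

lemma e_le_eta: "16 * e n \<le> eta n"
proof -
  have "16 * e n * gam n \<le> 1 * e n * 4" using e_pos[of n] gam_le[of n] mult_left_mono[OF gam_le[of n], of "16 * e n"] by simp
  then have "16 * e n \<le> 4 * e n / gam n" using gam_pos[of n] by (simp add: field_simps)
  then show ?thesis using e_bounds(1)[of n] by simp
qed

text \<open>
The factor \<open>z\<close> belongs to the identity, the summand of \<open>f\<close> that carries no tooth: on the circle its
conjugate is \<open>1 / z\<close>.
\<close>

definition blaschke_seq :: "(nat \<Rightarrow> complex \<Rightarrow> complex) \<Rightarrow> nat \<Rightarrow> complex \<Rightarrow> complex" where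
  "blaschke_seq b n z = z * (\<Prod>k<n. b k z)"

primrec numerator_seq :: "(nat \<Rightarrow> complex \<Rightarrow> complex) \<Rightarrow> (nat \<Rightarrow> complex \<Rightarrow> complex) \<Rightarrow> nat \<Rightarrow> complex \<Rightarrow> complex" where
  "numerator_seq b s 0 = (\<lambda>z. 1)"
| "numerator_seq b s (Suc n) = (\<lambda>z. numerator_seq b s n z * b n z + blaschke_seq b n z * s n z)"

text \<open>
The recursion for the numerators preserves the identity \<open>U n z = B n z * cnj (F {..<n} z)\<close> on the circle,
and the maximum principle turns it into a bound for \<open>U n\<close> in the disc that is uniform in \<open>n\<close>. The value at
\<open>1/2\<close> shows later that the limit of the \<open>B n\<close> does not vanish identically.
\<close>

lemma pseudocontinuation_sequences:
  obtains B U where "tame B" "tame U"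
    "\<And>n z. norm z \<le> 1 \<Longrightarrow> norm (B n z) \<le> 1" "\<And>n z. norm z \<le> 1 \<Longrightarrow> norm (U n z) \<le> 4"
    "\<And>n z. norm z = 1 \<Longrightarrow> norm (B n z) = 1 \<and> U n z = B n z * cnj (F {..<n} z)"
    "\<And>n. norm (B n (1/2) - 1/2) \<le> 1/100"
proof -
  have "\<forall>k. \<exists>b s. reflector (\<zeta> k) (8 * e k) (tooth_fun k) b s" using tooth_fun_reflectable unfolding reflectable_def by blast
  then obtain b s where bs: "\<And>k. reflector (\<zeta> k) (8 * e k) (tooth_fun k) (b k) (s k)" by metis
  have b: "b k holomorphic_on ball 0 1" "continuous_on (cball 0 1) (b k)"
    and s: "s k holomorphic_on ball 0 1" "continuous_on (cball 0 1) (s k)" for k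
    using bs[of k] unfolding reflector_def by blast+
  have b1: "norm (b k z) \<le> 1" and b2: "norm (z - \<zeta> k) * norm (b k z - 1) \<le> 8 * e k"
    and s2: "norm (z - \<zeta> k) * norm (s k z) \<le> 8 * e k" if "norm z \<le> 1" for k z
    using bs[of k] that unfolding reflector_def by auto
  have bT: "norm (b k z) = 1" and sT: "s k z = b k z * cnj (tooth_fun k z)" if "norm z = 1" for k z
    using bs[of k] that unfolding reflector_def by auto
  define B U where "B = blaschke_seq b" and "U = numerator_seq b s"
  have B: "B n holomorphic_on ball 0 1" "continuous_on (cball 0 1) (B n)" for n
    unfolding B_def blaschke_seq_def[abs_def] by (auto intro!: holomorphic_intros continuous_intros b)
  have U: "U n holomorphic_on ball 0 1 \<and> continuous_on (cball 0 1) (U n)" for n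
  proof (induction n)
    case (Suc n)
    then show ?case unfolding U_def using b s B unfolding B_def by (auto intro!: holomorphic_intros continuous_intros)
  qed (auto simp: U_def)
  have B1: "norm (B n z) \<le> 1" if "norm z \<le> 1" for n z
  proof -
    have "(\<Prod>k<n. norm (b k z)) \<le> 1" using b1[OF that] by (intro prod_le_1) auto
    then show ?thesis unfolding B_def blaschke_seq_def norm_mult prod_norm[symmetric]
      using that mult_mono[of "norm z" 1 "\<Prod>k<n. norm (b k z)" 1] by (simp add: prod_nonneg)
  qed
  have BT: "norm (B n z) = 1" if "norm z = 1" for n z
    using that bT[OF that] by (simp add: B_def blaschke_seq_def norm_mult prod_norm[symmetric])
  have UT: "U n z = B n z * cnj (F {..<n} z)" if "norm z = 1" for n z
  proof (induction n)
    case 0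
    have "z * cnj z = 1" using that by (metis complex_norm_square of_real_1 one_power2)
    then show ?case by (simp add: U_def B_def blaschke_seq_def F_def)
  next
    case (Suc n)
    have "U (Suc n) z = U n z * b n z + B n z * s n z" by (simp add: U_def B_def)
    also have "\<dots> = (B n z * b n z) * cnj (F {..<n} z + tooth_fun n z)" using Suc sT[OF that] by (simp add: algebra_simps)
    finally show ?case by (simp add: F_def B_def blaschke_seq_def mult.assoc add.assoc)
  qed
  have U4: "norm (U n z) \<le> 4" if "norm z \<le> 1" for n z
  proof (rule maximum_modulus_frontier[of "U n" "cball 0 1"])
    show "norm (U n w) \<le> 4" if "w \<in> frontier (cball 0 1)" for w
      using UT[of w n] BT[of w n] norm_F_le[of w n] that by (simp add: frontier_cball norm_mult)
  qed (use U that in auto)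
  have Binc: "norm (z - \<zeta> n) * norm (B (Suc n) z - B n z) \<le> 8 * e n" if "norm z \<le> 1" for n z
  proof -
    have "B (Suc n) z - B n z = B n z * (b n z - 1)" by (simp add: B_def blaschke_seq_def algebra_simps)
    then have "norm (B (Suc n) z - B n z) \<le> 1 * norm (b n z - 1)"
      using B1[OF that] unfolding norm_mult by (metis mult_right_mono norm_ge_zero norm_mult)
    then have "norm (z - \<zeta> n) * norm (B (Suc n) z - B n z) \<le> norm (z - \<zeta> n) * norm (b n z - 1)" by (intro mult_left_mono) auto
    then show ?thesis using b2[OF that, of n] by linarith
  qed
  have Uinc: "norm (z - \<zeta> n) * norm (U (Suc n) z - U n z) \<le> 40 * e n" if "norm z \<le> 1" for n z
  proof -
    have "U (Suc n) z - U n z = U n z * (b n z - 1) + B n z * s n z" by (simp add: U_def B_def algebra_simps)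
    then have "norm (U (Suc n) z - U n z) \<le> norm (U n z) * norm (b n z - 1) + norm (B n z) * norm (s n z)"
      by (metis norm_mult norm_triangle_ineq)
    also have "\<dots> \<le> 4 * norm (b n z - 1) + 1 * norm (s n z)"
      using U4[OF that] B1[OF that] by (intro add_mono mult_right_mono) auto
    finally have "norm (z - \<zeta> n) * norm (U (Suc n) z - U n z) \<le> norm (z - \<zeta> n) * (4 * norm (b n z - 1) + 1 * norm (s n z))"
      by (intro mult_left_mono) auto
    also have "\<dots> = 4 * (norm (z - \<zeta> n) * norm (b n z - 1)) + norm (z - \<zeta> n) * norm (s n z)" by (simp add: algebra_simps)
    finally show ?thesis using b2[OF that, of n] s2[OF that, of n] by linarith
  qed
  have half: "norm (B n (1/2) - 1/2) \<le> sum eta {..<n}" for n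
  proof (induction n)
    case (Suc n)
    have "1/2 \<le> norm (1/2 - \<zeta> n)" using norm_triangle_ineq2[of "\<zeta> n" "1/2"] norm_zeta[of n] by (simp add: norm_minus_commute)
    then have "1/2 * norm (B (Suc n) (1/2) - B n (1/2)) \<le> norm (1/2 - \<zeta> n) * norm (B (Suc n) (1/2) - B n (1/2))"
      by (intro mult_right_mono) auto
    then have "norm (B (Suc n) (1/2) - B n (1/2)) \<le> eta n" using Binc[of "1/2" n] e_le_eta[of n] by simp
    then show ?case using Suc norm_triangle_ineq[of "B (Suc n) (1/2) - B n (1/2)" "B n (1/2) - 1/2"] by simp
  qed (simp add: B_def blaschke_seq_def)
  show ?thesis
  proof (rule that[of B U])
    have "norm (z - \<zeta> n) * norm (B (Suc n) z - B n z) \<le> 40 * e n" if "norm z \<le> 1" for n z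
      using Binc[OF that, of n] e_pos[of n] by linarith
    then show "tame B" unfolding tame_def using B by simp
    show "tame U" unfolding tame_def using U Uinc by simp
    show "norm (B n (1/2) - 1/2) \<le> 1/100" for n using half[of n] sum_eta_le'[of "{..<n}"] by simp
  qed (use B1 U4 BT UT in auto)
qed

end

lemma countable_cis_vimage: "countable {t. cis t = w}"
proof (cases "\<exists>t0. cis t0 = w")
  case True
  then obtain t0 where t0: "cis t0 = w" by blast
  have "{t. cis t = w} \<subseteq> range (\<lambda>n::int. t0 + 2 * of_int n * pi)"
  proof
    fix t assume "t \<in> {t. cis t = w}"
    then have "exp (\<i> * of_real t) = exp (\<i> * of_real t0)" using t0 by (simp add: cis_conv_exp)
    then obtain n :: int where "\<i> * of_real t = \<i> * of_real t0 + of_int (2 * n) * pi * \<i>" unfolding exp_eq by blast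
    then have "Im (\<i> * of_real t) = Im (\<i> * of_real t0 + of_int (2 * n) * pi * \<i>)" by (rule arg_cong)
    then have "t = t0 + 2 * of_int n * pi" by simp
    then show "t \<in> range (\<lambda>n::int. t0 + 2 * of_int n * pi)" by blast
  qed
  then show ?thesis by (rule countable_subset) simp
qed auto

context comb_limit begin

text \<open>
With \<open>Bl\<close> and \<open>Ul\<close> the limits of the Blaschke products and the numerators, \<open>u\<close> and \<open>v\<close> are obtained by
transport with the inverse of \<open>f\<close>. The exceptional parameters \<open>t\<close> are those with \<open>cis t\<close> a centre.
\<close>

theorem nevanlinna_G: "nevanlinna_domain G"
proof -
  obtain B U where BU: "tame B" "tame U"
    "\<And>n z. norm z \<le> 1 \<Longrightarrow> norm (B n z) \<le> 1" "\<And>n z. norm z \<le> 1 \<Longrightarrow> norm (U n z) \<le> 4"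
    "\<And>n z. norm z = 1 \<Longrightarrow> norm (B n z) = 1 \<and> U n z = B n z * cnj (F {..<n} z)"
    "\<And>n. norm (B n (1/2) - 1/2) \<le> 1/100"
    by (rule pseudocontinuation_sequences, rule that, assumption+)
  define Bl Ul where "Bl = series_limit B" and "Ul = series_limit U"
  have Bl: "Bl holomorphic_on ball 0 1" "Ul holomorphic_on ball 0 1"
    unfolding Bl_def Ul_def using BU by (auto intro: tame_holomorphic)
  have Bl1: "norm (Bl z) \<le> 1" "norm (Ul z) \<le> 4" if "z \<in> ball 0 1" for z
  proof -
    have n: "norm z \<le> 1" using that by simp
    show "norm (Bl z) \<le> 1" unfolding Bl_def
      using BU(3)[OF n] by (intro LIMSEQ_le_const2[OF tendsto_norm[OF tame_tendsto[OF BU(1) that]]]) auto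
    show "norm (Ul z) \<le> 4" unfolding Ul_def
      using BU(4)[OF n] by (intro LIMSEQ_le_const2[OF tendsto_norm[OF tame_tendsto[OF BU(2) that]]]) auto
  qed
  have half: "norm (Bl (1/2) - 1/2) \<le> 1/100"
  proof -
    have "(\<lambda>n. norm (B n (1/2) - 1/2)) \<longlonglongrightarrow> norm (Bl (1/2) - 1/2)"
      unfolding Bl_def by (intro tendsto_intros tame_tendsto BU(1)) simp
    then show ?thesis by (rule LIMSEQ_le_const2) (use BU(6) in auto)
  qed
  have Bnz: "Bl (1/2) \<noteq> 0" using half by auto
  obtain h where h': "h holomorphic_on (f ` ball 0 1)" "\<And>z. z \<in> ball 0 1 \<Longrightarrow> deriv f z * deriv h (f z) = 1"
     "\<And>z. z \<in> ball 0 1 \<Longrightarrow> h (f z) = z"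
    by (rule holomorphic_has_inverse[OF f_holomorphic open_ball f_inj], rule that, assumption+)
  note h = h'(1,3)
  have hG1: "h holomorphic_on G" using h(1) by (simp only: G_def)
  have hG2: "h ` G \<subseteq> ball 0 1"
  proof
    fix x assume "x \<in> h ` G"
    then obtain z where "z \<in> ball 0 1" "x = h (f z)" unfolding G_def by blast
    then show "x \<in> ball 0 1" using h(2) by simp
  qed
  note hG = hG1 hG2
  define u v where "u = Ul \<circ> h" and "v = Bl \<circ> h"
  have u: "u \<in> H_infinity G" "v \<in> H_infinity G"
  proof -
    have "u holomorphic_on G" "v holomorphic_on G"
      unfolding u_def v_def using holomorphic_on_compose_gen[OF hG(1) _ hG(2)] Bl by blast+
    moreover have "bounded (u ` G)" unfolding bounded_iff u_def using Bl1(2) hG(2) by (intro exI[of _ 4]) auto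
    moreover have "bounded (v ` G)" unfolding bounded_iff v_def using Bl1(1) hG(2) by (intro exI[of _ 1]) auto
    ultimately show "u \<in> H_infinity G" "v \<in> H_infinity G" by (auto simp: H_infinity_def)
  qed
  have uf: "(u \<circ> f) z = Ul z" "(v \<circ> f) z = Bl z" if "z \<in> ball 0 1" for z
    using h(2)[OF that] by (simp_all add: u_def v_def)
  have half_disc: "(1/2 :: complex) \<in> ball 0 1" by (simp add: norm_divide)
  have fG: "f (1/2) \<in> G" unfolding G_def using half_disc by (rule imageI)
  have "v (f (1/2)) = Bl (1/2)" using uf(2)[OF half_disc] by simp
  then have vnz: "\<exists>z\<in>G. v z \<noteq> 0" using fG Bnz by (intro bexI[of _ "f (1/2)"]) simp_all
  have Gne: "G \<noteq> {}" using fG by blast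
  have conf: "conformal_map_of_disc_onto f G"
    using f_holomorphic f_inj by (simp add: conformal_map_of_disc_onto_def G_def)
  define Q where "Q = (\<lambda>t. \<exists>a b c. has_angular_limit f (cis t) a \<and> has_angular_limit (u \<circ> f) (cis t) b \<and>
        has_angular_limit (v \<circ> f) (cis t) c \<and> c \<noteq> 0 \<and> cnj a = b / c)"
  have conj: "conj_eq_quotient_ae f u v"
    unfolding conj_eq_quotient_ae_def Q_def[symmetric]
  proof (rule AE_I')
    have "countable (\<Union>n. {t. cis t = \<zeta> n})" by (intro countable_UN countable_cis_vimage) simp
    then have c: "countable ({0..2*pi} \<inter> (\<Union>n. {t. cis t = \<zeta> n}))" by (rule countable_subset[rotated]) auto
    then have "({0..2*pi} \<inter> (\<Union>n. {t. cis t = \<zeta> n})) \<in> null_sets lebesgue"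
      by (intro null_sets_completionI countable_imp_null_set_lborel)
    then show "({0..2*pi} \<inter> (\<Union>n. {t. cis t = \<zeta> n})) \<in> null_sets (lebesgue_on {0..2*pi})"
      by (subst null_sets_restrict_space) auto
  next
    have Q: "Q t" if t: "\<And>n. cis t \<noteq> \<zeta> n" for t
    proof -
      define \<omega> where "\<omega> = cis t"
      have \<omega>: "norm \<omega> = 1" "\<omega> \<notin> range \<zeta>" using t by (auto simp: \<omega>_def)
      note lims = tame_angular_limit[OF F_tame \<omega>] tame_angular_limit[OF BU(1) \<omega>] tame_angular_limit[OF BU(2) \<omega>]
      have "(\<lambda>n. norm (B n \<omega>)) \<longlonglongrightarrow> norm (Bl \<omega>)" using lims(4) unfolding Bl_def by (rule tendsto_norm)
      then have "(\<lambda>n. 1::real) \<longlonglongrightarrow> norm (Bl \<omega>)" using BU(5)[OF \<omega>(1)] by simp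
      then have "norm (Bl \<omega>) = 1" by (simp add: LIMSEQ_const_iff)
      then have nz: "Bl \<omega> \<noteq> 0" by auto
      have "(\<lambda>n. B n \<omega> * cnj (F {..<n} \<omega>)) \<longlonglongrightarrow> Bl \<omega> * cnj (f \<omega>)"
        using tendsto_mult[OF lims(4) tendsto_cnj[OF lims(2)]] unfolding Bl_def series_limit_F .
      then have "(\<lambda>n. U n \<omega>) \<longlonglongrightarrow> Bl \<omega> * cnj (f \<omega>)" using BU(5)[OF \<omega>(1)] by simp
      from LIMSEQ_unique[OF this lims(6)] have "Ul \<omega> = Bl \<omega> * cnj (f \<omega>)" unfolding Ul_def by (rule sym)
      then have "cnj (f \<omega>) = Ul \<omega> / Bl \<omega>" using nz by simp
      moreover have "has_angular_limit (u \<circ> f) \<omega> (Ul \<omega>)"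
        using lims(5) has_angular_limit_cong[of "u \<circ> f" Ul, OF uf(1)] by (simp add: Ul_def)
      moreover have "has_angular_limit (v \<circ> f) \<omega> (Bl \<omega>)"
        using lims(3) has_angular_limit_cong[of "v \<circ> f" Bl, OF uf(2)] by (simp add: Bl_def)
      moreover have "has_angular_limit f \<omega> (f \<omega>)" using lims(1) by (simp add: series_limit_F)
      ultimately show ?thesis using nz unfolding Q_def \<omega>_def[symmetric]
        by - (rule exI[of _ "f \<omega>"], rule exI[of _ "Ul \<omega>"], rule exI[of _ "Bl \<omega>"], simp)
    qed
    show "{t \<in> space (lebesgue_on {0..2*pi}). \<not> Q t} \<subseteq> {0..2*pi} \<inter> (\<Union>n. {t. cis t = \<zeta> n})"
    proof
      fix t assume "t \<in> {t \<in> space (lebesgue_on {0..2*pi}). \<not> Q t}"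
      then have "t \<in> {0..2*pi}" "\<exists>n. cis t = \<zeta> n" using Q[of t] by (auto simp: space_restrict_space)
      then show "t \<in> {0..2*pi} \<inter> (\<Union>n. {t. cis t = \<zeta> n})" by blast
    qed
  qed
  have "\<exists>f. conformal_map_of_disc_onto f G \<and> conj_eq_quotient_ae f u v"
    using conf conj by (intro exI[of _ f] conjI)
  with vnz have "\<exists>u \<in> H_infinity G. \<exists>v \<in> H_infinity G. (\<exists>z\<in>G. v z \<noteq> 0) \<and>
        (\<exists>f. conformal_map_of_disc_onto f G \<and> conj_eq_quotient_ae f u v)"
    using u by (intro bexI[OF _ u(1)] bexI[OF _ u(2)] conjI)
  then show ?thesis
    unfolding nevanlinna_domain_def using G_open G_connected G_bounded G_simply_connected Gne
    by (intro conjI)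
qed

end

section \<open>Choice of the teeth\<close>

text \<open>
Every element of a countable dense subset is repeated infinitely often, so that arbitrarily late
members of the sequence come close to a given point of \<open>C\<close>, even if that point is isolated.
\<close>

lemma recurrent_dense_sequence:
  fixes C :: "'a::euclidean_space set"
  assumes "C \<noteq> {}"
  obtains q :: "nat \<Rightarrow> 'a" where "\<And>n. q n \<in> C" "\<And>\<xi> \<delta> m. \<xi> \<in> C \<Longrightarrow> 0 < \<delta> \<Longrightarrow> \<exists>n\<ge>m. dist (q n) \<xi> < \<delta>"
proof -
  obtain T where T: "countable T" "T \<subseteq> C" "C \<subseteq> closure T"
    by (rule separable[of C], rule that, assumption+)
  have Tne: "T \<noteq> {}" using T(3) assms by auto
  define q where "q n = from_nat_into T (fst (prod_decode n))" for n
  show thesis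
  proof (rule that[of q])
    show "q n \<in> C" for n using from_nat_into[OF Tne] T(2) by (auto simp: q_def)
    fix \<xi> :: 'a and \<delta> :: real and m :: nat assume "\<xi> \<in> C" "0 < \<delta>"
    then have "\<xi> \<in> closure T" using T(3) by blast
    then obtain t where t: "t \<in> T" "dist t \<xi> < \<delta>" using \<open>0 < \<delta>\<close> by (auto simp: closure_approachable)
    then obtain i where i: "t = from_nat_into T i" using from_nat_into_surj[OF T(1) t(1)] by auto
    show "\<exists>n\<ge>m. dist (q n) \<xi> < \<delta>"
      using t i le_prod_encode_2[of m i] by (intro exI[of _ "prod_encode (i, m)"]) (simp add: q_def)
  qed
qed

text \<open>
The centres are taken close to the members of a recurrent dense sequence of \<open>C\<close>, each at most half
as far from \<open>C\<close> as its predecessor, with \<open>g n\<close> half the distance of \<open>\<zeta> n\<close> from \<open>C\<close>. A later centre is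
closer to \<open>C\<close> than \<open>g k\<close> and therefore cannot enter the gap of \<open>\<zeta> k\<close>.
\<close>

lemma tooth_centres_exist:
  fixes C :: "complex set"
  assumes C: "compact C" "C \<noteq> {}" "\<And>\<xi>. \<xi> \<in> C \<Longrightarrow> norm \<xi> = 1"
    and dense: "\<And>\<xi> \<delta>. \<xi> \<in> C \<Longrightarrow> 0 < \<delta> \<Longrightarrow> \<exists>z. norm z = 1 \<and> z \<notin> C \<and> dist z \<xi> < \<delta>"
  obtains \<zeta> :: "nat \<Rightarrow> complex" and g :: "nat \<Rightarrow> real" where
    "\<And>n. norm (\<zeta> n) = 1" "\<And>n. 0 < g n" "g 0 \<le> 1" "\<And>n. g (Suc n) \<le> g n / 2"
    "\<And>k n. k < n \<Longrightarrow> g k \<le> norm (\<zeta> n - \<zeta> k)"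
    "\<And>\<xi> k. \<xi> \<in> C \<Longrightarrow> norm \<xi> = 1 \<and> g k \<le> norm (\<xi> - \<zeta> k)"
    "\<And>k. \<exists>\<xi>\<in>C. norm (\<xi> - \<zeta> k) \<le> 2 * g k"
    "\<And>\<xi> \<delta> m. \<xi> \<in> C \<Longrightarrow> 0 < \<delta> \<Longrightarrow> \<exists>k\<ge>m. norm (\<xi> - \<zeta> k) < \<delta>"
proof -
  have closed: "closed C" using C(1) by (rule compact_imp_closed)
  obtain q :: "nat \<Rightarrow> complex" where q: "\<And>n. q n \<in> C" "\<And>\<xi> \<delta> m. \<xi> \<in> C \<Longrightarrow> 0 < \<delta> \<Longrightarrow> \<exists>n\<ge>m. dist (q n) \<xi> < \<delta>"
    by (rule recurrent_dense_sequence[OF C(2)], rule that, assumption+)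
  have pos: "0 < infdist z C" if "z \<notin> C" for z
    using in_closed_iff_infdist_zero[OF closed C(2), of z] that infdist_nonneg[of z C] by linarith
  have "\<exists>\<zeta>. \<forall>n. (norm (\<zeta> n) = 1 \<and> \<zeta> n \<notin> C \<and> dist (\<zeta> n) (q n) < 1 / 2^n) \<and>
      infdist (\<zeta> (Suc n)) C < infdist (\<zeta> n) C / 2"
  proof (rule dependent_nat_choice)
    show "\<exists>z. norm z = 1 \<and> z \<notin> C \<and> dist z (q 0) < 1 / 2^0" using dense[OF q(1)] by simp
  next
    fix z n assume z: "norm z = 1 \<and> z \<notin> C \<and> dist z (q n) < 1 / 2^n"
    have "0 < min (1 / 2^Suc n) (infdist z C / 2)" using pos[of z] z by simp
    then obtain w where w: "norm w = 1" "w \<notin> C" "dist w (q (Suc n)) < min (1 / 2^Suc n) (infdist z C / 2)"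
      using dense[OF q(1)] by blast
    then show "\<exists>w. (norm w = 1 \<and> w \<notin> C \<and> dist w (q (Suc n)) < 1 / 2^Suc n) \<and> infdist w C < infdist z C / 2"
      using infdist_le[OF q(1), of w "Suc n"] by (intro exI[of _ w]) auto
  qed
  then obtain \<zeta> where "\<forall>n. (norm (\<zeta> n) = 1 \<and> \<zeta> n \<notin> C \<and> dist (\<zeta> n) (q n) < 1 / 2^n) \<and>
      infdist (\<zeta> (Suc n)) C < infdist (\<zeta> n) C / 2" by (rule exE)
  then have \<zeta>: "\<And>n. norm (\<zeta> n) = 1" "\<And>n. \<zeta> n \<notin> C" "\<And>n. dist (\<zeta> n) (q n) < 1 / 2^n"
      "\<And>n. infdist (\<zeta> (Suc n)) C < infdist (\<zeta> n) C / 2" by simp_all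
  define g where "g n = infdist (\<zeta> n) C / 2" for n
  have gpos: "0 < g n" for n using pos[OF \<zeta>(2)] by (simp add: g_def)
  have gSuc: "g (Suc n) \<le> g n / 2" for n using \<zeta>(4)[of n] by (simp add: g_def)
  have gless: "g n \<le> g k / 2" if "k < n" for k n
    using that
  proof (induction rule: strict_inc_induct)
    case (base i)
    then show ?case using gSuc by simp
  next
    case (step i)
    then show ?case using gSuc[of i] gpos[of i] gpos[of "Suc i"] by linarith
  qed
  show thesis
  proof (rule that[of \<zeta> g])
    show "g 0 \<le> 1"
      using infdist_le[OF q(1)[of 0], of "\<zeta> 0"] \<zeta>(3)[of 0] by (simp add: g_def)
    show "g k \<le> norm (\<zeta> n - \<zeta> k)" if "k < n" for k n
      using gless[OF that] infdist_triangle[of "\<zeta> k" C "\<zeta> n"] gpos[of k] by (simp add: g_def dist_norm norm_minus_commute)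
    show "norm \<xi> = 1 \<and> g k \<le> norm (\<xi> - \<zeta> k)" if "\<xi> \<in> C" for \<xi> k
      using infdist_le[OF that, of "\<zeta> k"] gpos[of k] C(3)[OF that] by (simp add: g_def dist_norm norm_minus_commute)
    show "\<exists>\<xi>\<in>C. norm (\<xi> - \<zeta> k) \<le> 2 * g k" for k
    proof -
      obtain x where "x \<in> C" "infdist (\<zeta> k) C = dist (\<zeta> k) x"
        by (rule infdist_attains_inf[OF closed C(2)], rule that, assumption+)
      then show ?thesis by (intro bexI[of _ x]) (simp_all add: g_def dist_norm norm_minus_commute)
    qed
    show "\<exists>k\<ge>m. norm (\<xi> - \<zeta> k) < \<delta>" if \<xi>: "\<xi> \<in> C" and \<delta>: "0 < \<delta>" for \<xi> \<delta> m
    proof -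
      obtain m' where m': "(1/2)^m' < \<delta> / 2" using real_arch_pow_inv[of "\<delta>/2" "1/2"] \<delta> by auto
      obtain k where k: "k \<ge> max m m'" "dist (q k) \<xi> < \<delta> / 2" using q(2)[OF \<xi>, of "\<delta>/2" "max m m'"] \<delta> by auto
      have "(1/2::real)^k \<le> (1/2)^m'" using k by (intro power_decreasing) auto
      then have "dist (\<zeta> k) (q k) < \<delta> / 2" using \<zeta>(3)[of k] m' by (simp add: power_one_over)
      then have "dist \<xi> (\<zeta> k) < \<delta>" using k dist_triangle_half_r[of "q k" \<xi> \<delta> "\<zeta> k"] by (simp add: dist_commute)
      then show ?thesis using k by (auto simp: dist_norm)
    qed
  qed (use \<zeta> gpos gSuc in auto)
qed

lemma dd_cong:
  assumes "\<And>k. k < n \<Longrightarrow> a k = a' k \<and> e k = e' k"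
  shows "comb_data.dd \<zeta> N a e {..<n} z w = comb_data.dd \<zeta> N a' e' {..<n} z w"
  unfolding comb_data.dd_def comb_data.tooth_fun_dd_def using assms by (intro arg_cong2[of _ _ _ _ "(+)"] sum.cong) auto

lemma dd_continuous:
  assumes "\<And>k. norm (\<zeta> k) = 1" "\<And>k. k < n \<Longrightarrow> 0 < e k"
  shows "continuous_on (cball 0 1 \<times> cball 0 1) (\<lambda>(z, w). comb_data.dd \<zeta> N a e {..<n} z w)"
proof -
  have nz: "of_real (e k) / 2^i + (1 - cnj (\<zeta> k) * z) \<noteq> 0" if "norm z \<le> 1" "k < n" for z k and i :: nat
    using add_pos_nonzero[of "hp_coord (\<zeta> k) z" "e k / 2^i"] Re_hp_coord_nonneg[of "\<zeta> k" z] assms that by (simp add: hp_coord_def)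
  show ?thesis
    unfolding comb_data.dd_def comb_data.tooth_fun_dd_def tooth_dd_def hp_coord_def case_prod_beta
    using nz by (auto intro!: continuous_intros)
qed

text \<open>
The condition on \<open>e n\<close> refers only to the earlier teeth, so \<open>a n\<close> and \<open>e n\<close> are obtained by recursion.
If the divided difference of the earlier sum has no zero on the compact bidisc, it has a positive
minimum \<open>\<mu>\<close> there, and \<open>e n\<close> is taken small compared with \<open>\<mu>\<close>.
\<close>

lemma tooth_sizes_exist:
  fixes \<zeta> :: "nat \<Rightarrow> complex" and g :: "nat \<Rightarrow> real" and N :: "nat \<Rightarrow> nat"
  assumes \<zeta>: "\<And>n. norm (\<zeta> n) = 1" and g: "\<And>n. 0 < g n"
  obtains a e where "\<And>n. a n = comb_data.dd \<zeta> N a e {..<n} (\<zeta> n) (\<zeta> n)" "\<And>n. 0 < e n"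
    "\<And>n. 4 * e n \<le> comb_data.eta g n * comb_data.gam g n ^ 3"
    "\<And>n z w. \<lbrakk>\<forall>z w. norm z \<le> 1 \<longrightarrow> norm w \<le> 1 \<longrightarrow> comb_data.dd \<zeta> N a e {..<n} z w \<noteq> 0;
          norm z \<le> 1; norm w \<le> 1; comb_data.gam g n \<le> norm (z - \<zeta> n); comb_data.gam g n \<le> norm (w - \<zeta> n)\<rbrakk>
        \<Longrightarrow> norm (comb_data.tooth_fun_dd \<zeta> N a e n z w) < norm (comb_data.dd \<zeta> N a e {..<n} z w)"
proof -
  define gam where "gam = comb_data.gam g"
  define \<Phi> where "\<Phi> f n r \<longleftrightarrow> (let dd = comb_data.dd \<zeta> N (fst \<circ> f) (snd \<circ> f) {..<n} in
      fst r = dd (\<zeta> n) (\<zeta> n) \<and> 0 < snd r \<and> 4 * snd r \<le> comb_data.eta g n * gam n ^ 3 \<and>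
      ((\<forall>z w. norm z \<le> 1 \<longrightarrow> norm w \<le> 1 \<longrightarrow> dd z w \<noteq> 0) \<longrightarrow>
       (\<forall>z w. norm z \<le> 1 \<longrightarrow> norm w \<le> 1 \<longrightarrow> gam n \<le> norm (z - \<zeta> n) \<longrightarrow> gam n \<le> norm (w - \<zeta> n) \<longrightarrow>
          norm (fst r * tooth_dd (N n) (snd r) (hp_coord (\<zeta> n) z) (hp_coord (\<zeta> n) w)) < norm (dd z w))))"
    for f :: "nat \<Rightarrow> complex \<times> real" and n :: nat and r :: "complex \<times> real"
  have gam: "0 < gam n" for n using g by (simp add: gam_def comb_data.gam_def)
  have "\<exists>f. \<forall>n. \<Phi> f n (f n)"
  proof (rule dependent_wellorder_choice[of \<Phi>])
    fix r :: "complex \<times> real" and f f' :: "nat \<Rightarrow> complex \<times> real" and n :: nat assume "\<And>k. k < n \<Longrightarrow> f k = f' k"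
    then have "comb_data.dd \<zeta> N (fst \<circ> f) (snd \<circ> f) {..<n} z w = comb_data.dd \<zeta> N (fst \<circ> f') (snd \<circ> f') {..<n} z w" for z w
      by (intro dd_cong) auto
    then show "\<Phi> f n r = \<Phi> f' n r" unfolding \<Phi>_def Let_def by simp
  next
    fix n :: nat and f :: "nat \<Rightarrow> complex \<times> real" assume IH: "\<And>k. k < n \<Longrightarrow> \<Phi> f k (f k)"
    define dd where "dd = comb_data.dd \<zeta> N (fst \<circ> f) (snd \<circ> f) {..<n}"
    define a where "a = dd (\<zeta> n) (\<zeta> n)"
    have epos: "0 < (snd \<circ> f) k" if "k < n" for k using IH[OF that] by (simp add: \<Phi>_def Let_def)
    have cont: "continuous_on (cball 0 1 \<times> cball 0 1) (\<lambda>(z, w). dd z w)"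
      unfolding dd_def using \<zeta> epos by (rule dd_continuous)
    have "\<exists>\<mu>>0. (\<forall>z w. norm z \<le> 1 \<longrightarrow> norm w \<le> 1 \<longrightarrow> dd z w \<noteq> 0) \<longrightarrow> (\<forall>z w. norm z \<le> 1 \<longrightarrow> norm w \<le> 1 \<longrightarrow> \<mu> \<le> norm (dd z w))"
    proof (cases "\<forall>z w. norm z \<le> 1 \<longrightarrow> norm w \<le> 1 \<longrightarrow> dd z w \<noteq> 0")
      case True
      have "continuous_on (cball 0 1 \<times> cball 0 1) (\<lambda>p. norm ((\<lambda>(z, w). dd z w) p))"
        using cont by (rule continuous_on_norm)
      then have "\<exists>p\<in>cball 0 1 \<times> cball 0 1. \<forall>x\<in>cball 0 1 \<times> cball 0 1. norm ((\<lambda>(z, w). dd z w) p) \<le> norm ((\<lambda>(z, w). dd z w) x)"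
        by (intro continuous_attains_inf compact_Times compact_cball) auto
      then obtain p where p: "p \<in> cball 0 1 \<times> cball 0 1" "\<forall>x\<in>cball 0 1 \<times> cball 0 1. norm ((\<lambda>(z, w). dd z w) p) \<le> norm ((\<lambda>(z, w). dd z w) x)"
        by (rule bexE)
      have "0 < norm ((\<lambda>(z, w). dd z w) p)" using p(1) True by (auto simp: case_prod_beta)
      moreover have "norm ((\<lambda>(z, w). dd z w) p) \<le> norm (dd z w)" if "norm z \<le> 1" "norm w \<le> 1" for z w
        using p(2)[rule_format, of "(z, w)"] that by simp
      ultimately show ?thesis by blast
    qed (auto intro: exI[of _ 1])
    then obtain \<mu> where \<mu>: "0 < \<mu>" "\<And>z w. \<forall>z w. norm z \<le> 1 \<longrightarrow> norm w \<le> 1 \<longrightarrow> dd z w \<noteq> 0 \<Longrightarrow> norm z \<le> 1 \<Longrightarrow> norm w \<le> 1 \<Longrightarrow> \<mu> \<le> norm (dd z w)"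
      by blast
    define e where "e = min (comb_data.eta g n * gam n ^ 3 / 4) (\<mu> * gam n ^ 2 / (4 * (norm a + 1)))"
    have e: "0 < e" "4 * e \<le> comb_data.eta g n * gam n ^ 3" "e \<le> \<mu> * gam n ^ 2 / (4 * (norm a + 1))"
      using g[of n] gam[of n] \<mu>(1) by (auto simp: e_def comb_data.eta_def add_nonneg_pos)
    have "\<Phi> f n (a, e)"
      unfolding \<Phi>_def Let_def dd_def[symmetric] fst_conv snd_conv
    proof (intro conjI impI allI)
      fix z w assume nz: "\<forall>z w. norm z \<le> 1 \<longrightarrow> norm w \<le> 1 \<longrightarrow> dd z w \<noteq> 0"
        and zw: "norm z \<le> 1" "norm w \<le> 1" "gam n \<le> norm (z - \<zeta> n)" "gam n \<le> norm (w - \<zeta> n)"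
      have "norm (tooth_dd (N n) e (hp_coord (\<zeta> n) z) (hp_coord (\<zeta> n) w)) \<le> 2 * e / (gam n)\<^sup>2"
        using zw gam e(1) \<zeta> by (intro norm_tooth_dd_le Re_hp_coord_nonneg) (auto simp: norm_hp_coord)
      also have "\<dots> \<le> 2 * (\<mu> * gam n ^ 2 / (4 * (norm a + 1))) / (gam n)\<^sup>2"
        using e(3) gam[of n] by (intro divide_right_mono) auto
      also have "\<dots> = \<mu> / (2 * (norm a + 1))"
      proof -
        have "norm a + 1 \<noteq> 0" using norm_ge_zero[of a] by linarith
        then show ?thesis using gam[of n] by (simp add: divide_simps)
      qed
      finally have "norm a * norm (tooth_dd (N n) e (hp_coord (\<zeta> n) z) (hp_coord (\<zeta> n) w)) \<le> norm a * (\<mu> / (2 * (norm a + 1)))"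
        by (intro mult_left_mono) auto
      also have "\<dots> < \<mu>"
      proof -
        have "norm a < 2 * (norm a + 1)" by (smt (verit) norm_ge_zero)
        then have "\<mu> * norm a < \<mu> * (2 * (norm a + 1))" using \<mu>(1) by (rule mult_strict_left_mono)
        moreover have "0 < 2 * (norm a + 1)" by (smt (verit) norm_ge_zero)
        ultimately show ?thesis by (simp only: times_divide_eq_right pos_divide_less_eq mult.commute[of "norm a"])
      qed
      also have "\<mu> \<le> norm (dd z w)" using \<mu>(2)[OF nz] zw by blast
      finally show "norm (a * tooth_dd (N n) e (hp_coord (\<zeta> n) z) (hp_coord (\<zeta> n) w)) < norm (dd z w)" by (simp add: norm_mult)
    qed (use e in \<open>auto simp: a_def\<close>)
    then show "\<exists>r. \<Phi> f n r" by blast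
  qed
  then obtain f where f: "\<And>n. \<Phi> f n (f n)" by blast
  show thesis
  proof (rule that[of "fst \<circ> f" "snd \<circ> f"])
    fix n
    show "(fst \<circ> f) n = comb_data.dd \<zeta> N (fst \<circ> f) (snd \<circ> f) {..<n} (\<zeta> n) (\<zeta> n)" "0 < (snd \<circ> f) n"
      "4 * (snd \<circ> f) n \<le> comb_data.eta g n * comb_data.gam g n ^ 3"
      using f[of n] by (simp_all add: \<Phi>_def Let_def gam_def)
  next
    fix n z w
    assume "\<forall>z w. norm z \<le> 1 \<longrightarrow> norm w \<le> 1 \<longrightarrow> comb_data.dd \<zeta> N (fst \<circ> f) (snd \<circ> f) {..<n} z w \<noteq> 0"
      and "norm z \<le> 1" "norm w \<le> 1" "comb_data.gam g n \<le> norm (z - \<zeta> n)" "comb_data.gam g n \<le> norm (w - \<zeta> n)"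
    then show "norm (comb_data.tooth_fun_dd \<zeta> N (fst \<circ> f) (snd \<circ> f) n z w) < norm (comb_data.dd \<zeta> N (fst \<circ> f) (snd \<circ> f) {..<n} z w)"
      using f[of n] unfolding \<Phi>_def Let_def gam_def comb_data.tooth_fun_dd_def o_apply by blast
  qed
qed

theorem nevanlinna_comb_exists:
  fixes C :: "complex set"
  assumes C: "compact C" "C \<noteq> {}" "\<And>\<xi>. \<xi> \<in> C \<Longrightarrow> norm \<xi> = 1"
    and dense: "\<And>\<xi> \<delta>. \<xi> \<in> C \<Longrightarrow> 0 < \<delta> \<Longrightarrow> \<exists>z. norm z = 1 \<and> z \<notin> C \<and> dist z \<xi> < \<delta>"
  obtains G :: "complex set" and P :: "complex \<Rightarrow> real \<Rightarrow> complex" and f :: "complex \<Rightarrow> complex" and A :: "nat \<Rightarrow> complex set"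
  where "nevanlinna_domain G"
    "(\<lambda>(\<xi>, t). P \<xi> t) ` (C \<times> {0..1}) \<subseteq> frontier G"
    "frontier G \<subseteq> (\<lambda>(\<xi>, t). P \<xi> t) ` (C \<times> {0..1}) \<union> (\<Union>n. f ` A n)"
    "\<And>n. A n \<subseteq> sphere 0 1" "\<And>n. \<exists>L. L-lipschitz_on (A n) f"
    "\<And>\<xi> \<xi>' t t'. \<lbrakk>\<xi> \<in> C; \<xi>' \<in> C; t \<in> {0..1}; t' \<in> {0..1}\<rbrakk> \<Longrightarrow>
       norm (\<xi> - \<xi>') / 2 \<le> dist (P \<xi> t) (P \<xi>' t') \<and> \<bar>t - t'\<bar> / 2 \<le> dist (P \<xi> t) (P \<xi>' t') \<and>
       dist (P \<xi> t) (P \<xi>' t') \<le> 3 * (norm (\<xi> - \<xi>') + \<bar>t - t'\<bar>)"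
proof -
  obtain \<zeta> g where \<zeta>: 
    "\<And>n. norm (\<zeta> n) = 1" "\<And>n. 0 < g n" "g 0 \<le> 1" "\<And>n. g (Suc n) \<le> g n / 2"
    "\<And>k n. k < n \<Longrightarrow> g k \<le> norm (\<zeta> n - \<zeta> k)"
    "\<And>\<xi> k. \<xi> \<in> C \<Longrightarrow> norm \<xi> = 1 \<and> g k \<le> norm (\<xi> - \<zeta> k)"
    "\<And>k. \<exists>\<xi>\<in>C. norm (\<xi> - \<zeta> k) \<le> 2 * g k"
    "\<And>\<xi> \<delta> m. \<xi> \<in> C \<Longrightarrow> 0 < \<delta> \<Longrightarrow> \<exists>k\<ge>m. norm (\<xi> - \<zeta> k) < \<delta>"
    by (rule tooth_centres_exist[OF C dense], assumption+, rule that, assumption+)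
  define N where "N n = nat \<lceil>1600 / g n\<rceil>" for n
  obtain a e where ae: "\<And>n. a n = comb_data.dd \<zeta> N a e {..<n} (\<zeta> n) (\<zeta> n)" "\<And>n. 0 < e n"
    "\<And>n. 4 * e n \<le> comb_data.eta g n * comb_data.gam g n ^ 3"
    "\<And>n z w. \<lbrakk>\<forall>z w. norm z \<le> 1 \<longrightarrow> norm w \<le> 1 \<longrightarrow> comb_data.dd \<zeta> N a e {..<n} z w \<noteq> 0;
          norm z \<le> 1; norm w \<le> 1; comb_data.gam g n \<le> norm (z - \<zeta> n); comb_data.gam g n \<le> norm (w - \<zeta> n)\<rbrakk>
        \<Longrightarrow> norm (comb_data.tooth_fun_dd \<zeta> N a e n z w) < norm (comb_data.dd \<zeta> N a e {..<n} z w)"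
    by (rule tooth_sizes_exist[of \<zeta> g N], rule \<zeta>(1), rule \<zeta>(2), rule that, assumption+)
  interpret comb_limit \<zeta> g N a e C
  proof
    show "1600 / g n \<le> real (N n)" for n unfolding N_def by (rule real_nat_ceiling_ge)
    show "norm (comb_data.tooth_fun_dd \<zeta> N a e n z w) < norm (comb_data.dd \<zeta> N a e {..<n} z w)"
      if "\<And>z w. norm z \<le> 1 \<Longrightarrow> norm w \<le> 1 \<Longrightarrow> comb_data.dd \<zeta> N a e {..<n} z w \<noteq> 0"
        "norm z \<le> 1" "norm w \<le> 1" "comb_data.gam g n \<le> norm (z - \<zeta> n)" "comb_data.gam g n \<le> norm (w - \<zeta> n)" for n z w
      by (rule ae(4)) (use that in simp_all)
  qed (fact \<zeta> ae C)+
  show thesis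
  proof (rule that[of G P f arc])
    show "nevanlinna_domain G" by (rule nevanlinna_G)
    show "(\<lambda>(\<xi>, t). P \<xi> t) ` (C \<times> {0..1}) \<subseteq> frontier G" using K_subset_frontier by (simp add: K_def)
    show "frontier G \<subseteq> (\<lambda>(\<xi>, t). P \<xi> t) ` (C \<times> {0..1}) \<union> (\<Union>n. f ` arc n)" using frontier_subset by (simp add: K_def)
    show "arc n \<subseteq> sphere 0 1" for n by (auto simp: arc_def)
    show "\<exists>L. L-lipschitz_on (arc n) f" for n using f_lipschitz_arc by blast
    show "norm (\<xi> - \<xi>') / 2 \<le> dist (P \<xi> t) (P \<xi>' t') \<and> \<bar>t - t'\<bar> / 2 \<le> dist (P \<xi> t) (P \<xi>' t') \<and>
       dist (P \<xi> t) (P \<xi>' t') \<le> 3 * (norm (\<xi> - \<xi>') + \<bar>t - t'\<bar>)"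
      if "\<xi> \<in> C" "\<xi>' \<in> C" "t \<in> {0..1}" "t' \<in> {0..1}" for \<xi> \<xi>' t t'
      using P_bilipschitz[of \<xi> \<xi>' t t'] C_allfree that by (simp add: dist_norm)
  qed
qed

section \<open>Thin sets on the line and a Cantor set of prescribed dimension\<close>

lemma dist_cis: "dist (cis x) (cis y) = 2 * \<bar>sin ((x - y) / 2)\<bar>"
proof -
  have "cis x - cis y = cis y * (cis (x - y) - 1)" by (simp add: cis_mult algebra_simps)
  then have "dist (cis x) (cis y) = norm (cis (x - y) - 1)" by (simp add: dist_norm norm_mult)
  then show ?thesis using dist_exp_i_1[of "x - y"] by (simp add: cis_conv_exp)
qed

lemma dist_cis_le: "dist (cis x) (cis y) \<le> \<bar>x - y\<bar>"
  using abs_sin_x_le_abs_x[of "(x - y) / 2"] by (simp add: dist_cis)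

text \<open>
Here \<open>pi / 4 \<ge> 1 / 2\<close> gives \<open>cos t \<ge> cos (pi / 4) \<ge> 1 / 2\<close> for \<open>t\<close> up to \<open>1 / 2\<close>.
\<close>

lemma dist_cis_ge:
  assumes "\<bar>x - y\<bar> \<le> 1"
  shows "\<bar>x - y\<bar> / 2 \<le> dist (cis x) (cis y)"
proof -
  define h where "h = \<bar>x - y\<bar> / 2"
  have h: "0 \<le> h" "h \<le> 1/2" using assms by (auto simp: h_def)
  have "sin 0 - 0 / 2 \<le> sin h - h / 2"
  proof (rule DERIV_nonneg_imp_nondecreasing[OF h(1)])
    fix t assume t: "0 \<le> t" "t \<le> h"
    have "cos (pi / 4) \<le> cos t" using t h pi_ge_two by (intro cos_monotone_0_pi_le) auto
    then have "1 / 2 \<le> cos t" by (simp add: cos_45) (smt (verit) real_le_rsqrt power_one)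
    then show "\<exists>D. ((\<lambda>t. sin t - t / 2) has_real_derivative D) (at t) \<and> 0 \<le> D"
      by (intro exI[of _ "cos t - 1 / 2"]) (auto intro!: derivative_eq_intros)
  qed
  moreover have "\<bar>sin ((x - y) / 2)\<bar> = \<bar>sin h\<bar>"
  proof -
    have "(x - y) / 2 = h \<or> (x - y) / 2 = - h" by (auto simp: h_def abs_if)
    then show ?thesis by (metis abs_minus_cancel sin_minus)
  qed
  ultimately show ?thesis by (simp add: dist_cis h_def)
qed

text \<open>
For \<open>\<tau> > 0\<close> this is somewhat stronger than being null for the Hausdorff measure of exponent \<open>\<tau>\<close>: the covering
sets have a common size. In this form thinness passes to products with an interval.
\<close>

definition thin_covers :: "real \<Rightarrow> 'a::metric_space set \<Rightarrow> bool" where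
  "thin_covers \<tau> X \<longleftrightarrow> (\<forall>\<epsilon>>0. \<exists>(m::nat) d V. X \<subseteq> (\<Union>i<m. V i) \<and> 0 < d \<and> d \<le> 1 \<and> real m * d powr \<tau> < \<epsilon> \<and>
        (\<forall>i<m. \<forall>x\<in>V i. \<forall>y\<in>V i. dist x y \<le> d))"

lemma thin_covers_null:
  fixes X :: "'a::metric_space set"
  shows "thin_covers \<tau> X \<Longrightarrow> 0 < \<tau> \<Longrightarrow> hausdorff_measure \<tau> X = 0"
proof (rule hausdorff_null_finite_covers)
  fix \<epsilon> :: real assume X: "thin_covers \<tau> X" and \<epsilon>: "0 < \<epsilon>"
  obtain m :: nat and d and V :: "nat \<Rightarrow> 'a set" where "X \<subseteq> (\<Union>i<m. V i)" "0 < d" "real m * d powr \<tau> < \<epsilon>"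
      "\<forall>i<m. \<forall>x\<in>V i. \<forall>y\<in>V i. dist x y \<le> d"
    using X \<epsilon> unfolding thin_covers_def by meson
  then show "\<exists>(m::nat) d V. X \<subseteq> (\<Union>i<m. V i) \<and> 0 < d \<and> real m * d powr \<tau> < \<epsilon> \<and> (\<forall>i<m. \<forall>x\<in>V i. \<forall>y\<in>V i. dist x y \<le> d)"
    by (intro exI conjI)
qed auto

lemma thin_covers_singleton: "0 < \<tau> \<Longrightarrow> thin_covers \<tau> {x}"
  unfolding thin_covers_def
proof (intro allI impI)
  fix \<epsilon> :: real assume \<tau>: "0 < \<tau>" and \<epsilon>: "0 < \<epsilon>"
  define d where "d = min 1 ((\<epsilon> / 2) powr (1 / \<tau>))"
  have d: "0 < d" "d \<le> 1" using \<epsilon> by (auto simp: d_def)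
  have "d powr \<tau> \<le> ((\<epsilon> / 2) powr (1 / \<tau>)) powr \<tau>" using d \<tau> by (intro powr_mono2) (auto simp: d_def)
  also have "\<dots> = \<epsilon> / 2" using \<tau> \<epsilon> by (simp add: powr_powr)
  finally have "d powr \<tau> < \<epsilon>" using \<epsilon> by simp
  then show "\<exists>(m::nat) d V. {x} \<subseteq> (\<Union>i<m. V i) \<and> 0 < d \<and> d \<le> 1 \<and> real m * d powr \<tau> < \<epsilon> \<and> (\<forall>i<m. \<forall>x\<in>V i. \<forall>y\<in>V i. dist x y \<le> d)"
    using d by - (rule exI[of _ 1], rule exI[of _ d], rule exI[of _ "\<lambda>_. {x}"], auto)
qed

lemma dist_Pair_le: "dist (x, t) (x', t') \<le> dist x x' + dist t t'"
  by (simp add: dist_Pair_Pair sqrt_sum_squares_le_sum)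

text \<open>
A strip over a set of size \<open>d\<close> is cut into about \<open>1 / d\<close> pieces of diameter at most \<open>2 * d\<close>.
\<close>

lemma thin_covers_strip_null:
  fixes X :: "real set"
  assumes X: "thin_covers (s - 1) X" and s: "1 < s"
  shows "hausdorff_measure s (X \<times> {0..1::real}) = 0"
proof (rule hausdorff_null_finite_covers)
  fix \<epsilon> :: real assume "0 < \<epsilon>"
  then have "0 < \<epsilon> / 2 powr (s + 1)" by simp
  then obtain m :: nat and d and V :: "nat \<Rightarrow> real set" where V: "X \<subseteq> (\<Union>i<m. V i)" "0 < d" "d \<le> 1" "real m * d powr (s - 1) < \<epsilon> / 2 powr (s + 1)"
      "\<forall>i<m. \<forall>x\<in>V i. \<forall>y\<in>V i. dist x y \<le> d"
    using X unfolding thin_covers_def by meson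
  define J where "J = nat \<lceil>1 / d\<rceil>"
  have J: "1 / d \<le> real J" "real J \<le> 2 / d" "0 < J"
  proof -
    have d1: "1 \<le> 1 / d" using V by simp
    show "1 / d \<le> real J" unfolding J_def by (rule real_nat_ceiling_ge)
    then show "0 < J" using d1 by linarith
    have "real J < 1 / d + 1" using d1 unfolding J_def by linarith
    then show "real J \<le> 2 / d" using d1 by (simp add: field_simps)
  qed
  define W where "W k = V (k div J) \<times> {real (k mod J) * d .. (real (k mod J) + 1) * d}" for k
  show "\<exists>m d V. X \<times> {0..1::real} \<subseteq> (\<Union>i<m. V i) \<and> 0 < d \<and> real m * d powr s < \<epsilon> \<and> (\<forall>i<m. \<forall>x\<in>V i. \<forall>y\<in>V i. dist x y \<le> d)"
  proof (rule exI[of _ "m * J"], rule exI[of _ "2 * d"], rule exI[of _ W], intro conjI)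
    show "X \<times> {0..1::real} \<subseteq> (\<Union>k<m * J. W k)"
    proof
      fix p assume "p \<in> X \<times> {0..1::real}"
      then obtain x t where p: "p = (x, t)" "x \<in> X" "0 \<le> t" "t \<le> 1" by auto
      obtain i where i: "i < m" "x \<in> V i" using V(1) p(2) by blast
      \<comment> \<open>The minimum puts \<open>t = 1\<close> into the last piece when \<open>1 / d\<close> is an integer.\<close>
      define j where "j = min (J - 1) (nat \<lfloor>t / d\<rfloor>)"
      have jJ: "j < J" using J(3) by (auto simp: j_def)
      have fl: "real (nat \<lfloor>t / d\<rfloor>) \<le> t / d" "t / d < real (nat \<lfloor>t / d\<rfloor>) + 1" 
      proof -
        have "0 \<le> t / d" using p V(2) by simp
        then have "real (nat \<lfloor>t / d\<rfloor>) = of_int \<lfloor>t / d\<rfloor>" by simp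
        then show "real (nat \<lfloor>t / d\<rfloor>) \<le> t / d" "t / d < real (nat \<lfloor>t / d\<rfloor>) + 1" by linarith+
      qed
      have "real j \<le> t / d" using fl by (simp add: j_def)
      moreover have "t / d \<le> real j + 1"
      proof (cases "nat \<lfloor>t / d\<rfloor> \<le> J - 1")
        case False
        then have "real j + 1 = real J" using J(3) by (simp add: j_def of_nat_diff)
        moreover have "t / d \<le> 1 / d" using p V(2) by (intro divide_right_mono) auto
        ultimately show ?thesis using J(1) by linarith
      qed (use fl in \<open>simp add: j_def\<close>)
      ultimately have "t \<in> {real j * d .. (real j + 1) * d}" using V(2) by (simp add: field_simps)
      then have "p \<in> W (i * J + j)" using p i jJ by (simp add: W_def)
      moreover have "i * J + j < m * J"
      proof -
        have "i * J + j < (i + 1) * J" using jJ by simp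
        also have "\<dots> \<le> m * J" using i by (intro mult_right_mono) auto
        finally show ?thesis .
      qed
      ultimately show "p \<in> (\<Union>k<m * J. W k)" by blast
    qed
    show "0 < 2 * d" using V by simp
    show "\<forall>k<m * J. \<forall>p\<in>W k. \<forall>q\<in>W k. dist p q \<le> 2 * d"
    proof (intro allI impI ballI)
      fix k p q assume k: "k < m * J" and "p \<in> W k" "q \<in> W k"
      moreover obtain x t x' t' where xt: "p = (x, t)" "q = (x', t')" by (cases p, cases q)
      ultimately have pq: "p = (x, t)" "q = (x', t')" "x \<in> V (k div J)" "x' \<in> V (k div J)"
        "t \<in> {real (k mod J) * d .. (real (k mod J) + 1) * d}" "t' \<in> {real (k mod J) * d .. (real (k mod J) + 1) * d}"
        unfolding W_def by simp_all
      have "k div J < m" using k J(3) by (simp add: less_mult_imp_div_less)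
      then have "dist x x' \<le> d" using V(5) pq by blast
      moreover have "dist t t' \<le> d" using pq by (auto simp: dist_real_def algebra_simps)
      ultimately show "dist p q \<le> 2 * d" using dist_Pair_le[of x t x' t'] pq by simp
    qed
    have "real (m * J) * (2 * d) powr s \<le> real m * (2 / d) * (2 * d) powr s"
      using J(2) unfolding of_nat_mult by (intro mult_right_mono mult_left_mono) auto
    also have "\<dots> = real m * d powr (s - 1) * 2 powr (s + 1)"
    proof -
      have "(2 * d) powr s = 2 powr s * d powr s" using V(2) by (simp add: powr_mult)
      moreover have "d powr (s - 1) = d powr s / d" using V(2) by (simp add: powr_diff)
      moreover have "2 powr (s + 1) = 2 powr s * (2::real)" by (simp add: powr_add)
      ultimately show ?thesis by simp
    qed
    also have "\<dots> < \<epsilon>" using V(4) by (simp add: pos_less_divide_eq)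
    finally show "real (m * J) * (2 * d) powr s < \<epsilon>" .
  qed
qed (use s in auto)

lemma interval_not_hausdorff_1_null:
  fixes a b :: real
  assumes "a < b"
  shows "hausdorff_measure 1 {a..b} \<noteq> 0"
proof (rule mass_distribution[of 1 2 "{a..b}" id "{a..b}"])
  fix U :: "real set" assume U: "bounded U" "U \<noteq> {}"
  then obtain u where u: "u \<in> U" by blast
  have "U \<subseteq> {u - diameter U..u + diameter U}"
  proof
    fix v assume "v \<in> U"
    then have "\<bar>v - u\<bar> \<le> diameter U" using diameter_bounded_bound[OF U(1) _ u] by (simp add: dist_real_def)
    then show "v \<in> {u - diameter U..u + diameter U}" by auto
  qed
  then show "\<exists>V\<in>sets lborel. id ` U \<subseteq> V \<and> emeasure lborel V \<le> ennreal (2 * diameter U powr 1)"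
    using diameter_ge_0[OF U(1)] by (intro bexI[of _ "{u - diameter U..u + diameter U}"]) auto
qed (use assms in auto)

definition stair_coeff :: "real \<Rightarrow> nat \<Rightarrow> real" where
  "stair_coeff \<rho> m = \<rho>^m / ((real m + 1) * (real m + 2))"

text \<open>
A strictly increasing function with a jump at every dyadic rational: the term with index \<open>m\<close> jumps by
\<open>stair_coeff \<rho> m\<close> at all multiples of \<open>1 / 2^m\<close>. The closure of its range is a Cantor set whose gaps come from
these jumps; the \<open>2^n\<close> dyadic cells of level \<open>n\<close> are mapped into intervals of length less than \<open>\<rho>^n\<close>. The
quadratic denominators make the series converge for \<open>\<rho> = 1/2\<close> as well, and since they are
subexponential they do not influence the dimension.
\<close>

definition stair :: "real \<Rightarrow> real \<Rightarrow> real" where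
  "stair \<rho> y = (\<Sum>m. stair_coeff \<rho> m * of_int \<lfloor>2^m * y\<rfloor>)"

lemma telescoping_reciprocals: "(\<lambda>k. 1 / ((real (k + n) + 1) * (real (k + n) + 2))) sums (1 / (real n + 1))"
proof -
  have "(\<lambda>k. 1 / (real (k + n) + 1)) \<longlonglongrightarrow> 0" by real_asymp
  then have "(\<lambda>k. 1 / (real (k + n) + 1) - 1 / (real (Suc k + n) + 1)) sums (1 / (real (0 + n) + 1) - 0)"
    by (rule telescope_sums')
  moreover have "1 / (real (k + n) + 1) - 1 / (real (Suc k + n) + 1) = 1 / ((real (k + n) + 1) * (real (k + n) + 2))" for k
    by (simp add: divide_simps)
  ultimately show ?thesis by simp
qed

context
  fixes \<rho> :: real
  assumes \<rho>: "0 < \<rho>" "\<rho> \<le> 1/2"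
begin

lemma stair_coeff_pos: "0 < stair_coeff \<rho> m"
  using \<rho> by (simp add: stair_coeff_def)

lemma stair_coeff_le: "n \<le> m \<Longrightarrow> stair_coeff \<rho> m * 2^(m - n) \<le> \<rho>^n * (1 / ((real m + 1) * (real m + 2)))"
proof -
  assume "n \<le> m"
  then obtain k where k: "m = n + k" using le_Suc_ex by blast
  have "\<rho>^m * 2^(m - n) = \<rho>^n * (2 * \<rho>)^(m - n)" unfolding k by (simp add: power_add power_mult_distrib)
  also have "\<dots> \<le> \<rho>^n * 1" using \<rho> by (intro mult_left_mono power_le_one) auto
  finally have "\<rho>^m * 2^(m - n) / ((real m + 1) * (real m + 2)) \<le> \<rho>^n / ((real m + 1) * (real m + 2))"
    by (intro divide_right_mono) auto
  then show ?thesis by (simp add: stair_coeff_def)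
qed

lemma stair_summand_bounds:
  fixes y :: real
  assumes "0 \<le> y" "y < 1"
  shows "0 \<le> stair_coeff \<rho> m * of_int \<lfloor>2^m * y\<rfloor>" "stair_coeff \<rho> m * of_int \<lfloor>2^m * y\<rfloor> \<le> 1 / ((real m + 1) * (real m + 2))"
proof -
  show "0 \<le> stair_coeff \<rho> m * of_int \<lfloor>2^m * y\<rfloor>" using stair_coeff_pos[of m] assms by simp
  have "2^m * y \<le> 2^m * 1" using assms by (intro mult_left_mono) auto
  then have "of_int \<lfloor>2^m * y\<rfloor> \<le> (2::real)^m" using of_int_floor_le[of "2^m * y"] by linarith
  then have "stair_coeff \<rho> m * of_int \<lfloor>2^m * y\<rfloor> \<le> stair_coeff \<rho> m * 2^m" using stair_coeff_pos[of m] by (intro mult_left_mono) auto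
  then show "stair_coeff \<rho> m * of_int \<lfloor>2^m * y\<rfloor> \<le> 1 / ((real m + 1) * (real m + 2))"
    using stair_coeff_le[of 0 m] by simp
qed

lemma reciprocals_summable: "summable (\<lambda>m. 1 / ((real m + 1) * (real m + 2)))"
  and reciprocals_suminf: "(\<Sum>m. 1 / ((real m + 1) * (real m + 2))) = 1"
proof -
  have "(\<lambda>m. 1 / ((real m + 1) * (real m + 2))) sums 1"
    using telescoping_reciprocals[of 0] unfolding add_0_right by simp
  then show "summable (\<lambda>m. 1 / ((real m + 1) * (real m + 2)))" "(\<Sum>m. 1 / ((real m + 1) * (real m + 2))) = 1"
    by (rule sums_summable, rule sums_unique[symmetric])
qed

lemma stair_summable:
  fixes y :: real
  assumes y: "0 \<le> y" "y < 1"
  shows "summable (\<lambda>m. stair_coeff \<rho> m * of_int \<lfloor>2^m * y\<rfloor>)"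
proof (rule summable_comparison_test'[OF reciprocals_summable, of 0])
  fix m :: nat
  show "norm (stair_coeff \<rho> m * of_int \<lfloor>2^m * y\<rfloor>) \<le> 1 / ((real m + 1) * (real m + 2))"
    unfolding real_norm_def abs_of_nonneg[OF stair_summand_bounds(1)[OF y]] by (rule stair_summand_bounds(2)[OF y])
qed

lemma stair_range:
  assumes y: "0 \<le> y" "y < 1"
  shows "stair \<rho> y \<in> {0..1}"
proof -
  have "stair \<rho> y \<le> (\<Sum>m. 1 / ((real m + 1) * (real m + 2)))" unfolding stair_def
    by (rule suminf_le[OF stair_summand_bounds(2)[OF y] stair_summable[OF y] reciprocals_summable])
  then have "stair \<rho> y \<le> 1" unfolding reciprocals_suminf .
  moreover have "0 \<le> stair \<rho> y" unfolding stair_def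
    by (rule suminf_nonneg[OF stair_summable[OF y] stair_summand_bounds(1)[OF y]])
  ultimately show ?thesis by simp
qed

text \<open>
Between \<open>x\<close> and \<open>y\<close> there is a multiple of \<open>1 / 2^n\<close>, at which the term of index \<open>n\<close> jumps.
\<close>

lemma stair_gap:
  assumes "0 \<le> x" "y < 1" "1 / 2^n \<le> y - x"
  shows "stair_coeff \<rho> n \<le> stair \<rho> y - stair \<rho> x"
proof -
  have "0 < (1::real) / 2^n" by simp
  then have xy: "x \<le> y" using assms(3) by linarith
  have x: "0 \<le> x" "x < 1" and y: "0 \<le> y" "y < 1" using assms xy by linarith+
  let ?d = "\<lambda>m. stair_coeff \<rho> m * of_int \<lfloor>2^m * y\<rfloor> - stair_coeff \<rho> m * of_int \<lfloor>2^m * x\<rfloor>"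
  have sm: "summable ?d" by (intro summable_diff stair_summable x y)
  have "2^n * (1 / 2^n) \<le> 2^n * (y - x)" using assms(3) by (intro mult_left_mono) auto
  then have "2^n * x + 1 \<le> 2^n * y" by (simp add: right_diff_distrib)
  then have "\<lfloor>2^n * x + 1\<rfloor> \<le> \<lfloor>2^n * y\<rfloor>" by (rule floor_mono)
  then have "\<lfloor>2^n * x\<rfloor> + 1 \<le> \<lfloor>2^n * y\<rfloor>" by simp
  then have "1 \<le> real_of_int (\<lfloor>2^n * y\<rfloor> - \<lfloor>2^n * x\<rfloor>)" by linarith
  then have "stair_coeff \<rho> n * 1 \<le> stair_coeff \<rho> n * real_of_int (\<lfloor>2^n * y\<rfloor> - \<lfloor>2^n * x\<rfloor>)"
    using stair_coeff_pos[of n] by (intro mult_left_mono) auto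
  also have "\<dots> = ?d n" by (simp add: right_diff_distrib)
  also have "\<dots> = sum ?d {n}" by simp
  also have "\<dots> \<le> suminf ?d"
  proof (rule sum_le_suminf[OF sm])
    fix m
    have "2^m * x \<le> 2^m * y" by (rule mult_left_mono[OF xy]) simp
    then have "real_of_int \<lfloor>2^m * x\<rfloor> \<le> real_of_int \<lfloor>2^m * y\<rfloor>" unfolding of_int_le_iff by (rule floor_mono)
    from mult_left_mono[OF this less_imp_le[OF stair_coeff_pos[of m]]] show "0 \<le> ?d m" by linarith
  qed simp
  also have "\<dots> = stair \<rho> y - stair \<rho> x"
    unfolding stair_def by (rule suminf_diff[OF stair_summable[OF y] stair_summable[OF x], symmetric])
  finally show ?thesis by (simp only: mult_1_right)
qed

text \<open>
Within a cell of level \<open>n\<close> the terms up to \<open>n\<close> are constant, and the term of index \<open>m\<close> makes at most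
\<open>2^(m - n)\<close> jumps.
\<close>

lemma stair_same_cell:
  assumes x: "0 \<le> x" "x < 1" and y: "0 \<le> y" "y < 1" and cell: "\<lfloor>2^n * x\<rfloor> = \<lfloor>2^n * y\<rfloor>"
  shows "\<bar>stair \<rho> x - stair \<rho> y\<bar> \<le> \<rho>^n / (real n + 2)"
proof -
  let ?d = "\<lambda>m. stair_coeff \<rho> m * of_int \<lfloor>2^m * x\<rfloor> - stair_coeff \<rho> m * of_int \<lfloor>2^m * y\<rfloor>"
  have sm: "summable ?d" by (intro summable_diff stair_summable x y)
  have d0: "?d m = 0" if mn: "m < n + 1" for m
  proof -
    have "\<lfloor>2^m * z\<rfloor> = \<lfloor>2^n * z\<rfloor> div 2^(n - m)" for z :: real
    proof -
      obtain k where k: "n = m + k" using mn le_Suc_ex[of m n] by auto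
      have "2^m * z = 2^n * z / real_of_int (2^k)" unfolding k by (simp add: power_add)
      then have "\<lfloor>2^m * z\<rfloor> = \<lfloor>2^n * z / real_of_int (2^k)\<rfloor>" by (rule arg_cong)
      also have "\<dots> = \<lfloor>2^n * z\<rfloor> div 2^k" by (rule floor_divide_real_eq_div) simp
      finally show ?thesis by (simp add: k)
    qed
    then show ?thesis using cell by simp
  qed
  have dle: "\<bar>?d m\<bar> \<le> \<rho>^n * (1 / ((real m + 1) * (real m + 2)))" if nm: "n + 1 \<le> m" for m
  proof -
    have "of_int \<lfloor>2^n * x\<rfloor> \<le> 2^n * x" "2^n * x < of_int \<lfloor>2^n * x\<rfloor> + 1" "of_int \<lfloor>2^n * y\<rfloor> \<le> 2^n * y" "2^n * y < of_int \<lfloor>2^n * y\<rfloor> + 1"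
      by (simp_all add: floor_correct)
    then have "\<bar>2^n * x - 2^n * y\<bar> < 1" unfolding cell by linarith
    then have "2^(m - n) * \<bar>2^n * x - 2^n * y\<bar> \<le> 2^(m - n) * 1" by (intro mult_left_mono) auto
    moreover have "2^(m - n) * \<bar>2^n * x - 2^n * y\<bar> = \<bar>2^m * x - 2^m * y\<bar>"
    proof -
      obtain k where k: "m = n + k" using nm le_Suc_ex[of n m] by auto
      have "2^m * x - 2^m * y = 2^(m - n) * (2^n * x - 2^n * y)" unfolding k by (simp add: power_add algebra_simps)
      then show ?thesis by (simp add: abs_mult)
    qed
    ultimately have b: "\<bar>2^m * x - 2^m * y\<bar> \<le> 2^(m - n)" by simp
    have "\<bar>\<lfloor>2^m * x\<rfloor> - \<lfloor>2^m * y\<rfloor>\<bar> \<le> 2^(m - n)"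
    proof -
      have "2^m * x \<le> 2^m * y + of_int (2^(m - n))" "2^m * y \<le> 2^m * x + of_int (2^(m - n))" using b by auto
      then have "\<lfloor>2^m * x\<rfloor> \<le> \<lfloor>2^m * y + of_int (2^(m - n))\<rfloor>" "\<lfloor>2^m * y\<rfloor> \<le> \<lfloor>2^m * x + of_int (2^(m - n))\<rfloor>"
        by (intro floor_mono; simp)+
      then show ?thesis unfolding floor_add_int[symmetric] by linarith
    qed
    then have f: "\<bar>real_of_int (\<lfloor>2^m * x\<rfloor> - \<lfloor>2^m * y\<rfloor>)\<bar> \<le> 2^(m - n)"
      by (metis of_int_abs of_int_le_iff of_int_numeral of_int_power)
    have "\<bar>?d m\<bar> = stair_coeff \<rho> m * \<bar>real_of_int (\<lfloor>2^m * x\<rfloor> - \<lfloor>2^m * y\<rfloor>)\<bar>"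
    proof -
      have "?d m = stair_coeff \<rho> m * real_of_int (\<lfloor>2^m * x\<rfloor> - \<lfloor>2^m * y\<rfloor>)" by (simp add: right_diff_distrib)
      then show ?thesis using stair_coeff_pos[of m] by (simp add: abs_mult)
    qed
    also have "\<dots> \<le> stair_coeff \<rho> m * 2^(m - n)" using f stair_coeff_pos[of m] by (intro mult_left_mono) auto
    also have "\<dots> \<le> \<rho>^n * (1 / ((real m + 1) * (real m + 2)))" using that by (intro stair_coeff_le) auto
    finally show ?thesis .
  qed
  have "stair \<rho> x - stair \<rho> y = suminf ?d"
    unfolding stair_def by (rule suminf_diff[OF stair_summable[OF x] stair_summable[OF y]])
  also have "\<dots> = (\<Sum>k. ?d (k + (n + 1))) + sum ?d {..<n + 1}" by (rule suminf_split_initial_segment[OF sm])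
  also have "sum ?d {..<n + 1} = 0" using d0 by (intro sum.neutral) auto
  finally have eq: "stair \<rho> x - stair \<rho> y = (\<Sum>k. ?d (k + (n + 1)))" by simp
  have ts: "(\<lambda>k. \<rho>^n * (1 / ((real (k + (n + 1)) + 1) * (real (k + (n + 1)) + 2)))) sums (\<rho>^n * (1 / (real (n + 1) + 1)))"
    by (intro sums_mult telescoping_reciprocals)
  have "norm (\<Sum>k. ?d (k + (n + 1))) \<le> (\<Sum>k. \<rho>^n * (1 / ((real (k + (n + 1)) + 1) * (real (k + (n + 1)) + 2))))"
  proof (rule norm_suminf_le[OF _ sums_summable[OF ts]])
    fix k
    show "norm (?d (k + (n + 1))) \<le> \<rho>^n * (1 / ((real (k + (n + 1)) + 1) * (real (k + (n + 1)) + 2)))"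
      unfolding real_norm_def by (rule dle) simp
  qed
  also have "\<dots> = \<rho>^n * (1 / (real (n + 1) + 1))" using sums_unique[OF ts] by simp
  finally show ?thesis unfolding eq real_norm_def by (simp add: add.commute)
qed

end

text \<open>
The ratio for which \<open>2^n\<close> intervals of length \<open>\<rho>^n\<close> have dimension \<open>\<alpha>\<close>.
\<close>

lemma stair_ratio_bounds:
  fixes \<alpha> :: real
  assumes "0 < \<alpha>" "\<alpha> \<le> 1"
  shows "0 < 2 powr (- 1 / \<alpha>)" "2 powr (- 1 / \<alpha>) \<le> 1/2"
proof -
  have "1 \<le> 1 / \<alpha>" using assms by simp
  then have "- 1 / \<alpha> \<le> - 1" by simp
  then have "2 powr (- 1 / \<alpha>) \<le> 2 powr (- 1 :: real)" by (intro powr_mono) auto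
  then show "2 powr (- 1 / \<alpha>) \<le> 1/2" by (simp add: powr_minus_divide)
qed simp

text \<open>
The inverse of \<open>stair \<rho>\<close> is Hoelder continuous with every exponent below \<open>\<alpha>\<close>: points at distance about
\<open>1 / 2^n\<close> are separated by a jump of size at least \<open>stair_coeff \<rho> n\<close>.
\<close>

lemma stair_holder:
  assumes \<alpha>: "0 < \<alpha>" "\<alpha> \<le> 1" and \<tau>: "0 < \<tau>" "\<tau> < \<alpha>"
  defines "\<rho> \<equiv> 2 powr (- 1 / \<alpha>)"
  obtains c where "0 \<le> c" "\<And>x y. x \<in> {0..<1} \<Longrightarrow> y \<in> {0..<1} \<Longrightarrow> \<bar>x - y\<bar> \<le> c * \<bar>stair \<rho> x - stair \<rho> y\<bar> powr \<tau>"
proof -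
  have \<rho>: "0 < \<rho>" "\<rho> \<le> 1/2"
    unfolding \<rho>_def using stair_ratio_bounds[OF \<alpha>] by blast+
  define \<delta> where "\<delta> = 1 - \<tau> / \<alpha>"
  have \<delta>: "0 < \<delta>" using \<alpha> \<tau> by (simp add: \<delta>_def)
  have bound: "(1/2)^n \<le> (2 powr (- \<delta> * real n) * ((real n + 1) * (real n + 2))) * stair_coeff \<rho> n powr \<tau>" for n
  proof -
    define w where "w = (real n + 1) * (real n + 2)"
    have "1 * 1 \<le> (real n + 1) * (real n + 2)" by (intro mult_mono) auto
    then have w: "1 \<le> w" by (simp add: w_def)
    have "w powr \<tau> \<le> w powr 1" using w \<tau> \<alpha> by (intro powr_mono) auto
    then have w\<tau>: "w powr \<tau> \<le> w" "0 < w powr \<tau>" using w by auto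
    have "\<rho>^n = 2 powr (- real n / \<alpha>)" using \<alpha> by (simp add: \<rho>_def powr_power)
    then have "stair_coeff \<rho> n powr \<tau> = (2 powr (- real n / \<alpha>)) powr \<tau> / w powr \<tau>"
      using w by (simp add: stair_coeff_def powr_divide flip: w_def)
    then have sc: "stair_coeff \<rho> n powr \<tau> = 2 powr (- real n * \<tau> / \<alpha>) / w powr \<tau>" by (simp add: powr_powr)
    have "(1/2)^n = 2 powr (- real n)" by (simp add: powr_minus powr_realpow inverse_eq_divide power_divide)
    also have "- real n = - \<delta> * real n + - real n * \<tau> / \<alpha>" by (simp add: \<delta>_def algebra_simps)
    also have "2 powr \<dots> = 2 powr (- \<delta> * real n) * 2 powr (- real n * \<tau> / \<alpha>) * 1" by (simp only: powr_add mult_1_right)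
    also have "\<dots> \<le> 2 powr (- \<delta> * real n) * 2 powr (- real n * \<tau> / \<alpha>) * (w / w powr \<tau>)"
      using w\<tau> by (intro mult_left_mono) (auto simp: le_divide_eq_1)
    also have "\<dots> = (2 powr (- \<delta> * real n) * w) * stair_coeff \<rho> n powr \<tau>" by (simp add: sc)
    finally show ?thesis unfolding w_def .
  qed
  have "(\<lambda>n. 2 powr (- \<delta> * real n) * ((real n + 1) * (real n + 2))) \<longlonglongrightarrow> 0" using \<delta> by real_asymp
  then have "Bseq (\<lambda>n. 2 powr (- \<delta> * real n) * ((real n + 1) * (real n + 2)))"
    by (intro convergent_imp_Bseq convergentI)
  then obtain c where c: "0 < c" "\<And>n. norm (2 powr (- \<delta> * real n) * ((real n + 1) * (real n + 2))) \<le> c"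
    unfolding Bseq_def by blast
  have half: "(1/2)^n \<le> c * stair_coeff \<rho> n powr \<tau>" for n
  proof -
    have "2 powr (- \<delta> * real n) * ((real n + 1) * (real n + 2)) \<le> c" using c(2)[of n] by (simp only: real_norm_def)
    from mult_right_mono[OF this, of "stair_coeff \<rho> n powr \<tau>"] show ?thesis using bound[of n] by simp
  qed
  have less: "\<bar>x - y\<bar> \<le> (2 * c) * \<bar>stair \<rho> x - stair \<rho> y\<bar> powr \<tau>" if xy: "0 \<le> x" "x < y" "y < 1" for x y
  proof -
    define n where "n = (LEAST n. (1/2)^n \<le> y - x)"
    obtain n0 where "(1/2)^n0 < y - x" using real_arch_pow_inv[of "y - x" "1/2"] xy by auto
    then have n: "(1/2)^n \<le> y - x"
      using LeastI[of "\<lambda>n. (1/2)^n \<le> y - x" n0] unfolding n_def by linarith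
    have "n \<noteq> 0" using n xy by (cases n) auto
    then obtain k where k: "n = Suc k" using not0_implies_Suc by blast
    have "\<not> (1/2)^k \<le> y - x" using not_less_Least[of k "\<lambda>n. (1/2)^n \<le> y - x"] k unfolding n_def by simp
    then have up: "y - x \<le> 2 * (1/2)^n" by (simp add: k)
    have "1 / 2^n \<le> y - x" using n by (simp add: power_one_over)
    then have "stair_coeff \<rho> n \<le> stair \<rho> y - stair \<rho> x" using xy by (intro stair_gap[OF \<rho>]) auto
    then have "stair_coeff \<rho> n powr \<tau> \<le> \<bar>stair \<rho> x - stair \<rho> y\<bar> powr \<tau>"
      using stair_coeff_pos[OF \<rho>, of n] \<tau> by (intro powr_mono2) auto
    then have "c * stair_coeff \<rho> n powr \<tau> \<le> c * \<bar>stair \<rho> x - stair \<rho> y\<bar> powr \<tau>" using c by (intro mult_left_mono) auto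
    then show ?thesis using up half[of n] xy by linarith
  qed
  show thesis
  proof (rule that[of "2 * c"])
    show "0 \<le> 2 * c" using c by simp
    fix x y :: real assume xy: "x \<in> {0..<1}" "y \<in> {0..<1}"
    consider "x < y" | "y < x" | "x = y" by linarith
    then show "\<bar>x - y\<bar> \<le> 2 * c * \<bar>stair \<rho> x - stair \<rho> y\<bar> powr \<tau>"
    proof cases
      case 2
      then show ?thesis using less[of y x] xy by (simp add: abs_minus_commute)
    qed (use less[of x y] xy c in auto)
  qed
qed

text \<open>
The images of the \<open>2^n\<close> cells are shorter than \<open>\<rho>^n\<close> by the factor \<open>real n + 2\<close>. This factor gives
thinness also for the exponent \<open>\<tau> = \<alpha>\<close>; for \<open>\<alpha> = 1\<close> it makes the set null, hence nowhere dense.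
\<close>

lemma stair_thin_covers:
  assumes \<alpha>: "0 < \<alpha>" "\<alpha> \<le> 1" and \<tau>: "\<alpha> \<le> \<tau>"
  defines "\<rho> \<equiv> 2 powr (- 1 / \<alpha>)"
  shows "thin_covers \<tau> (closure (stair \<rho> ` {0..<1}))"
  unfolding thin_covers_def
proof (intro allI impI)
  fix \<epsilon> :: real assume \<epsilon>: "0 < \<epsilon>"
  have \<rho>: "0 < \<rho>" "\<rho> \<le> 1/2"
    unfolding \<rho>_def using stair_ratio_bounds[OF \<alpha>] by blast+
  have "(\<lambda>n. (real n + 2) powr (- \<tau>)) \<longlonglongrightarrow> 0" using \<alpha> \<tau> by real_asymp
  then have "\<forall>\<^sub>F n in sequentially. (real n + 2) powr (- \<tau>) < \<epsilon>" using \<epsilon> by (rule order_tendstoD)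
  then obtain n where n: "(real n + 2) powr (- \<tau>) < \<epsilon>" unfolding eventually_sequentially by blast
  define R where "R = \<rho>^n / (real n + 2)"
  define S where "S i = stair \<rho> ` {y. 0 \<le> y \<and> y < 1 \<and> \<lfloor>2^n * y\<rfloor> = int i}" for i :: nat
  have R: "0 < R" "R \<le> 1"
  proof -
    show "0 < R" using \<rho> by (simp add: R_def)
    have "\<rho>^n \<le> 1" using \<rho> by (intro power_le_one) auto
    then show "R \<le> 1" by (simp add: R_def divide_le_eq_1)
  qed
  have SR: "dist x y \<le> R" if "x \<in> S i" "y \<in> S i" for x y i
    using that stair_same_cell[OF \<rho>, of _ _ n] by (auto simp: S_def R_def dist_real_def)
  have cov: "closure (stair \<rho> ` {0..<1}) \<subseteq> (\<Union>i<2^n. closure (S i))"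
  proof -
    have "stair \<rho> ` {0..<1} \<subseteq> (\<Union>i<2^n. S i)"
    proof
      fix v assume "v \<in> stair \<rho> ` {0..<1}"
      then obtain y where y: "0 \<le> y" "y < 1" "v = stair \<rho> y" by auto
      define i where "i = nat \<lfloor>2^n * y\<rfloor>"
      have i: "\<lfloor>2^n * y\<rfloor> = int i" using y by (simp add: i_def)
      have "2^n * y < 2^n * 1" using y by (intro mult_strict_left_mono) auto
      then have "real_of_int \<lfloor>2^n * y\<rfloor> < 2^n" using of_int_floor_le[of "2^n * y"] by linarith
      then have "real i < 2^n" using i by simp
      then have "i < 2^n" by (metis of_nat_less_iff of_nat_numeral of_nat_power)
      then show "v \<in> (\<Union>i<2^n. S i)" using y i by (auto simp: S_def)
    qed
    also have "\<dots> \<subseteq> (\<Union>i<2^n. closure (S i))" using closure_subset by (intro UN_mono) auto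
    finally show ?thesis by (intro closure_minimal closed_UN) auto
  qed
  have dR: "dist x y \<le> R" if "x \<in> closure (S i)" "y \<in> closure (S i)" for x y i
  proof -
    have b: "bounded (S i)" using SR by (rule bounded_if_dist_le)
    have "dist x y \<le> diameter (closure (S i))" using b that by (intro diameter_bounded_bound bounded_closure)
    also have "\<dots> = diameter (S i)" using b by (rule diameter_closure)
    also have "\<dots> \<le> R" using SR R by (intro diameter_le_dist) auto
    finally show ?thesis .
  qed
  have "real (2^n) * R powr \<tau> < \<epsilon>"
  proof -
    have "\<rho>^n = 2 powr (- real n / \<alpha>)" using \<alpha> by (simp add: \<rho>_def powr_power)
    then have Rp: "R powr \<tau> = 2 powr (- real n * \<tau> / \<alpha>) * (real n + 2) powr (- \<tau>)"
      
    proof -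
      assume "\<rho>^n = 2 powr (- real n / \<alpha>)"
      then have "R = 2 powr (- real n / \<alpha>) * (real n + 2) powr (- 1)" by (simp add: R_def powr_minus_divide)
      then have "R powr \<tau> = (2 powr (- real n / \<alpha>)) powr \<tau> * ((real n + 2) powr (- 1)) powr \<tau>"
        by (simp only: powr_mult powr_ge_zero)
      then show ?thesis unfolding powr_powr by simp
    qed
    have "1 \<le> \<tau> / \<alpha>" using \<alpha> \<tau> by simp
    then have "real n * 1 \<le> real n * (\<tau> / \<alpha>)" by (intro mult_left_mono) auto
    then have "2 powr (- real n * \<tau> / \<alpha>) \<le> 2 powr (- real n)" by (intro powr_mono) auto
    then have "2^n * 2 powr (- real n * \<tau> / \<alpha>) \<le> 2^n * 2 powr (- real n)" by (intro mult_left_mono) auto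
    also have "\<dots> = 1" by (simp add: powr_minus powr_realpow)
    finally have "2^n * 2 powr (- real n * \<tau> / \<alpha>) * (real n + 2) powr (- \<tau>) \<le> 1 * (real n + 2) powr (- \<tau>)"
      by (intro mult_right_mono) auto
    moreover have "real (2^n) * R powr \<tau> = 2^n * 2 powr (- real n * \<tau> / \<alpha>) * (real n + 2) powr (- \<tau>)"
      unfolding Rp by simp
    ultimately show ?thesis using n by linarith
  qed
  then show "\<exists>(m::nat) d V. closure (stair \<rho> ` {0..<1}) \<subseteq> (\<Union>i<m. V i) \<and> 0 < d \<and> d \<le> 1 \<and> real m * d powr \<tau> < \<epsilon> \<and>
        (\<forall>i<m. \<forall>x\<in>V i. \<forall>y\<in>V i. dist x y \<le> d)"
    using cov R dR by - (rule exI[of _ "2^n"], rule exI[of _ R], rule exI[of _ "\<lambda>i. closure (S i)"], blast)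
qed

section \<open>Combs with a boundary of prescribed dimension\<close>

text \<open>
The comb over \<open>C = cis ` X\<close>. Thinness with exponent 1 makes \<open>X\<close> a null set, so that \<open>X\<close> contains no
interval and the centres of the teeth can be placed outside \<open>C\<close>, arbitrarily close to its points.
\<close>

theorem nevanlinna_comb_over_thin_set:
  fixes X :: "real set"
  assumes X: "closed X" "X \<noteq> {}" "X \<subseteq> {0..1}" and thin: "thin_covers 1 X"
  obtains G :: "complex set" and Q :: "real \<Rightarrow> real \<Rightarrow> complex" where "nevanlinna_domain G"
    "\<And>s. 1 < s \<Longrightarrow> thin_covers (s - 1) X \<Longrightarrow> hausdorff_measure s (frontier G) = 0"
    "\<And>x t. x \<in> X \<Longrightarrow> t \<in> {0..1} \<Longrightarrow> Q x t \<in> frontier G"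
    "\<And>x x' t t'. \<lbrakk>x \<in> X; x' \<in> X; t \<in> {0..1}; t' \<in> {0..1}\<rbrakk> \<Longrightarrow>
       \<bar>x - x'\<bar> / 4 \<le> dist (Q x t) (Q x' t') \<and> \<bar>t - t'\<bar> / 2 \<le> dist (Q x t) (Q x' t')"
proof -
  have near1: "\<bar>x - x'\<bar> \<le> 1" if "x \<in> X" "x' \<in> X" for x x'
    using X(3) that by (auto simp: abs_le_iff subset_iff) (smt (verit))+
  define C where "C = cis ` X"
  have "compact X" using X bounded_subset[OF bounded_closed_interval[of 0 1]] by (simp add: compact_eq_bounded_closed)
  then have C: "compact C" unfolding C_def by (intro compact_continuous_image) (auto intro!: continuous_intros)
  have null: "hausdorff_measure 1 X = 0" using thin by (rule thin_covers_null) simp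
  have dense: "\<exists>z. norm z = 1 \<and> z \<notin> C \<and> dist z \<xi> < \<delta>" if \<xi>: "\<xi> \<in> C" and \<delta>: "0 < \<delta>" for \<xi> \<delta>
  proof -
    obtain x where x: "x \<in> X" "\<xi> = cis x" using \<xi> by (auto simp: C_def)
    define h where "h = min 1 \<delta> / 2"
    have h: "0 < h" "h \<le> 1/2" "h < \<delta>" using \<delta> by (auto simp: h_def)
    have "\<not> {x..x + h} \<subseteq> X"
    proof
      assume "{x..x + h} \<subseteq> X"
      then have "hausdorff_measure 1 {x..x + h} = 0" by (rule hausdorff_null_mono[OF null])
      then show False using interval_not_hausdorff_1_null[of x "x + h"] h by simp
    qed
    then obtain y where "y \<in> {x..x + h}" "y \<notin> X" by blast
    then have y: "x \<le> y" "y \<le> x + h" "y \<notin> X" by auto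
    have "cis y \<notin> C"
    proof
      assume "cis y \<in> C"
      then obtain x' where x': "x' \<in> X" "cis x' = cis y" by (auto simp: C_def)
      have "0 \<le> x" "x \<le> 1" "0 \<le> x'" "x' \<le> 1" using X(3) x x' by auto
      then have ab: "0 \<le> y" "y < 2 * pi" "0 \<le> x'" "x' < 2 * pi" using y h pi_ge_two by linarith+
      have "x' = y"
      proof -
        have "Arg2pi (cis y) = y" "Arg2pi (cis x') = x'"
          using ab by (auto intro!: Arg2pi_unique[where r = 1] simp: cis_conv_exp)
        then show ?thesis using x' by simp
      qed
      then show False using x' y by simp
    qed
    moreover have "dist (cis y) \<xi> < \<delta>"
      using dist_cis_le[of y x] y h x by simp
    ultimately show ?thesis by (intro exI[of _ "cis y"]) simp
  qed
  obtain G and P :: "complex \<Rightarrow> real \<Rightarrow> complex" and f and A :: "nat \<Rightarrow> complex set" where G: "nevanlinna_domain G"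
    "(\<lambda>(\<xi>, t). P \<xi> t) ` (C \<times> {0..1}) \<subseteq> frontier G"
    "frontier G \<subseteq> (\<lambda>(\<xi>, t). P \<xi> t) ` (C \<times> {0..1}) \<union> (\<Union>n. f ` A n)"
    "\<And>n. A n \<subseteq> sphere 0 1" "\<And>n. \<exists>L. L-lipschitz_on (A n) f"
    "\<And>\<xi> \<xi>' t t'. \<lbrakk>\<xi> \<in> C; \<xi>' \<in> C; t \<in> {0..1}; t' \<in> {0..1}\<rbrakk> \<Longrightarrow>
       norm (\<xi> - \<xi>') / 2 \<le> dist (P \<xi> t) (P \<xi>' t') \<and> \<bar>t - t'\<bar> / 2 \<le> dist (P \<xi> t) (P \<xi>' t') \<and>
       dist (P \<xi> t) (P \<xi>' t') \<le> 3 * (norm (\<xi> - \<xi>') + \<bar>t - t'\<bar>)"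
  proof (rule nevanlinna_comb_exists[OF C])
    show "C \<noteq> {}" using X by (simp add: C_def)
    show "norm \<xi> = 1" if "\<xi> \<in> C" for \<xi> using that by (auto simp: C_def)
  qed (rule dense, assumption+, rule that, assumption+)
  define Q where "Q x t = P (cis x) t" for x t
  have Qb: "\<bar>x - x'\<bar> / 4 \<le> dist (Q x t) (Q x' t')" "\<bar>t - t'\<bar> / 2 \<le> dist (Q x t) (Q x' t')"
     "dist (Q x t) (Q x' t') \<le> 3 * (\<bar>x - x'\<bar> + \<bar>t - t'\<bar>)"
    if xt: "x \<in> X" "x' \<in> X" "t \<in> {0..1}" "t' \<in> {0..1}" for x x' t t'
  proof -
    have "cis x \<in> C" "cis x' \<in> C" using xt by (auto simp: C_def)
    note g = G(6)[OF this xt(3,4)] dist_cis_le[of x x'] dist_cis_ge[OF near1[OF xt(1,2)]]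
    show "\<bar>x - x'\<bar> / 4 \<le> dist (Q x t) (Q x' t')" "\<bar>t - t'\<bar> / 2 \<le> dist (Q x t) (Q x' t')"
      using g unfolding Q_def dist_norm[of "cis x"] by linarith+
    have "dist (Q x t) (Q x' t') \<le> 3 * (norm (cis x - cis x') + \<bar>t - t'\<bar>)" using g unfolding Q_def by blast
    also have "\<dots> \<le> 3 * (\<bar>x - x'\<bar> + \<bar>t - t'\<bar>)"
      using dist_cis_le[of x x'] by (intro mult_left_mono add_mono) (simp_all add: dist_norm)
    finally show "dist (Q x t) (Q x' t') \<le> 3 * (\<bar>x - x'\<bar> + \<bar>t - t'\<bar>)" .
  qed
  show thesis
  proof (rule that[of G Q, OF G(1)])
    fix s :: real assume s: "1 < s" "thin_covers (s - 1) X"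
    have "hausdorff_measure s ((\<lambda>(x, t). Q x t) ` (X \<times> {0..1})) = 0"
    proof (rule hausdorff_null_lipschitz_image)
      show "hausdorff_measure s (X \<times> {0..1::real}) = 0" using s(2,1) by (rule thin_covers_strip_null)
      show "6-lipschitz_on (X \<times> {0..1}) (\<lambda>(x, t). Q x t)"
      proof (rule lipschitz_onI)
        fix p q assume p: "p \<in> X \<times> {0..1::real}" and q: "q \<in> X \<times> {0..1::real}"
        have "dist (Q (fst p) (snd p)) (Q (fst q) (snd q)) \<le> 3 * (dist (fst p) (fst q) + dist (snd p) (snd q))"
          unfolding dist_real_def using p q by (intro Qb(3)) auto
        then show "dist ((\<lambda>(x, t). Q x t) p) ((\<lambda>(x, t). Q x t) q) \<le> 6 * dist p q"
          using dist_fst_le[of p q] dist_snd_le[of p q] by (simp add: case_prod_beta)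
      qed simp
    qed (use s in simp)
    moreover have "(\<lambda>(\<xi>, t). P \<xi> t) ` (C \<times> {0..1}) = (\<lambda>(x, t). Q x t) ` (X \<times> {0..1})"
      by (force simp: C_def Q_def)
    moreover have "hausdorff_measure s (f ` A n) = 0" for n
    proof -
      have "sphere 0 1 \<subseteq> cis ` {0..8}"
      proof
        fix z :: complex assume "z \<in> sphere 0 1"
        then have "z = cis (Arg2pi z)" using Arg2pi_eq[of z] by (simp add: cis_conv_exp)
        moreover have "Arg2pi z \<in> {0..8}" using Arg2pi_ge_0[of z] Arg2pi_lt_2pi[of z] pi_less_4 by simp
        ultimately show "z \<in> cis ` {0..8}" by blast
      qed
      then have "A n \<subseteq> cis ` {0..8}" using G(4) by blast
      moreover have "hausdorff_measure s (cis ` {0..8}) = 0"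
      proof (rule hausdorff_null_lipschitz_image)
        show "hausdorff_measure s {0..8::real} = 0" using s(1) by (rule hausdorff_null_interval)
        show "1-lipschitz_on {0..8} cis" by (rule lipschitz_onI) (simp_all add: dist_cis_le dist_real_def)
      qed (use s in simp)
      ultimately have "hausdorff_measure s (A n) = 0" by (rule hausdorff_null_mono[rotated])
      moreover obtain L where "L-lipschitz_on (A n) f" using G(5) by blast
      ultimately show ?thesis using s by (intro hausdorff_null_lipschitz_image) auto
    qed
    ultimately have "hausdorff_measure s ((\<lambda>(\<xi>, t). P \<xi> t) ` (C \<times> {0..1}) \<union> (\<Union>n. f ` A n)) = 0"
      by (intro hausdorff_null_Un hausdorff_null_UN) simp_all
    then show "hausdorff_measure s (frontier G) = 0" using G(3) by (rule hausdorff_null_mono)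
  next
    fix x t assume "x \<in> X" "t \<in> {0..1::real}"
    then have "(\<lambda>(\<xi>, t). P \<xi> t) (cis x, t) \<in> (\<lambda>(\<xi>, t). P \<xi> t) ` (C \<times> {0..1})" by (intro imageI) (auto simp: C_def)
    then show "Q x t \<in> frontier G" using G(2) by (auto simp: Q_def)
  next
    fix x x' t t' assume "x \<in> X" "x' \<in> X" "t \<in> {0..1::real}" "t' \<in> {0..1::real}"
    then show "\<bar>x - x'\<bar> / 4 \<le> dist (Q x t) (Q x' t') \<and> \<bar>t - t'\<bar> / 2 \<le> dist (Q x t) (Q x' t')"
      by (intro conjI Qb)
  qed
qed

text \<open>
For \<open>\<beta> > 1\<close> the set \<open>X\<close> is the Cantor set of dimension \<open>\<alpha> = \<beta> - 1\<close>, and the lower bound transports the area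
of the square \<open>D\<close> to the boundary by \<open>q\<close>: a set of diameter \<open>d\<close> in the image comes from a rectangle whose
sides are at most of order \<open>d powr (s - 1)\<close>, by \<open>stair_holder\<close>, and of order \<open>d\<close>, which has area at most of
order \<open>d powr s\<close>.
\<close>

theorem theorem1:
  fixes \<beta> :: real
  assumes "1 \<le> \<beta>" and "\<beta> \<le> 2"
  shows "\<exists>G :: complex set. nevanlinna_domain G \<and> hausdorff_dim (frontier G) = ereal \<beta>"
proof (cases "\<beta> = 1")
  case True
  have pt: "closed {0::real}" "{0::real} \<noteq> {}" "{0::real} \<subseteq> {0..1}" by simp_all
  obtain G :: "complex set" and Q :: "real \<Rightarrow> real \<Rightarrow> complex" where G: "nevanlinna_domain G"
    "\<And>s. 1 < s \<Longrightarrow> thin_covers (s - 1) {0::real} \<Longrightarrow> hausdorff_measure s (frontier G) = 0"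
    "\<And>x t. x \<in> {0::real} \<Longrightarrow> t \<in> {0..1} \<Longrightarrow> Q x t \<in> frontier G"
    "\<And>x x' t t'. \<lbrakk>x \<in> {0::real}; x' \<in> {0}; t \<in> {0..1}; t' \<in> {0..1}\<rbrakk> \<Longrightarrow>
       \<bar>x - x'\<bar> / 4 \<le> dist (Q x t) (Q x' t') \<and> \<bar>t - t'\<bar> / 2 \<le> dist (Q x t) (Q x' t')"
    by (rule nevanlinna_comb_over_thin_set[OF pt thin_covers_singleton[OF zero_less_one]], rule that, assumption+)
  have "hausdorff_dim (frontier G) = ereal \<beta>"
  proof (rule hausdorff_dim_eqI)
    show "hausdorff_measure 1 (frontier G) \<noteq> 0"
      using G(1) by (intro frontier_not_hausdorff_1_null) (auto simp: nevanlinna_domain_def)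
    show "hausdorff_measure s (frontier G) = 0" if "\<beta> < s" for s
    proof -
      have "1 < s" "0 < s - 1" using that True by simp_all
      from G(2)[OF this(1) thin_covers_singleton[OF this(2)]] show ?thesis .
    qed
    show "1 \<le> \<beta>" by (rule assms(1))
    show "hausdorff_measure s (frontier G) \<noteq> 0" if "1 < s" "s < \<beta>" for s using that True by linarith
  qed
  with G(1) show ?thesis by (intro exI[of _ G] conjI)
next
  case False
  define \<alpha> where "\<alpha> = \<beta> - 1"
  have \<alpha>: "0 < \<alpha>" "\<alpha> \<le> 1" using assms False by (auto simp: \<alpha>_def)
  define \<rho> where "\<rho> = 2 powr (- 1 / \<alpha>)"
  have \<rho>: "0 < \<rho>" "\<rho> \<le> 1/2"
    unfolding \<rho>_def using stair_ratio_bounds[OF \<alpha>] by blast+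
  define X where "X = closure (stair \<rho> ` {0..<1})"
  have XI: "stair \<rho> ` {0..<1} \<subseteq> {0..1}"
  proof
    fix v assume "v \<in> stair \<rho> ` {0..<1}"
    then obtain y where "0 \<le> y" "y < 1" "v = stair \<rho> y" by auto
    then show "v \<in> {0..1}" using stair_range[OF \<rho>, of y] by simp
  qed
  have X3: "X \<subseteq> {0..1}" unfolding X_def by (rule closure_minimal[OF XI]) simp
  have "stair \<rho> 0 \<in> X" unfolding X_def using closure_subset[of "stair \<rho> ` {0..<1}"] by (rule subsetD) simp
  then have X2: "X \<noteq> {}" by blast
  have X1: "closed X" unfolding X_def by (rule closed_closure)
  note X = X1 X2 X3
  have inX: "stair \<rho> y \<in> X" if "y \<in> {0..<1}" for y unfolding X_def by (rule subsetD[OF closure_subset imageI[OF that]])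
  have thin: "thin_covers \<tau> X" if "\<alpha> \<le> \<tau>" for \<tau>
    unfolding X_def \<rho>_def using \<alpha> that by (rule stair_thin_covers)
  obtain G :: "complex set" and Q :: "real \<Rightarrow> real \<Rightarrow> complex" where G: "nevanlinna_domain G"
    "\<And>s. 1 < s \<Longrightarrow> thin_covers (s - 1) X \<Longrightarrow> hausdorff_measure s (frontier G) = 0"
    "\<And>x t. x \<in> X \<Longrightarrow> t \<in> {0..1} \<Longrightarrow> Q x t \<in> frontier G"
    "\<And>x x' t t'. \<lbrakk>x \<in> X; x' \<in> X; t \<in> {0..1}; t' \<in> {0..1}\<rbrakk> \<Longrightarrow>
       \<bar>x - x'\<bar> / 4 \<le> dist (Q x t) (Q x' t') \<and> \<bar>t - t'\<bar> / 2 \<le> dist (Q x t) (Q x' t')"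
    by (rule nevanlinna_comb_over_thin_set[OF X thin[OF \<alpha>(2)]], rule that, assumption+)
  have lower: "hausdorff_measure s (frontier G) \<noteq> 0" if s: "1 < s" "s < \<beta>" for s
  proof -
    define \<tau> where "\<tau> = s - 1"
    have \<tau>: "0 < \<tau>" "\<tau> < \<alpha>" using s by (auto simp: \<tau>_def \<alpha>_def)
    obtain c where c: "0 \<le> c" "\<And>x y. x \<in> {0..<1} \<Longrightarrow> y \<in> {0..<1} \<Longrightarrow> \<bar>x - y\<bar> \<le> c * \<bar>stair \<rho> x - stair \<rho> y\<bar> powr \<tau>"
      by (rule stair_holder[OF \<alpha> \<tau>, folded \<rho>_def], rule that, assumption+)
    define D where "D = {0..<1::real} \<times> {0..1::real}"
    define q where "q = (\<lambda>(y, t). Q (stair \<rho> y) t)"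
    have est: "\<bar>fst p - fst p'\<bar> \<le> c * (4 * dist (q p) (q p')) powr \<tau> \<and> \<bar>snd p - snd p'\<bar> \<le> 2 * dist (q p) (q p')"
      if p: "p \<in> D" "p' \<in> D" for p p'
    proof -
      obtain y t y' t' where yt: "p = (y, t)" "p' = (y', t')" by (cases p, cases p')
      have i: "y \<in> {0..<1}" "y' \<in> {0..<1}" "t \<in> {0..1}" "t' \<in> {0..1}" using p by (simp_all add: D_def yt)
      note g = G(4)[OF inX[OF i(1)] inX[OF i(2)] i(3,4)]
      have "\<bar>y - y'\<bar> \<le> c * \<bar>stair \<rho> y - stair \<rho> y'\<bar> powr \<tau>" using i by (intro c(2))
      also have "\<dots> \<le> c * (4 * dist (q p) (q p')) powr \<tau>"
        using g \<tau> c(1) by (intro mult_left_mono powr_mono2) (simp_all add: q_def yt)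
      finally show ?thesis using g by (simp add: q_def yt)
    qed
    have "inj_on q D"
    proof (rule inj_onI)
      fix p p' assume p: "p \<in> D" "p' \<in> D" "q p = q p'"
      then show "p = p'" using est[OF p(1,2)] by (simp add: prod_eq_iff)
    qed
    then have inv: "inv_into D q (q p) = p" if "p \<in> D" for p using that by (rule inv_into_f_f)
    have "hausdorff_measure s (q ` D) \<noteq> 0"
    proof (rule mass_distribution[of s "8 * c * 4 powr \<tau>" "q ` D" "inv_into D q" D])
      fix U assume U: "bounded U" "U \<subseteq> q ` D" "U \<noteq> {}"
      then obtain p0 where p0: "p0 \<in> D" "q p0 \<in> U" by blast
      define d where "d = diameter U"
      have d: "0 \<le> d" using diameter_ge_0[OF U(1)] by (simp add: d_def)
      define r where "r = c * (4 * d) powr \<tau>"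
      define V where "V = {fst p0 - r..fst p0 + r} \<times> {snd p0 - 2 * d..snd p0 + 2 * d}"
      have r: "0 \<le> r" using c(1) by (simp add: r_def)
      have "inv_into D q ` U \<subseteq> V"
      proof
        fix w assume "w \<in> inv_into D q ` U"
        then obtain u where u: "u \<in> U" "w = inv_into D q u" by blast
        then obtain p where p: "p \<in> D" "u = q p" using U(2) by blast
        then have wp: "w = p" using u inv by simp
        have dd: "dist (q p0) (q p) \<le> d" unfolding d_def using U(1) p0(2) u(1) p(2) by (intro diameter_bounded_bound) auto
        have "c * (4 * dist (q p0) (q p)) powr \<tau> \<le> r"
          unfolding r_def using dd c(1) \<tau> by (intro mult_left_mono powr_mono2) auto
        then have "\<bar>fst p0 - fst p\<bar> \<le> r" "\<bar>snd p0 - snd p\<bar> \<le> 2 * d" using est[OF p0(1) p(1)] dd by linarith+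
        then have "fst p \<in> {fst p0 - r..fst p0 + r}" "snd p \<in> {snd p0 - 2 * d..snd p0 + 2 * d}" by auto
        then show "w \<in> V" unfolding wp V_def by (simp add: mem_Times_iff)
      qed
      moreover have "V \<in> sets lborel" unfolding V_def by (simp add: borel_Times)
      moreover have "emeasure lborel V \<le> ennreal (8 * c * 4 powr \<tau> * diameter U powr s)"
      proof -
        have "emeasure lborel V = emeasure lborel {fst p0 - r..fst p0 + r} * emeasure lborel {snd p0 - 2 * d..snd p0 + 2 * d}"
          unfolding V_def by (subst lborel_prod[symmetric]) (intro lborel.emeasure_pair_measure_Times; simp)
        also have "\<dots> = ennreal (2 * r) * ennreal (4 * d)" using r d by simp
        also have "\<dots> = ennreal (2 * r * (4 * d))" using r d by (intro ennreal_mult[symmetric]) auto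
        also have "2 * r * (4 * d) = 8 * c * 4 powr \<tau> * d powr s"
        proof (cases "d = 0")
          case False
          then have "d powr s = d powr \<tau> * d" using d by (simp add: \<tau>_def powr_diff)
          then show ?thesis using d by (simp add: r_def powr_mult)
        qed simp
        finally show ?thesis by (simp add: d_def)
      qed
      ultimately show "\<exists>V\<in>sets lborel. inv_into D q ` U \<subseteq> V \<and> emeasure lborel V \<le> ennreal (8 * c * 4 powr \<tau> * diameter U powr s)"
        by blast
    next
      show "D \<in> sets lborel" unfolding D_def by (simp add: borel_Times)
      show "D \<subseteq> inv_into D q ` (q ` D)"
      proof
        fix p assume "p \<in> D"
        then have "p = inv_into D q (q p)" "q p \<in> q ` D" using inv by auto
        then show "p \<in> inv_into D q ` (q ` D)" by (rule image_eqI)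
      qed
      have "emeasure lborel D = emeasure lborel {0..<1::real} * emeasure lborel {0..1::real}"
        unfolding D_def by (subst lborel_prod[symmetric]) (intro lborel.emeasure_pair_measure_Times; simp)
      then show "0 < emeasure lborel D" by simp
      show "0 < s" using s by simp
      show "0 \<le> 8 * c * 4 powr \<tau>" using c(1) by (intro mult_nonneg_nonneg) simp_all
    qed
    moreover have "q ` D \<subseteq> frontier G"
    proof
      fix w assume "w \<in> q ` D"
      then obtain p where p: "p \<in> D" "w = q p" by blast
      obtain y t where yt: "p = (y, t)" by (cases p)
      have "y \<in> {0..<1}" "t \<in> {0..1}" using p(1) by (simp_all add: D_def yt)
      from G(3)[OF inX[OF this(1)] this(2)] show "w \<in> frontier G" by (simp add: p(2) q_def yt)
    qed
    ultimately show ?thesis using hausdorff_null_mono[of s "frontier G" "q ` D"] by metis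
  qed
  have "hausdorff_dim (frontier G) = ereal \<beta>"
  proof (rule hausdorff_dim_eqI)
    show "hausdorff_measure 1 (frontier G) \<noteq> 0"
      using G(1) by (intro frontier_not_hausdorff_1_null) (auto simp: nevanlinna_domain_def)
    show "hausdorff_measure s (frontier G) = 0" if "\<beta> < s" for s
    proof -
      have "1 < s" "\<alpha> \<le> s - 1" using that assms by (simp_all add: \<alpha>_def)
      from G(2)[OF this(1) thin[OF this(2)]] show ?thesis .
    qed
    show "hausdorff_measure s (frontier G) \<noteq> 0" if "1 < s" "s < \<beta>" for s using that by (rule lower)
  qed (rule assms(1))
  with G(1) show ?thesis by (intro exI[of _ G] conjI)
qed

end
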